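(* Let $X$ be a Polish space, $p\in[1,\infty)$, $\alpha\in(0,1)$, $\gamma\in[0,\infty)$ and $c\in\mathcal D_p$. Then $$\tilde d_{c,\gamma,\alpha}:\mathcal P_p(X)\times\mathcal P_p(X)\to[0,\infty),\qquad \tilde d_{c,\gamma,\alpha}(\mu,\nu)=\begin{cases}d_{c,\gamma,\alpha}(\mu,\nu),&\mu\neq\nu,\\0,&\mu=\nu,\end{cases}$$ is a metric on $\mathcal P_p(X)$.
   Context: $X$ is a Polish space with Borel $\sigma$-algebra $\mathcal B$; $\mathcal P(X)$ is the set of Borel probability measures. $\mathcal D_p$ is the set of functions $c=d^p$ with $d:X\times X\to[0,\infty)$ a metric that is weakly lower semicontinuous (read: lower semicontinuous for the topology of $X\times X$). $\mathcal P_p(X)=\{\mu\in\mathcal P(X):\int_Xc(x,x_0)\,d\mu(x)<\infty\text{ for some }x_0\in X\}$. $\Pi(\mu,\nu)=\{\pi\in\mathcal P(X\times X):\pi(A\times X)=\mu(A),\ \pi(X\times B)=\nu(B)\ \forall A,B\in\mathcal B\}$; $\langle c,\pi\rangle=\int c\,d\pi$. For $\alpha\in(0,1)$ the $\alpha$-Rényi divergence is $R_\alpha(\mu\mid\nu)=\frac1{\alpha-1}\ln\left(\int\left(\frac{\rho_\mu}{\rho_\nu}\right)^\alpha d\nu\right)\in[0,\infty]$, where $\rho_\mu,\rho_\nu$ are densities with respect to any $\sigma$-finite non-negative reference measure dominating both (with $\ln 0=-\infty$). $\Pi_\gamma^\alpha(\mu,\nu)=\{\pi\in\Pi(\mu,\nu):R_\alpha(\pi\mid\mu\otimes\nu)\le\gamma\}$,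 and $d_{c,\gamma,\alpha}(\mu,\nu)=\left(\min_{\pi\in\Pi_\gamma^\alpha(\mu,\nu)}\langle c,\pi\rangle\right)^{1/p}$. *)

theory Defs
  imports "HOL-Probability.Probability"
begin

definition borel_probs :: "'a::topological_space measure set" where
  "borel_probs = {\<mu>. prob_space \<mu> \<and> sets \<mu> = sets borel}"

definition lower_semicontinuous :: "('a::topological_space \<Rightarrow> real) \<Rightarrow> bool" where
  "lower_semicontinuous f \<longleftrightarrow> (\<forall>r. open {x. r < f x})"

definition metric_costs :: "real \<Rightarrow> ('a::polish_space \<times> 'a \<Rightarrow> real) set" where
  "metric_costs p = {c. \<exists>d. Metric_space UNIV d \<and> lower_semicontinuous (\<lambda>(x, y). d x y)
                          \<and> c = (\<lambda>(x, y). d x y powr p)}"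

text \<open>The space \<open>\<P>\<^sub>p(X)\<close>; the exponent enters only through the cost \<open>c = d\<^sup>p\<close>.\<close>

definition prob_moment :: "('a::polish_space \<times> 'a \<Rightarrow> real) \<Rightarrow> 'a measure set" where
  "prob_moment c = {\<mu> \<in> borel_probs. \<exists>x0. (\<integral>\<^sup>+x. ennreal (c (x, x0)) \<partial>\<mu>) < \<infinity>}"

definition couplings :: "'a::polish_space measure \<Rightarrow> 'a measure \<Rightarrow> ('a \<times> 'a) measure set" where
  "couplings \<mu> \<nu> = {\<pi> \<in> borel_probs. \<forall>A\<in>sets borel. \<forall>B\<in>sets borel.
      emeasure \<pi> (A \<times> UNIV) = emeasure \<mu> A \<and> emeasure \<pi> (UNIV \<times> B) = emeasure \<nu> B}"

definition ext_ln :: "ennreal \<Rightarrow> ereal" where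
  "ext_ln t = (if t = 0 then -\<infinity> else if t = \<infinity> then \<infinity> else ereal (ln (enn2real t)))"

definition dominates :: "'a measure \<Rightarrow> 'a measure \<Rightarrow> bool" where
  "dominates \<xi> \<mu> \<longleftrightarrow> sets \<xi> = sets \<mu> \<and> absolutely_continuous \<xi> \<mu>"

text \<open>
  The formula for given densities \<open>f\<close>, \<open>g\<close> of \<open>\<mu>\<close>, \<open>\<nu>\<close>. The densities of finite measures are finite
  almost everywhere, and \<open>g \<noteq> 0\<close> holds \<open>\<nu>\<close>-almost everywhere, so neither \<open>enn2real \<infinity> = 0\<close> nor
  \<open>x / 0 = 0\<close> affects the integral. When the integral vanishes, the value is
  \<open>1 / (\<alpha> - 1) \<cdot> (-\<infinity>) = \<infinity>\<close>.
\<close>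

definition renyi_formula :: "real \<Rightarrow> ('a \<Rightarrow> ennreal) \<Rightarrow> ('a \<Rightarrow> ennreal) \<Rightarrow> 'a measure \<Rightarrow> ereal" where
  "renyi_formula \<alpha> f g \<nu> = ereal (1 / (\<alpha> - 1)) *
      ext_ln (\<integral>\<^sup>+x. ennreal ((enn2real (f x) / enn2real (g x)) powr \<alpha>) \<partial>\<nu>)"

text \<open>
  The reference measure is an arbitrary dominating one; \<open>renyi_divergence_eq\<close> below shows that
  neither its choice nor that of the densities matters.
\<close>

definition renyi_divergence :: "real \<Rightarrow> 'a measure \<Rightarrow> 'a measure \<Rightarrow> ereal" where
  "renyi_divergence \<alpha> \<mu> \<nu> =
    (let \<xi> = (SOME \<xi>. sigma_finite_measure \<xi> \<and> dominates \<xi> \<mu> \<and> dominates \<xi> \<nu>)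
     in renyi_formula \<alpha> (RN_deriv \<xi> \<mu>) (RN_deriv \<xi> \<nu>) \<nu>)"

definition renyi_couplings ::
    "real \<Rightarrow> real \<Rightarrow> 'a::polish_space measure \<Rightarrow> 'a measure \<Rightarrow> ('a \<times> 'a) measure set" where
  "renyi_couplings \<gamma> \<alpha> \<mu> \<nu> =
    {\<pi> \<in> couplings \<mu> \<nu>. renyi_divergence \<alpha> \<pi> (\<mu> \<Otimes>\<^sub>M \<nu>) \<le> ereal \<gamma>}"

definition ennreal_powr :: "ennreal \<Rightarrow> real \<Rightarrow> ennreal" where
  "ennreal_powr t a = (if t = \<infinity> then \<infinity> else ennreal (enn2real t powr a))"

text \<open>
  \<open>LEAST\<close> is the minimum, not the infimum: it is only meaningful if the minimum is attained.
\<close>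

definition renyi_dist ::
    "('a::polish_space \<times> 'a \<Rightarrow> real) \<Rightarrow> real \<Rightarrow> real \<Rightarrow> real \<Rightarrow> 'a measure \<Rightarrow> 'a measure \<Rightarrow> ennreal" where
  "renyi_dist c p \<gamma> \<alpha> \<mu> \<nu> =
    ennreal_powr (LEAST v. v \<in> (\<lambda>\<pi>. \<integral>\<^sup>+z. ennreal (c z) \<partial>\<pi>) ` renyi_couplings \<gamma> \<alpha> \<mu> \<nu>) (1 / p)"

text \<open>
  The value \<open>0\<close> outside \<open>\<P>\<^sub>p(X)\<close> is a convention: the locale \<open>Metric_space\<close> asks for symmetry on
  the whole type, although the distance is only defined on the carrier.
\<close>

definition renyi_dist_tilde ::
    "('a::polish_space \<times> 'a \<Rightarrow> real) \<Rightarrow> real \<Rightarrow> real \<Rightarrow> real \<Rightarrow> 'a measure \<Rightarrow> 'a measure \<Rightarrow> ennreal" where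
  "renyi_dist_tilde c p \<gamma> \<alpha> \<mu> \<nu> =
    (if \<mu> \<in> prob_moment c \<and> \<nu> \<in> prob_moment c \<and> \<mu> \<noteq> \<nu> then renyi_dist c p \<gamma> \<alpha> \<mu> \<nu> else 0)"

lemma AE_density_ratio_unique:
  assumes fin: "finite_measure \<mu>" "finite_measure \<nu>"
    and L1: "sigma_finite_measure L1" "f1 \<in> borel_measurable L1" "g1 \<in> borel_measurable L1"
      "density L1 f1 = \<mu>" "density L1 g1 = \<nu>"
    and L2: "sigma_finite_measure L2" "f2 \<in> borel_measurable L2" "g2 \<in> borel_measurable L2"
      "density L2 f2 = \<mu>" "density L2 g2 = \<nu>"
  shows "AE x in \<nu>. enn2real (f1 x) / enn2real (g1 x) = enn2real (f2 x) / enn2real (g2 x)"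
proof -
  have ratio: "(\<integral>\<^sup>+x. ennreal (enn2real (f x) / enn2real (g x)) * indicator E x \<partial>\<nu>) = emeasure \<mu> E"
    if "sigma_finite_measure L" and f: "f \<in> borel_measurable L" and g: "g \<in> borel_measurable L"
      and fd: "density L f = \<mu>" and gd: "density L g = \<nu>"
      and E: "E \<in> sets L" and sub: "E \<subseteq> {x. g x \<noteq> 0}" for L f g E
  proof -
    interpret sigma_finite_measure L by fact
    interpret m: finite_measure \<mu> by fact
    interpret n: finite_measure \<nu> by fact
    have If: "integral\<^sup>N L f \<noteq> \<infinity>"
    proof -
      have "integral\<^sup>N L f = emeasure \<mu> (space L)"
        unfolding fd[symmetric] using f by (auto simp: emeasure_density intro!: nn_integral_cong)
      then show ?thesis using m.emeasure_finite[of "space L"] by simp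
    qed
    have Ig: "integral\<^sup>N L g \<noteq> \<infinity>"
    proof -
      have "integral\<^sup>N L g = emeasure \<nu> (space L)"
        unfolding gd[symmetric] using g by (auto simp: emeasure_density intro!: nn_integral_cong)
      then show ?thesis using n.emeasure_finite[of "space L"] by simp
    qed
    have a: "AE x in L. f x \<noteq> \<infinity>" "AE x in L. g x \<noteq> \<infinity>"
      using nn_integral_PInf_AE[OF f If] nn_integral_PInf_AE[OF g Ig] by auto
    have "(\<integral>\<^sup>+x. ennreal (enn2real (f x) / enn2real (g x)) * indicator E x \<partial>\<nu>)
        = (\<integral>\<^sup>+x. g x * (ennreal (enn2real (f x) / enn2real (g x)) * indicator E x) \<partial>L)"
      unfolding gd[symmetric] using f g E by (subst nn_integral_density) auto
    also have "\<dots> = (\<integral>\<^sup>+x. f x * indicator E x \<partial>L)"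
    proof (rule nn_integral_cong_AE, use a in eventually_elim)
      fix x assume fx: "f x \<noteq> \<infinity>" and gx: "g x \<noteq> \<infinity>"
      show "g x * (ennreal (enn2real (f x) / enn2real (g x)) * indicator E x) = f x * indicator E x"
      proof (cases "x \<in> E")
        case True
        then have "g x \<noteq> 0" using sub by auto
        then have pos: "enn2real (g x) > 0" using gx
          by (metis enn2real_positive_iff infinity_ennreal_def top.not_eq_extremum zero_less_iff_neq_zero)
        have "g x * ennreal (enn2real (f x) / enn2real (g x))
            = ennreal (enn2real (g x)) * ennreal (enn2real (f x) / enn2real (g x))"
          using gx by (simp add: less_top)
        also have "\<dots> = ennreal (enn2real (f x))"
          using pos by (simp add: ennreal_mult[symmetric])
        also have "\<dots> = f x" using fx by (simp add: less_top)
        finally show ?thesis using True by simp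
      qed simp
    qed
    also have "\<dots> = emeasure \<mu> E" unfolding fd[symmetric] using f E by (simp add: emeasure_density)
    finally show ?thesis .
  qed
  have s1: "sets L1 = sets \<nu>" and s2: "sets L2 = sets \<nu>" and sm: "sets \<mu> = sets \<nu>"
    using L1(4,5) L2(5) by (metis sets_density)+
  have [measurable]: "f1 \<in> borel_measurable \<nu>" "g1 \<in> borel_measurable \<nu>"
    "f2 \<in> borel_measurable \<nu>" "g2 \<in> borel_measurable \<nu>"
    using L1 L2 measurable_cong_sets[OF s1 refl] measurable_cong_sets[OF s2 refl] by auto
  define A where "A = {x \<in> space \<nu>. g1 x \<noteq> 0 \<and> g2 x \<noteq> 0}"
  have A: "A \<in> sets \<nu>" unfolding A_def by measurable
  have pos1: "AE x in \<nu>. g1 x \<noteq> 0"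
    unfolding L1(5)[symmetric] AE_density[OF L1(3)] by auto
  have pos2: "AE x in \<nu>. g2 x \<noteq> 0"
    unfolding L2(5)[symmetric] AE_density[OF L2(3)] by auto
  let ?h = "\<lambda>f g x. ennreal (enn2real (f x) / enn2real (g x)) * indicator A x"
  interpret n: finite_measure \<nu> by fact
  have "density \<nu> (?h f1 g1) = density \<nu> (?h f2 g2)"
  proof (rule measure_eqI)
    fix E assume "E \<in> sets (density \<nu> (?h f1 g1))"
    then have E: "E \<in> sets \<nu>" by simp
    have AE: "A \<inter> E \<in> sets L1" "A \<inter> E \<in> sets L2" using A E s1 s2 by auto
    have "(\<integral>\<^sup>+x. ?h f1 g1 x * indicator E x \<partial>\<nu>) = emeasure \<mu> (A \<inter> E)"
      using ratio[OF L1 AE(1)] by (auto simp: A_def indicator_inter_arith mult.assoc)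
    moreover have "(\<integral>\<^sup>+x. ?h f2 g2 x * indicator E x \<partial>\<nu>) = emeasure \<mu> (A \<inter> E)"
      using ratio[OF L2 AE(2)] by (auto simp: A_def indicator_inter_arith mult.assoc)
    ultimately show "emeasure (density \<nu> (?h f1 g1)) E = emeasure (density \<nu> (?h f2 g2)) E"
      using E A by (simp add: emeasure_density)
  qed simp
  then have "AE x in \<nu>. ?h f1 g1 x = ?h f2 g2 x"
    using A by (intro n.density_unique) auto
  with pos1 pos2 show ?thesis
    using AE_space by eventually_elim (auto simp: A_def)
qed

lemma renyi_divergence_eq:
  assumes fin: "finite_measure \<mu>" "finite_measure \<nu>"
    and L: "sigma_finite_measure \<xi>" "f \<in> borel_measurable \<xi>" "g \<in> borel_measurable \<xi>"
      "density \<xi> f = \<mu>" "density \<xi> g = \<nu>"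
  shows "renyi_divergence \<alpha> \<mu> \<nu> = renyi_formula \<alpha> f g \<nu>"
proof -
  let ?P = "\<lambda>L. sigma_finite_measure L \<and> dominates L \<mu> \<and> dominates L \<nu>"
  define K where "K = (SOME L. ?P L)"
  have "?P \<xi>"
    using L absolutely_continuousI_density[OF L(2)] absolutely_continuousI_density[OF L(3)]
    by (auto simp: dominates_def)
  then have K: "?P K" unfolding K_def by (rule someI)
  then interpret K: sigma_finite_measure K by simp
  have "density K (RN_deriv K \<mu>) = \<mu>" "density K (RN_deriv K \<nu>) = \<nu>"
    using K by (auto simp: dominates_def intro!: K.density_RN_deriv)
  then have "AE x in \<nu>. enn2real (RN_deriv K \<mu> x) / enn2real (RN_deriv K \<nu> x)
                       = enn2real (f x) / enn2real (g x)"
    using K by (intro AE_density_ratio_unique[OF fin _ _ _ _ _ L]) auto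
  then have "(\<integral>\<^sup>+x. ennreal ((enn2real (RN_deriv K \<mu> x) / enn2real (RN_deriv K \<nu> x)) powr \<alpha>) \<partial>\<nu>)
           = (\<integral>\<^sup>+x. ennreal ((enn2real (f x) / enn2real (g x)) powr \<alpha>) \<partial>\<nu>)"
    by (intro nn_integral_cong_AE) (auto elim!: eventually_mono)
  then show ?thesis
    by (simp add: renyi_divergence_def renyi_formula_def K_def Let_def)
qed

end

theory Submission
  imports Defs
begin

text \<open>
  Limits of couplings with fixed marginals can be taken on Borel rectangles, where compactness is
  Tychonoff's theorem. A finitely additive bimeasure with tight marginals extends to a measure, so
  the limit is a coupling. Lower semicontinuous costs are suprema of simple functions over rectangles,
  and the constraint \<open>R\<^sub>\<alpha>(\<pi> | \<mu> \<otimes> \<nu>) \<le> \<gamma>\<close> is a family of linear inequalities in \<open>\<pi>\<close> by Young's inequality;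
  both pass to the limit, so the minimum is attained. For the triangle inequality an optimal coupling
  of \<open>\<mu>\<^sub>1\<close>, \<open>\<mu>\<^sub>2\<close> is continued to \<open>\<mu>\<^sub>3\<close> by the conditional law of the second one. This turns
  \<open>\<mu>\<^sub>1 \<otimes> \<mu>\<^sub>2\<close> into \<open>\<mu>\<^sub>1 \<otimes> \<mu>\<^sub>3\<close>, and by data processing the divergence does not increase; Minkowski's
  inequality bounds the cost.
\<close>

section \<open>Extension of tight bimeasures\<close>

text \<open>The diagonal coupling, which makes the unconstrained transport distance vanish at
  \<open>\<mu> = \<nu>\<close>, may violate the divergence constraint; hence the separate value 0 on
  the diagonal.

  Two obstacles shape the proof. The Young inequalities have test functions that are merely
  measurable, for which weak convergence is of no use. With fixed marginals, however, limits of
  rectangle masses stay dominated by \<open>\<mu>\<close> and \<open>\<nu>\<close>, and inner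
  regularity of these two measures restores countable additivity.

  Secondly, gluing must treat the coupling and the product it is compared with by the same kernel.
  So the dominating measure \<open>\<xi>\<close>, the sum of both, is glued once, and the two
  densities, functions of the first two points, are lifted. The kernel itself is replaced by one
  Radon-Nikodym derivative for each Borel set \<open>C\<close>, and the measure on triples comes
  from the same extension theorem as the limit couplings. Lifting keeps the Hellinger integral;
  projecting to the outer points only leaves fewer test functions, which is the data processing
  inequality.\<close>

lemma compact_inner_approx:
  fixes M :: "'a::{second_countable_topology, complete_space} measure"
  assumes "finite_measure M" "sets M = sets borel" "B \<in> sets borel" "0 < e"
  obtains K where "K \<subseteq> B" "compact K" "measure M (B - K) < e"
proof -
  interpret finite_measure M by fact
  have reg: "emeasure M B = (SUP K \<in> {K. K \<subseteq> B \<and> compact K}. emeasure M K)"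
    using assms by (intro inner_regular) auto
  have "\<exists>K\<in>{K. K \<subseteq> B \<and> compact K}. emeasure M B < emeasure M K + ennreal e"
  proof (rule ccontr)
    assume "\<not> ?thesis"
    then have *: "emeasure M K + ennreal e \<le> emeasure M B" if "K \<subseteq> B" "compact K" for K
      using that by (auto simp: not_less)
    have "(SUP K \<in> {K. K \<subseteq> B \<and> compact K}. emeasure M K + ennreal e) \<le> emeasure M B"
      using * by (auto intro!: SUP_least)
    moreover have "(SUP K \<in> {K. K \<subseteq> B \<and> compact K}. emeasure M K + ennreal e) = emeasure M B + ennreal e"
      unfolding reg by (intro ennreal_SUP_add_left) auto
    ultimately have "measure M B + e \<le> measure M B"
      using \<open>0 < e\<close> by (simp add: emeasure_eq_measure flip: ennreal_plus)
    with \<open>0 < e\<close> show False by simp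
  qed
  then obtain K where K: "K \<subseteq> B" "compact K" "emeasure M B < emeasure M K + ennreal e"
    by auto
  have "K \<in> sets M" using K assms by (simp add: compact_imp_closed)
  then have "measure M (B - K) = measure M B - measure M K"
    using K assms by (intro finite_measure_Diff) auto
  moreover have "measure M B < measure M K + e"
    using K(3) \<open>0 < e\<close> by (simp add: emeasure_eq_measure ennreal_less_iff flip: ennreal_plus)
  ultimately show ?thesis using that K by simp
qed

text \<open>Inner regularity of the complement: a compact subset of \<open>- B\<close> is closed, so
  its complement is an open superset of \<open>B\<close>.\<close>

lemma open_outer_approx:
  fixes M :: "'a::{second_countable_topology, complete_space} measure"
  assumes "finite_measure M" "sets M = sets borel" "B \<in> sets borel" "0 < e"
  obtains U where "B \<subseteq> U" "open U" "measure M (U - B) < e"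
proof -
  obtain K where K: "K \<subseteq> - B" "compact K" "measure M (- B - K) < e"
    using compact_inner_approx[OF assms(1,2) _ assms(4), of "- B"] assms(3)
    by (auto simp: Compl_eq_Diff_UNIV)
  show ?thesis
  proof
    show "B \<subseteq> - K" "open (- K)" using K by (auto simp: compact_imp_closed)
    have "- K - B = - B - K" by auto
    with K(3) show "measure M (- K - B) < e" by simp
  qed
qed

text \<open>
  Only finite additivity in each variable is required of a bimeasure: countable additivity of its
  extension is a consequence of the tightness of the two dominating measures.
\<close>

locale tight_bimeasure =
  fixes \<beta> :: "'a::{second_countable_topology, complete_space} set
      \<Rightarrow> 'b::{second_countable_topology, complete_space} set \<Rightarrow> real"
    and \<rho> :: "'a measure" and \<sigma> :: "'b measure"
  assumes fin1: "finite_measure \<rho>" and fin2: "finite_measure \<sigma>"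
    and sets1 [measurable_cong]: "sets \<rho> = sets borel"
    and sets2 [measurable_cong]: "sets \<sigma> = sets borel"
    and nonneg: "A \<in> sets borel \<Longrightarrow> B \<in> sets borel \<Longrightarrow> 0 \<le> \<beta> A B"
    and add1: "A \<in> sets borel \<Longrightarrow> A' \<in> sets borel \<Longrightarrow> B \<in> sets borel \<Longrightarrow> A \<inter> A' = {} \<Longrightarrow>
      \<beta> (A \<union> A') B = \<beta> A B + \<beta> A' B"
    and add2: "A \<in> sets borel \<Longrightarrow> B \<in> sets borel \<Longrightarrow> B' \<in> sets borel \<Longrightarrow> B \<inter> B' = {} \<Longrightarrow>
      \<beta> A (B \<union> B') = \<beta> A B + \<beta> A B'"
    and le1: "A \<in> sets borel \<Longrightarrow> B \<in> sets borel \<Longrightarrow> \<beta> A B \<le> measure \<rho> A"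
    and le2: "A \<in> sets borel \<Longrightarrow> B \<in> sets borel \<Longrightarrow> \<beta> A B \<le> measure \<sigma> B"
begin

lemma split1:
  assumes "A \<in> sets borel" "A' \<in> sets borel" "B \<in> sets borel"
  shows "\<beta> A B = \<beta> (A \<inter> A') B + \<beta> (A - A') B"
  using add1[of "A \<inter> A'" "A - A'" B] assms by (auto simp: Int_Diff_Un)

lemma split2:
  assumes "A \<in> sets borel" "B \<in> sets borel" "B' \<in> sets borel"
  shows "\<beta> A B = \<beta> A (B \<inter> B') + \<beta> A (B - B')"
  using add2[of A "B \<inter> B'" "B - B'"] assms by (auto simp: Int_Diff_Un)

lemma empty1: "B \<in> sets borel \<Longrightarrow> \<beta> {} B = 0"
  using add1[of "{}" "{}" B] by simp

lemma empty2: "A \<in> sets borel \<Longrightarrow> \<beta> A {} = 0"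
  using add2[of A "{}" "{}"] by simp

lemma mono1:
  assumes "A \<in> sets borel" "A' \<in> sets borel" "B \<in> sets borel" "A \<subseteq> A'"
  shows "\<beta> A B \<le> \<beta> A' B"
  using split1[of A' A B] nonneg[of "A' - A" B] assms by (auto simp: Int_absorb1)

lemma mono2:
  assumes "A \<in> sets borel" "B \<in> sets borel" "B' \<in> sets borel" "B \<subseteq> B'"
  shows "\<beta> A B \<le> \<beta> A B'"
  using split2[of A B' B] nonneg[of A "B' - B"] assms by (auto simp: Int_absorb1)

lemma rectangle_diff:
  assumes [measurable]: "A \<in> sets borel" "A' \<in> sets borel" "B \<in> sets borel" "B' \<in> sets borel"
    and "A' \<subseteq> A" "B' \<subseteq> B"
  shows "\<beta> A B \<le> \<beta> A' B' + measure \<rho> (A - A') + measure \<sigma> (B - B')"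
proof -
  have "\<beta> A B = \<beta> A' B + \<beta> (A - A') B" "\<beta> A' B = \<beta> A' B' + \<beta> A' (B - B')"
    using split1[of A A' B] split2[of A' B B'] assms by (simp_all add: Int_absorb1)
  moreover have "\<beta> (A - A') B \<le> measure \<rho> (A - A')" "\<beta> A' (B - B') \<le> measure \<sigma> (B - B')"
    by (auto intro!: le1 le2)
  ultimately show ?thesis by simp
qed

text \<open>Disjoint rectangles need not form a grid, so additivity in each variable does not apply
  at once. Cutting \<open>D n \<times> C n\<close> out of \<open>A \<times> B\<close> leaves the
  rectangles \<open>D n \<times> (B - C n)\<close> and \<open>(A - D n) \<times> B\<close>, and
  every other piece splits along \<open>D n\<close> into a part of each. The induction therefore
  lets \<open>A\<close>, \<open>B\<close>, \<open>D\<close>, \<open>C\<close> vary.\<close>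

lemma superadditive:
  assumes "finite I" "A \<in> sets borel" "B \<in> sets borel"
    and "\<And>i. i \<in> I \<Longrightarrow> D i \<in> sets borel" "\<And>i. i \<in> I \<Longrightarrow> C i \<in> sets borel"
    and "disjoint_family_on (\<lambda>i. D i \<times> C i) I" "\<And>i. i \<in> I \<Longrightarrow> D i \<times> C i \<subseteq> A \<times> B"
  shows "(\<Sum>i\<in>I. \<beta> (D i) (C i)) \<le> \<beta> A B"
  using assms
proof (induction I arbitrary: A B D C rule: finite_induct)
  case empty
  then show ?case by (simp add: nonneg)
next
  case (insert n I)
  note [measurable] = insert.prems(1,2)
  have [measurable]: "D i \<in> sets borel" "C i \<in> sets borel" if "i \<in> insert n I" for i
    using insert.prems(3,4) that by auto
  have [measurable]: "D n \<in> sets borel" "C n \<in> sets borel" by auto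
  have disjI: "disjoint_family_on (\<lambda>i. D i \<times> C i) I"
    using insert.prems(5) by (auto simp: disjoint_family_on_def)
  have disj: "D i \<times> C i \<inter> D j \<times> C j = {}" if "i \<in> insert n I" "j \<in> insert n I" "i \<noteq> j" for i j
    using insert.prems(5) that unfolding disjoint_family_on_def by blast
  show ?case
  \<comment> \<open>An empty product says nothing about its sides, so
    \<open>D n \<subseteq> A\<close> and \<open>C n \<subseteq> B\<close> may fail; but then its
    mass is 0.\<close>
  proof (cases "D n = {} \<or> C n = {}")
    case True
    then have "\<beta> (D n) (C n) = 0" by (auto simp: empty1 empty2)
    moreover have "(\<Sum>i\<in>I. \<beta> (D i) (C i)) \<le> \<beta> A B"
      using insert.prems by (intro insert.IH) (auto simp: disjoint_family_on_def)
    ultimately show ?thesis using insert.hyps by simp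
  next
    case False
    then have sub: "D n \<subseteq> A" "C n \<subseteq> B" using insert.prems(6)[of n] by auto
    \<comment> \<open>If \<open>D i\<close> meets \<open>D n\<close>, disjointness of the rectangles
      forces \<open>C i\<close> to miss \<open>C n\<close>; otherwise both sides are 0.\<close>
    have *: "\<beta> (D i \<inter> D n) (C i) = \<beta> (D i \<inter> D n) (C i - C n)" if "i \<in> I" for i
    proof (cases "D i \<inter> D n = {}")
      case True
      then show ?thesis using that by (simp add: empty1)
    next
      case False
      then have "C i \<inter> C n = {}" using disj[of i n] that insert.hyps by auto
      then show ?thesis by (simp add: Diff_triv)
    qed
    have "(\<Sum>i\<in>insert n I. \<beta> (D i) (C i))
        = \<beta> (D n) (C n) + (\<Sum>i\<in>I. \<beta> (D i \<inter> D n) (C i - C n)) + (\<Sum>i\<in>I. \<beta> (D i - D n) (C i))"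
    proof -
      have "(\<Sum>i\<in>I. \<beta> (D i) (C i)) = (\<Sum>i\<in>I. \<beta> (D i \<inter> D n) (C i - C n) + \<beta> (D i - D n) (C i))"
        by (intro sum.cong refl) (subst split1[of _ "D n"], auto simp: *)
      then show ?thesis using insert.hyps by (simp add: sum.distrib)
    qed
    also have "(\<Sum>i\<in>I. \<beta> (D i \<inter> D n) (C i - C n)) \<le> \<beta> (D n) (B - C n)"
    proof (rule insert.IH)
      show "disjoint_family_on (\<lambda>i. (D i \<inter> D n) \<times> (C i - C n)) I"
        by (rule disjoint_family_on_bisimulation[OF disjI]) auto
      show "(D i \<inter> D n) \<times> (C i - C n) \<subseteq> D n \<times> (B - C n)" if "i \<in> I" for i
        using insert.prems(6)[of i] that by auto
    qed auto
    also have "(\<Sum>i\<in>I. \<beta> (D i - D n) (C i)) \<le> \<beta> (A - D n) B"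
    proof (rule insert.IH)
      show "disjoint_family_on (\<lambda>i. (D i - D n) \<times> C i) I"
        by (rule disjoint_family_on_bisimulation[OF disjI]) auto
      show "(D i - D n) \<times> C i \<subseteq> (A - D n) \<times> B" if "i \<in> I" for i
        using insert.prems(6)[of i] that by auto
    qed auto
    also have "\<beta> (D n) (C n) + \<beta> (D n) (B - C n) + \<beta> (A - D n) B = \<beta> A B"
      using split1[of A "D n" B] split2[of "D n" B "C n"] sub by (simp add: Int_absorb1)
    finally show ?thesis by simp
  qed
qed

text \<open>The same cut as for superadditivity: the part of \<open>A \<times> B\<close> outside
  \<open>D n \<times> C n\<close> consists of \<open>(A - D n) \<times> B\<close> and
  \<open>(A \<inter> D n) \<times> (B - C n)\<close>, and the remaining rectangles, split along
  \<open>D n\<close>, cover these two.\<close>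

lemma subadditive:
  assumes "finite I" "A \<in> sets borel" "B \<in> sets borel"
    and "\<And>i. i \<in> I \<Longrightarrow> D i \<in> sets borel" "\<And>i. i \<in> I \<Longrightarrow> C i \<in> sets borel"
    and "A \<times> B \<subseteq> (\<Union>i\<in>I. D i \<times> C i)"
  shows "\<beta> A B \<le> (\<Sum>i\<in>I. \<beta> (D i) (C i))"
  using assms
proof (induction I arbitrary: A B D C rule: finite_induct)
  case empty
  then show ?case by (auto simp: empty1 empty2)
next
  case (insert n I)
  note [measurable] = insert.prems(1,2)
  have [measurable]: "D i \<in> sets borel" "C i \<in> sets borel" if "i \<in> insert n I" for i
    using insert.prems(3,4) that by auto
  have [measurable]: "D n \<in> sets borel" "C n \<in> sets borel" by auto
  have "\<beta> A B = \<beta> (A - D n) B + \<beta> (A \<inter> D n) (B - C n) + \<beta> (A \<inter> D n) (B \<inter> C n)"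
    using split1[of A "D n" B] split2[of "A \<inter> D n" B "C n"] by simp
  also have "\<beta> (A - D n) B \<le> (\<Sum>i\<in>I. \<beta> (D i - D n) (C i))"
    using insert.prems(5) by (intro insert.IH) auto
  also have "\<beta> (A \<inter> D n) (B - C n) \<le> (\<Sum>i\<in>I. \<beta> (D i \<inter> D n) (C i))"
    using insert.prems(5) by (intro insert.IH) auto
  also have "\<beta> (A \<inter> D n) (B \<inter> C n) \<le> \<beta> (D n) (C n)"
    using mono1[of "A \<inter> D n" "D n" "B \<inter> C n"] mono2[of "D n" "B \<inter> C n" "C n"] by simp
  also have "(\<Sum>i\<in>I. \<beta> (D i - D n) (C i)) + (\<Sum>i\<in>I. \<beta> (D i \<inter> D n) (C i)) + \<beta> (D n) (C n)
      = (\<Sum>i\<in>insert n I. \<beta> (D i) (C i))"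
  proof -
    have "(\<Sum>i\<in>I. \<beta> (D i) (C i)) = (\<Sum>i\<in>I. \<beta> (D i \<inter> D n) (C i) + \<beta> (D i - D n) (C i))"
      by (intro sum.cong refl split1) auto
    then show ?thesis using insert.hyps by (simp add: sum.distrib)
  qed
  finally show ?case by simp
qed

lemma (in -) sum_half_power_le: "(\<Sum>n<N. (1/2::real) ^ Suc n) \<le> 1"
proof -
  have "(\<Sum>n<N. (1/2::real) ^ Suc n) = 1 - (1/2) ^ N" by (induction N) auto
  then show ?thesis by simp
qed

text \<open>Compactness turns the countable cover into a finite one: \<open>A \<times> B\<close> is
  shrunk to a compact \<open>K \<times> L\<close> and each \<open>D n \<times> C n\<close> is
  enlarged to an open rectangle. The shrinking costs \<open>2 * e\<close>; the n-th enlargement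
  costs \<open>2 * e * (1/2) ^ Suc n\<close>, so all of them together cost at most another
  \<open>2 * e\<close>.\<close>

lemma countably_subadditive:
  assumes [measurable]: "A \<in> sets borel" "B \<in> sets borel"
    "\<And>n::nat. D n \<in> sets borel" "\<And>n. C n \<in> sets borel"
    and sub: "A \<times> B \<subseteq> (\<Union>n. D n \<times> C n)" and e: "0 < e"
  shows "\<exists>N. \<beta> A B \<le> (\<Sum>n<N. \<beta> (D n) (C n)) + 4 * e"
proof -
  obtain K where K: "K \<subseteq> A" "compact K" "measure \<rho> (A - K) < e"
    using compact_inner_approx[OF fin1 sets1 assms(1) e] .
  obtain L where L: "L \<subseteq> B" "compact L" "measure \<sigma> (B - L) < e"
    using compact_inner_approx[OF fin2 sets2 assms(2) e] .
  have KL [measurable]: "K \<in> sets borel" "L \<in> sets borel"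
    using K(2) L(2) by (auto simp: compact_imp_closed)
  have "\<exists>U. D n \<subseteq> U \<and> open U \<and> measure \<rho> (U - D n) < e * (1/2) ^ Suc n" for n
    by (rule open_outer_approx[OF fin1 sets1 assms(3), of "e * (1/2) ^ Suc n"]) (use e in auto)
  then obtain U where U: "\<And>n. D n \<subseteq> U n" "\<And>n. open (U n)"
    "\<And>n. measure \<rho> (U n - D n) < e * (1/2) ^ Suc n" by metis
  have "\<exists>V. C n \<subseteq> V \<and> open V \<and> measure \<sigma> (V - C n) < e * (1/2) ^ Suc n" for n
    by (rule open_outer_approx[OF fin2 sets2 assms(4), of "e * (1/2) ^ Suc n"]) (use e in auto)
  then obtain V where V: "\<And>n. C n \<subseteq> V n" "\<And>n. open (V n)"
    "\<And>n. measure \<sigma> (V n - C n) < e * (1/2) ^ Suc n" by metis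
  have UV [measurable]: "U n \<in> sets borel" "V n \<in> sets borel" for n
    using U(2) V(2) by auto
  have "K \<times> L \<subseteq> (\<Union>n\<in>UNIV. U n \<times> V n)"
  proof -
    have "K \<times> L \<subseteq> A \<times> B" using K(1) L(1) by auto
    also note sub
    also have "(\<Union>n. D n \<times> C n) \<subseteq> (\<Union>n. U n \<times> V n)" using U(1) V(1) by blast
    finally show ?thesis by simp
  qed
  with compact_Times[OF K(2) L(2)]
  obtain J where J: "finite J" "K \<times> L \<subseteq> (\<Union>n\<in>J. U n \<times> V n)"
    using U(2) V(2) by (elim compactE_image[where f = "\<lambda>n. U n \<times> V n" and C = UNIV]) (auto intro: open_Times)
  from J(1) obtain N where N: "J \<subseteq> {..<N}" by (meson finite_nat_iff_bounded)
  have "\<beta> A B \<le> \<beta> K L + measure \<rho> (A - K) + measure \<sigma> (B - L)"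
    using K L by (intro rectangle_diff) auto
  also have "\<dots> \<le> \<beta> K L + 2 * e" using K(3) L(3) by simp
  also have "\<beta> K L \<le> (\<Sum>n<N. \<beta> (U n) (V n))"
  proof (rule subadditive)
    show "K \<times> L \<subseteq> (\<Union>n<N. U n \<times> V n)"
      using J(2) N by (meson UN_mono order_trans order_refl)
  qed (use KL UV in auto)
  also have "\<dots> \<le> (\<Sum>n<N. \<beta> (D n) (C n) + 2 * e * (1/2) ^ Suc n)"
  proof (rule sum_mono)
    fix n
    have "\<beta> (U n) (V n) \<le> \<beta> (D n) (C n) + measure \<rho> (U n - D n) + measure \<sigma> (V n - C n)"
      using U(1) V(1) by (intro rectangle_diff) auto
    then show "\<beta> (U n) (V n) \<le> \<beta> (D n) (C n) + 2 * e * (1/2) ^ Suc n"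
      using U(3)[of n] V(3)[of n] by simp
  qed
  also have "\<dots> = (\<Sum>n<N. \<beta> (D n) (C n)) + 2 * e * (\<Sum>n<N. (1/2) ^ Suc n)"
    by (simp add: sum.distrib sum_distrib_left)
  also have "\<dots> \<le> (\<Sum>n<N. \<beta> (D n) (C n)) + 2 * e * 1"
    using e sum_half_power_le by (intro add_left_mono mult_left_mono) auto
  finally show ?thesis by (intro exI[of _ N]) simp
qed

text \<open>The hypothesis of Caratheodory's theorem. Superadditivity bounds all partial sums; the
  opposite inequality is where tightness enters.\<close>

lemma countably_additive_rectangles:
  assumes [measurable]: "A \<in> sets borel" "B \<in> sets borel"
    "\<And>n::nat. D n \<in> sets borel" "\<And>n. C n \<in> sets borel"
    and disj: "disjoint_family (\<lambda>n. D n \<times> C n)" and eq: "(\<Union>n. D n \<times> C n) = A \<times> B"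
  shows "(\<Sum>n. ennreal (\<beta> (D n) (C n))) = ennreal (\<beta> A B)"
proof (rule antisym)
  have "(\<Sum>n<N. ennreal (\<beta> (D n) (C n))) \<le> ennreal (\<beta> A B)" for N
  proof -
    have "(\<Sum>n<N. \<beta> (D n) (C n)) \<le> \<beta> A B"
    proof (rule superadditive)
      show "D n \<times> C n \<subseteq> A \<times> B" for n using eq by blast
    qed (use disj in \<open>auto simp: disjoint_family_on_def\<close>)
    then show ?thesis by (simp add: sum_ennreal nonneg ennreal_leI)
  qed
  then show "(\<Sum>n. ennreal (\<beta> (D n) (C n))) \<le> ennreal (\<beta> A B)"
    by (intro suminf_le_const) auto
next
  show "ennreal (\<beta> A B) \<le> (\<Sum>n. ennreal (\<beta> (D n) (C n)))"
  proof (rule ennreal_le_epsilon)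
    fix e :: real assume "0 < e"
    then obtain N where N: "\<beta> A B \<le> (\<Sum>n<N. \<beta> (D n) (C n)) + 4 * (e / 4)"
      using countably_subadditive[of A B D C "e / 4"] eq by auto
    have "ennreal (\<beta> A B) \<le> ennreal ((\<Sum>n<N. \<beta> (D n) (C n)) + e)"
      using N by (intro ennreal_leI) simp
    also have "\<dots> = (\<Sum>n<N. ennreal (\<beta> (D n) (C n))) + ennreal e"
      using \<open>0 < e\<close> by (simp add: sum_ennreal nonneg sum_nonneg ennreal_plus)
    also have "(\<Sum>n<N. ennreal (\<beta> (D n) (C n))) \<le> (\<Sum>n. ennreal (\<beta> (D n) (C n)))"
      by (intro sum_le_suminf) auto
    finally show "ennreal (\<beta> A B) \<le> (\<Sum>n. ennreal (\<beta> (D n) (C n))) + ennreal e"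
      by simp
  qed
qed

end

abbreviation borel_rectangles :: "('a::topological_space \<times> 'b::topological_space) set set" where
  "borel_rectangles \<equiv> {A \<times> B | A B. A \<in> sets borel \<and> B \<in> sets borel}"

lemma semiring_borel_rectangles:
  "semiring_of_sets UNIV (borel_rectangles :: ('a::topological_space \<times> 'b::topological_space) set set)"
proof (unfold_locales, safe)
  show "\<exists>A B. ({} :: ('a \<times> 'b) set) = A \<times> B \<and> A \<in> sets borel \<and> B \<in> sets borel"
    by (intro exI[of _ "{}"]) auto
next
  fix A A' :: "'a set" and B B' :: "'b set"
  assume [measurable]: "A \<in> sets borel" "B \<in> sets borel" "A' \<in> sets borel" "B' \<in> sets borel"
  show "\<exists>A'' B''. A \<times> B \<inter> A' \<times> B' = A'' \<times> B'' \<and> A'' \<in> sets borel \<and> B'' \<in> sets borel"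
    by (intro exI[of _ "A \<inter> A'"] exI[of _ "B \<inter> B'"]) auto
  show "\<exists>C\<subseteq>borel_rectangles. finite C \<and> disjoint C \<and> A \<times> B - A' \<times> B' = \<Union> C"
  \<comment> \<open>The difference is an L-shaped region, cut into two disjoint rectangles.\<close>
  proof (intro exI[of _ "{(A - A') \<times> B, (A \<inter> A') \<times> (B - B')}"] conjI subsetI)
    fix S assume "S \<in> {(A - A') \<times> B, (A \<inter> A') \<times> (B - B')}"
    moreover have "A - A' \<in> sets borel" "A \<inter> A' \<in> sets borel" "B - B' \<in> sets borel"
      by auto
    ultimately show "S \<in> borel_rectangles" using \<open>B \<in> sets borel\<close> by blast
  qed (auto simp: disjoint_def)
qed simp

lemma sets_borel_rectangles:
  "sets (borel :: ('a::second_countable_topology \<times> 'b::second_countable_topology) measure)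
     = sigma_sets UNIV borel_rectangles"
  unfolding borel_prod[symmetric] sets_pair_measure by (simp cong: conj_cong)

theorem (in tight_bimeasure) bimeasure_extension:
  obtains \<pi> :: "('a \<times> 'b) measure" where "sets \<pi> = sets borel"
    "\<And>A B. A \<in> sets borel \<Longrightarrow> B \<in> sets borel \<Longrightarrow> emeasure \<pi> (A \<times> B) = ennreal (\<beta> A B)"
proof -
  let ?P = "\<lambda>(A::'a set) (B::'b set). A \<in> sets borel \<and> B \<in> sets borel"
  define \<pi> where "\<pi> = extend_measure UNIV {(A, B). ?P A B} (\<lambda>(A, B). A \<times> B) (\<lambda>(A, B). ennreal (\<beta> A B))"
  have "sets \<pi> = sets borel"
  proof -
    have "(\<lambda>(A, B). A \<times> B) ` {(A, B). ?P A B} = borel_rectangles" by auto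
    then show ?thesis unfolding \<pi>_def sets_borel_rectangles by (subst sets_extend_measure) auto
  qed
  moreover have "emeasure \<pi> (A \<times> B) = ennreal (\<beta> A B)" if "?P A B" for A B
  proof (rule extend_measure_caratheodory_pair[OF \<pi>_def that])
    show "semiring_of_sets UNIV {A \<times> B | A B. ?P A B}" by (rule semiring_borel_rectangles)
  next
    fix A B assume "?P A B" "A \<times> B = {}"
    then show "ennreal (\<beta> A B) = 0" by (auto simp: empty1 empty2)
  next
    \<comment> \<open>A nonempty product determines its sides; an empty one has many index pairs,
      all of value 0.\<close>
    fix A B A' B' assume "?P A B" "?P A' B'" "A \<times> B = A' \<times> B'"
    then show "ennreal (\<beta> A B) = ennreal (\<beta> A' B')"
      by (auto simp: times_eq_iff empty1 empty2)
  next
    fix D C A B assume "\<And>n::nat. ?P (D n) (C n)" "?P A B" "disjoint_family (\<lambda>n. D n \<times> C n)"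
      "(\<Union>n. D n \<times> C n) = A \<times> B"
    then show "(\<Sum>n. ennreal (\<beta> (D n) (C n))) = ennreal (\<beta> A B)"
      by (intro countably_additive_rectangles) auto
  qed auto
  ultimately show thesis using that by blast
qed

section \<open>Compactness of couplings\<close>

lemma couplingsD:
  assumes "\<pi> \<in> couplings \<mu> \<nu>"
  shows "prob_space \<pi>" "sets \<pi> = sets borel" "space \<pi> = UNIV"
    and "A \<in> sets borel \<Longrightarrow> emeasure \<pi> (A \<times> UNIV) = emeasure \<mu> A"
    and "B \<in> sets borel \<Longrightarrow> emeasure \<pi> (UNIV \<times> B) = emeasure \<nu> B"
  using assms sets_eq_imp_space_eq[of \<pi> borel] by (auto simp: couplings_def borel_probs_def)

lemma borel_probsD:
  assumes "\<mu> \<in> borel_probs"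
  shows "prob_space \<mu>" "sets \<mu> = sets borel" "space \<mu> = UNIV"
  using assms sets_eq_imp_space_eq[of \<mu> borel] by (auto simp: borel_probs_def)

text \<open>Tychonoff's theorem yields a cluster point for every index type, but in general no
  convergent subsequence; hence a filter. \<open>G \<le> sequentially\<close> ensures that ordinary
  limits remain limits along \<open>G\<close>.\<close>

lemma bounded_sequence_cluster:
  fixes u :: "nat \<Rightarrow> 'i \<Rightarrow> real"
  assumes "\<And>n i. u n i \<in> {0..1}"
  obtains G x where "G \<noteq> bot" "G \<le> sequentially" "\<And>i. ((\<lambda>n. u n i) \<longlongrightarrow> x i) G"
proof -
  let ?K = "PiE UNIV (\<lambda>_::'i. {0..1::real})"
  have "compactin (product_topology (\<lambda>_. euclidean) UNIV) ?K"
    by (simp add: compactin_PiE)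
  then have "compact ?K" by (simp add: euclidean_product_topology)
  moreover have "filtermap u sequentially \<noteq> bot" by (simp add: filtermap_bot_iff)
  moreover have "eventually (\<lambda>x. x \<in> ?K) (filtermap u sequentially)"
    using assms by (auto simp: eventually_filtermap PiE_iff intro!: always_eventually)
  ultimately obtain x where x: "inf (nhds x) (filtermap u sequentially) \<noteq> bot"
    unfolding compact_filter by blast
  \<comment> \<open>The neighbourhoods of \<open>x\<close> are pulled back along \<open>u\<close>;
    the result is a proper filter because \<open>x\<close> is a cluster point of the
    sequence.\<close>
  define G where "G = inf (filtercomap u (nhds x)) sequentially"
  show thesis
  proof
    show "G \<noteq> bot"
    proof
      assume "G = bot"
      then obtain P Q where P: "eventually P (nhds x)" and Q: "eventually Q sequentially"
        and PQ: "\<And>n. P (u n) \<Longrightarrow> Q n \<Longrightarrow> False"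
        unfolding trivial_limit_def G_def eventually_inf eventually_filtercomap by metis
      have "eventually (\<lambda>y. \<not> P y) (filtermap u sequentially)"
        unfolding eventually_filtermap using Q by eventually_elim (use PQ in auto)
      with P have "eventually (\<lambda>_. False) (inf (nhds x) (filtermap u sequentially))"
        unfolding eventually_inf by blast
      with x show False by (simp add: trivial_limit_def)
    qed
    show "G \<le> sequentially" by (simp add: G_def)
    fix i
    have "filterlim u (nhds x) G"
      unfolding G_def by (rule filterlim_mono[OF filterlim_filtercomap]) auto
    moreover have "((\<lambda>x. x i) \<longlongrightarrow> x i) (nhds x)"
    proof (rule topological_tendstoI)
      fix S :: "real set" assume "open S" "x i \<in> S"
      then show "eventually (\<lambda>x. x i \<in> S) (nhds x)"
        using open_vimage[OF _ continuous_on_product_coordinates[of i]]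
        unfolding eventually_nhds by (intro exI[of _ "(\<lambda>x. x i) -` S"]) auto
    qed
    ultimately show "((\<lambda>n. u n i) \<longlongrightarrow> x i) G"
      by (rule filterlim_compose[rotated])
  qed
qed

text \<open>
  The limit is along a filter, so that all Borel rectangles, and not only countably many, can be
  treated at once.
\<close>

locale rectangle_limit =
  fixes G :: "nat filter"
    and \<pi> :: "nat \<Rightarrow> ('a::second_countable_topology \<times> 'b::second_countable_topology) measure"
    and \<kappa> :: "('a \<times> 'b) measure"
  assumes nontrivial: "G \<noteq> bot"
    and prob_seq: "prob_space (\<pi> n)" and sets_seq [measurable_cong]: "sets (\<pi> n) = sets borel"
    and prob_lim: "prob_space \<kappa>" and sets_lim [measurable_cong]: "sets \<kappa> = sets borel"
    and rectangles: "A \<in> sets borel \<Longrightarrow> B \<in> sets borel \<Longrightarrow>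
      ((\<lambda>n. measure (\<pi> n) (A \<times> B)) \<longlongrightarrow> measure \<kappa> (A \<times> B)) G"

text \<open>Finite additivity and the bounds by the marginals are closed conditions, so the
  pointwise limit \<open>\<beta>\<close> inherits them. Countable additivity is not closed; it is
  recovered from the bounds by \<open>bimeasure_extension\<close>. The limit has the right marginals
  because the masses of \<open>A \<times> UNIV\<close> and \<open>UNIV \<times> A\<close> are
  constant along the sequence.\<close>

lemma couplings_compact:
  fixes \<mu> \<nu> :: "'a::polish_space measure"
  assumes \<mu>: "\<mu> \<in> borel_probs" and \<nu>: "\<nu> \<in> borel_probs"
    and \<pi>: "\<And>n::nat. \<pi> n \<in> couplings \<mu> \<nu>"
  obtains G \<kappa> where "G \<le> sequentially" "rectangle_limit G \<pi> \<kappa>" "\<kappa> \<in> couplings \<mu> \<nu>"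
proof -
  interpret \<mu>: prob_space \<mu> using \<mu> by (rule borel_probsD)
  interpret \<nu>: prob_space \<nu> using \<nu> by (rule borel_probsD)
  interpret \<pi>: prob_space "\<pi> n" for n using couplingsD(1)[OF \<pi>] .
  have sp: "sets (\<pi> n) = sets borel" for n using couplingsD(2)[OF \<pi>] .
  note [measurable_cong] = sp
  have marg: "measure (\<pi> n) (A \<times> UNIV) = measure \<mu> A" "measure (\<pi> n) (UNIV \<times> A) = measure \<nu> A"
    if "A \<in> sets borel" for A n
    using couplingsD(4,5)[OF \<pi> that, of n] by (simp_all add: measure_def)
  obtain G x where G: "G \<noteq> bot" "G \<le> sequentially"
    and x: "\<And>p. ((\<lambda>n. measure (\<pi> n) (fst p \<times> snd p)) \<longlongrightarrow> x p) G"
    using bounded_sequence_cluster[of "\<lambda>n p. measure (\<pi> n) (fst p \<times> snd p)"] by auto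
  define \<beta> where "\<beta> A B = x (A, B)" for A B
  have lim: "((\<lambda>n. measure (\<pi> n) (A \<times> B)) \<longlongrightarrow> \<beta> A B) G" for A B
    using x[of "(A, B)"] by (simp add: \<beta>_def)
  have bm: "A \<in> sets borel \<Longrightarrow> B \<in> sets borel \<Longrightarrow> A \<times> B \<in> sets (\<pi> n)" for A B n
    unfolding sp borel_prod[symmetric] by (rule pair_measureI)
  interpret tight_bimeasure \<beta> \<mu> \<nu>
  proof
    show "sets \<mu> = sets borel" "sets \<nu> = sets borel" using \<mu> \<nu> by (simp_all add: borel_probs_def)
    fix A B :: "'a set" assume [measurable]: "A \<in> sets borel" "B \<in> sets borel"
    show "0 \<le> \<beta> A B" by (rule tendsto_lowerbound[OF lim _ G(1)]) auto
    have "measure (\<pi> n) (A \<times> B) \<le> measure \<mu> A" "measure (\<pi> n) (A \<times> B) \<le> measure \<nu> B" for n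
      unfolding marg(1)[symmetric, of A n, OF \<open>A \<in> sets borel\<close>] marg(2)[symmetric, of B n, OF \<open>B \<in> sets borel\<close>]
      by (intro \<pi>.finite_measure_mono bm; auto)+
    then show "\<beta> A B \<le> measure \<mu> A" "\<beta> A B \<le> measure \<nu> B"
      by (auto intro!: tendsto_upperbound[OF lim _ G(1)])
    fix A' :: "'a set" assume [measurable]: "A' \<in> sets borel" and "A \<inter> A' = {}"
    then have "measure (\<pi> n) ((A \<union> A') \<times> B) = measure (\<pi> n) (A \<times> B) + measure (\<pi> n) (A' \<times> B)" for n
      unfolding Sigma_Un_distrib1 by (intro \<pi>.finite_measure_Union bm) auto
    then show "\<beta> (A \<union> A') B = \<beta> A B + \<beta> A' B"
      using lim[of "A \<union> A'" B] tendsto_add[OF lim[of A B] lim[of A' B]]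
      by (simp add: tendsto_unique[OF G(1)])
  next
    fix A B B' :: "'a set" assume [measurable]: "A \<in> sets borel" "B \<in> sets borel" "B' \<in> sets borel" and "B \<inter> B' = {}"
    then have "measure (\<pi> n) (A \<times> (B \<union> B')) = measure (\<pi> n) (A \<times> B) + measure (\<pi> n) (A \<times> B')" for n
      unfolding Sigma_Un_distrib2 by (intro \<pi>.finite_measure_Union bm) auto
    then show "\<beta> A (B \<union> B') = \<beta> A B + \<beta> A B'"
      using lim[of A "B \<union> B'"] tendsto_add[OF lim[of A B] lim[of A B']]
      by (simp add: tendsto_unique[OF G(1)])
  qed unfold_locales
  obtain \<kappa> where sk: "sets \<kappa> = sets borel"
    and \<kappa>: "\<And>A B. A \<in> sets borel \<Longrightarrow> B \<in> sets borel \<Longrightarrow> emeasure \<kappa> (A \<times> B) = ennreal (\<beta> A B)"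
    using bimeasure_extension by blast
  have \<beta>: "\<beta> A UNIV = measure \<mu> A" "\<beta> UNIV A = measure \<nu> A" if "A \<in> sets borel" for A
    using lim[of A UNIV] lim[of UNIV A] that by (simp_all add: marg tendsto_const_iff G(1))
  have m: "emeasure \<kappa> (A \<times> UNIV) = emeasure \<mu> A" "emeasure \<kappa> (UNIV \<times> A) = emeasure \<nu> A"
    if "A \<in> sets borel" for A
    using \<kappa>[of A UNIV] \<kappa>[of UNIV A] \<beta>[OF that] that
    by (simp_all add: \<mu>.emeasure_eq_measure \<nu>.emeasure_eq_measure)
  have "emeasure \<kappa> (space \<kappa>) = 1"
    using m(1)[of UNIV] \<mu>.emeasure_space_1 borel_probsD(3)[OF \<mu>] sets_eq_imp_space_eq[OF sk] by simp
  then have pk: "prob_space \<kappa>" by (rule prob_spaceI)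
  show thesis
  proof
    show "G \<le> sequentially" by fact
    show "\<kappa> \<in> couplings \<mu> \<nu>"
      using pk sk m by (auto simp: couplings_def borel_probs_def)
    show "rectangle_limit G \<pi> \<kappa>"
    proof (rule rectangle_limit.intro)
      fix A B :: "'a set" assume A: "A \<in> sets borel" "B \<in> sets borel"
      then have "measure \<kappa> (A \<times> B) = \<beta> A B" using \<kappa>[OF A] nonneg[OF A] by (simp add: measure_def)
      then show "((\<lambda>n. measure (\<pi> n) (A \<times> B)) \<longlongrightarrow> measure \<kappa> (A \<times> B)) G" using lim by simp
    qed (fact G(1) \<pi>.prob_space_axioms sp pk sk)+
  qed
qed

section \<open>Functions that are simple over the ring of Borel rectangles\<close>

abbreviation rectangle_ring :: "('a::topological_space \<times> 'b::topological_space) set set" where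
  "rectangle_ring \<equiv> semiring_of_sets.generated_ring borel_rectangles"

lemma ring_rectangle_ring: "ring_of_sets UNIV rectangle_ring"
  by (rule semiring_of_sets.generating_ring[OF semiring_borel_rectangles])

lemma rectangle_in_ring: "A \<in> sets borel \<Longrightarrow> B \<in> sets borel \<Longrightarrow> A \<times> B \<in> rectangle_ring"
  by (intro semiring_of_sets.generated_ringI_Basic[OF semiring_borel_rectangles]) blast

lemma UNIV_in_rectangle_ring: "UNIV \<in> rectangle_ring"
  using rectangle_in_ring[of UNIV UNIV] by simp

lemma rectangle_ring_borel:
  fixes E :: "('a::second_countable_topology \<times> 'b::second_countable_topology) set"
  assumes "E \<in> rectangle_ring" shows "E \<in> sets borel"
proof -
  have "E \<in> sigma_sets UNIV rectangle_ring" using assms by auto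
  then show ?thesis
    unfolding sets_borel_rectangles
    by (simp add: semiring_of_sets.sigma_sets_generated_ring_eq[OF semiring_borel_rectangles])
qed

text \<open>Ring members are finite disjoint unions of rectangles, so the integral of such a real
  function is a finite combination of rectangle masses and converges with them. No structure on the
  values is required, which makes the class stable under composition with arbitrary functions,
  powers in particular.\<close>

definition ring_simple :: "('a::topological_space \<times> 'b::topological_space \<Rightarrow> 'c) \<Rightarrow> bool" where
  "ring_simple s \<longleftrightarrow> finite (range s) \<and> (\<forall>v. s -` {v} \<in> rectangle_ring)"

lemma ring_simple_vimage:
  assumes "ring_simple s" shows "s -` V \<in> rectangle_ring"
proof -
  interpret ring_of_sets UNIV rectangle_ring by (rule ring_rectangle_ring)
  have "s -` V = (\<Union>v\<in>V \<inter> range s. s -` {v})" by auto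
  also have "\<dots> \<in> rectangle_ring" using assms by (intro finite_UN) (auto simp: ring_simple_def)
  finally show ?thesis .
qed

lemma ring_simple_const: "ring_simple (\<lambda>_. v)"
proof -
  interpret ring_of_sets UNIV rectangle_ring by (rule ring_rectangle_ring)
  show ?thesis by (auto simp: ring_simple_def vimage_def UNIV_in_rectangle_ring)
qed

lemma ring_simple_comp:
  assumes "ring_simple s" shows "ring_simple (\<lambda>x. f (s x))"
proof -
  have "range (\<lambda>x. f (s x)) = f ` range s" "(\<lambda>x. f (s x)) -` {v} = s -` (f -` {v})" for v by auto
  then show ?thesis
    using assms ring_simple_vimage[OF assms] by (auto simp: ring_simple_def)
qed

lemma ring_simple_If:
  assumes "E \<in> rectangle_ring" "ring_simple s" "ring_simple t"
  shows "ring_simple (\<lambda>x. if x \<in> E then s x else t x)"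
proof -
  interpret ring_of_sets UNIV rectangle_ring by (rule ring_rectangle_ring)
  have "finite (range (\<lambda>x. if x \<in> E then s x else t x))"
    by (rule finite_subset[of _ "range s \<union> range t"]) (use assms in \<open>auto simp: ring_simple_def\<close>)
  moreover have "(\<lambda>x. if x \<in> E then s x else t x) -` {v} = (E \<inter> s -` {v}) \<union> (t -` {v} - E)" for v
    by auto
  moreover have "(E \<inter> s -` {v}) \<union> (t -` {v} - E) \<in> rectangle_ring" for v
    using assms by (intro Un Int Diff) (auto simp: ring_simple_def)
  ultimately show ?thesis by (simp add: ring_simple_def)
qed

lemma ring_simple_measurable:
  fixes s :: "'a::second_countable_topology \<times> 'b::second_countable_topology \<Rightarrow> 'c::topological_space"
  assumes "ring_simple s" shows "s \<in> borel_measurable borel"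
  by (rule measurableI) (auto intro: rectangle_ring_borel ring_simple_vimage[OF assms])

lemma integral_ring_simple:
  fixes s :: "'a::second_countable_topology \<times> 'b::second_countable_topology \<Rightarrow> real"
  assumes "ring_simple s" "finite_measure M" and [measurable_cong]: "sets M = sets borel"
  shows "integrable M s" "integral\<^sup>L M s = (\<Sum>v\<in>range s. v * measure M (s -` {v}))"
proof -
  interpret finite_measure M by fact
  have [measurable]: "s -` {v} \<in> sets M" for v
    unfolding assms(3) by (intro rectangle_ring_borel ring_simple_vimage assms(1))
  have fin: "finite (range s)" using assms by (simp add: ring_simple_def)
  have eq: "s = (\<lambda>x. \<Sum>v\<in>range s. v * indicator (s -` {v}) x)"
  proof
    fix x
    have "(\<Sum>v\<in>range s. v * indicator (s -` {v}) x) = (\<Sum>v\<in>{s x}. v * indicator (s -` {v}) x)"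
      using fin by (intro sum.mono_neutral_right) (auto split: split_indicator)
    then show "s x = (\<Sum>v\<in>range s. v * indicator (s -` {v}) x)" by simp
  qed
  have int: "integrable M (\<lambda>x. v * indicator (s -` {v}) x :: real)" for v
    by (intro integrable_mult_right integrable_real_indicator) (auto simp: emeasure_eq_measure)
  have "integrable M (\<lambda>x. \<Sum>v\<in>range s. v * indicator (s -` {v}) x)" using int by auto
  then show "integrable M s" using eq by simp
  have "integral\<^sup>L M s = (\<integral>x. (\<Sum>v\<in>range s. v * indicator (s -` {v}) x) \<partial>M)"
    using eq by simp
  also have "\<dots> = (\<Sum>v\<in>range s. v * measure M (s -` {v}))"
    using int by (simp add: Bochner_Integration.integral_sum sets.Int_space_eq2)
  finally show "integral\<^sup>L M s = (\<Sum>v\<in>range s. v * measure M (s -` {v}))" .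
qed

context rectangle_limit
begin

lemma tendsto_measure_ring:
  assumes "E \<in> rectangle_ring"
  shows "((\<lambda>n. measure (\<pi> n) E) \<longlongrightarrow> measure \<kappa> E) G"
proof -
  obtain C where C: "finite C" "disjoint C" "C \<subseteq> borel_rectangles" "E = \<Union> C"
    using semiring_of_sets.generated_ringE[OF semiring_borel_rectangles assms] .
  have eq: "measure M E = (\<Sum>c\<in>C. measure M c)" if "prob_space M" "sets M = sets borel" for M
  proof -
    interpret prob_space M by fact
    have "C \<subseteq> sets M"
      using C(3) unfolding that(2) by (auto intro!: rectangle_ring_borel rectangle_in_ring)
    then show ?thesis
      using C measure_finite_Union[of C id M] by (auto simp: disjoint_family_on_def disjoint_def emeasure_eq_measure)
  qed
  show ?thesis
    unfolding eq[OF prob_seq sets_seq] eq[OF prob_lim sets_lim]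
    using C(3) rectangles by (intro tendsto_sum) blast
qed

lemma tendsto_integral_ring_simple:
  fixes s :: "'a \<times> 'b \<Rightarrow> real"
  assumes "ring_simple s"
  shows "((\<lambda>n. integral\<^sup>L (\<pi> n) s) \<longlongrightarrow> integral\<^sup>L \<kappa> s) G"
  unfolding integral_ring_simple(2)[OF assms prob_space.finite_measure[OF prob_seq] sets_seq]
    integral_ring_simple(2)[OF assms prob_space.finite_measure[OF prob_lim] sets_lim]
  by (intro tendsto_sum tendsto_mult tendsto_const tendsto_measure_ring ring_simple_vimage assms)

end

text \<open>Superlevel sets are open, hence unions of basic rectangles. There are countably many
  pairs \<open>(q, R)\<close> with \<open>q\<close> rational, \<open>R\<close> a basic rectangle and
  \<open>f > q\<close> on \<open>R\<close>; \<open>s j\<close> is the maximum of 0 and those of the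
  first \<open>j\<close> levels \<open>q\<close> whose \<open>R\<close> contains the point.\<close>

lemma lower_semicontinuous_ring_simple_approx:
  fixes f :: "'a::second_countable_topology \<times> 'b::second_countable_topology \<Rightarrow> real"
  assumes "lower_semicontinuous f" and nonneg: "\<And>x. 0 \<le> f x"
  obtains s :: "nat \<Rightarrow> 'a \<times> 'b \<Rightarrow> real" where "\<And>j. ring_simple (s j)" "\<And>j x. 0 \<le> s j x"
    "incseq s" "\<And>x. (SUP j. ennreal (s j x)) = ennreal (f x)"
proof -
  obtain A :: "'a set set" where A: "countable A" "topological_basis A" using ex_countable_basis by auto
  obtain B :: "'b set set" where B: "countable B" "topological_basis B" using ex_countable_basis by auto
  define \<B> where "\<B> = (\<lambda>(a, b). a \<times> b) ` (A \<times> B)"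
  have \<B>: "topological_basis \<B>" "countable \<B>"
    unfolding \<B>_def using A B by (auto intro: topological_basis_prod)
  have \<B>_ring: "R \<in> rectangle_ring" if "R \<in> \<B>" for R
    using that topological_basis_open[OF A(2)] topological_basis_open[OF B(2)]
    unfolding \<B>_def by (auto intro!: rectangle_in_ring borel_open)
  define I where "I = {(q, R). q \<in> \<rat> \<and> R \<in> \<B> \<and> R \<subseteq> {x. q < f x}}"
  have "I \<subseteq> \<rat> \<times> \<B>" by (auto simp: I_def)
  then have "countable I"
    by (rule countable_subset) (intro countable_SIGMA countable_rat \<B>)
  have dense: "\<exists>(q, R)\<in>I. r < q \<and> x \<in> R" if r: "r < f x" for r x
  proof -
    obtain q where q: "q \<in> \<rat>" "r < q" "q < f x" using Rats_dense_in_real[OF r] by auto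
    have "open {x. q < f x}" using assms(1) by (simp add: lower_semicontinuous_def)
    then obtain R where "R \<in> \<B>" "x \<in> R" "R \<subseteq> {x. q < f x}"
      using q(3) by (elim topological_basisE[OF \<B>(1), where x = x]) auto
    with q have "(q, R) \<in> I" "r < q" "x \<in> R" by (auto simp: I_def)
    then show ?thesis by blast
  qed
  \<comment> \<open>\<open>from_nat_into\<close> enumerates nonempty countable sets, possibly with
    repetitions; the point and the level used here are arbitrary.\<close>
  have "I \<noteq> {}" using dense[of "f undefined - 1" undefined] by auto
  define q where "q j = fst (from_nat_into I j)" for j
  define R where "R j = snd (from_nat_into I j)" for j
  have qR: "(q j, R j) \<in> I" for j
    unfolding q_def R_def using from_nat_into[OF \<open>I \<noteq> {}\<close>, of j] by simp
  define s where "s = rec_nat (\<lambda>_::'a \<times> 'b. 0) (\<lambda>j t x. if x \<in> R j then max (q j) (t x) else t x)"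
  have s0: "s 0 = (\<lambda>_. 0)" and sS: "s (Suc j) = (\<lambda>x. if x \<in> R j then max (q j) (s j x) else s j x)" for j
    by (simp_all only: s_def nat.rec)
  have simple: "ring_simple (s j)" for j
  proof (induction j)
    case (Suc j)
    then show ?case unfolding sS
      using qR[of j] by (intro ring_simple_If ring_simple_comp[of "s j" "max (q j)"]) (auto simp: I_def \<B>_ring)
  qed (simp add: s0 ring_simple_const)
  have mono: "incseq s" by (rule incseq_SucI) (auto simp: sS le_fun_def)
  have le: "s j x \<le> f x" for j x
  proof (induction j)
    case (Suc j)
    then show ?case using qR[of j] by (auto simp: sS I_def)
  qed (simp add: s0 nonneg)
  have ge: "0 \<le> s j x" for j x
    using mono[THEN incseqD, of 0 j, THEN le_funD, of x] by (simp add: s0)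
  have "(SUP j. ennreal (s j x)) = ennreal (f x)" for x
  proof (rule antisym)
    show "(SUP j. ennreal (s j x)) \<le> ennreal (f x)" by (intro SUP_least ennreal_leI le)
    show "ennreal (f x) \<le> (SUP j. ennreal (s j x))"
      unfolding le_SUP_iff
    proof safe
      fix y assume y: "y < ennreal (f x)"
      then obtain r where r: "y = ennreal r" "0 \<le> r" by (cases y) auto
      with y nonneg have "r < f x" by (simp add: ennreal_less_iff)
      from dense[OF this] obtain q' R' where qR': "(q', R') \<in> I" "r < q'" "x \<in> R'" by auto
      obtain j where "from_nat_into I j = (q', R')"
        using from_nat_into_surj[OF \<open>countable I\<close> qR'(1)] by auto
      \<comment> \<open>The pair with index \<open>j\<close> enters the maximum at stage
        \<open>Suc j\<close>.\<close>
      then have "r < s (Suc j) x" using qR' by (auto simp: sS q_def R_def)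
      then show "\<exists>j\<in>UNIV. y < ennreal (s j x)" using r by (auto simp: ennreal_less_iff)
    qed
  qed
  with simple ge mono show thesis using that by blast
qed

text \<open>Each \<open>s j\<close> lies below \<open>f\<close> and its integral converges along
  \<open>G\<close>, so its integral under \<open>\<kappa>\<close> is at most \<open>L\<close>;
  monotone convergence under \<open>\<kappa>\<close> alone then gives the bound for
  \<open>f\<close>.\<close>

lemma (in rectangle_limit) nn_integral_lower_semicontinuous:
  assumes "lower_semicontinuous f" and nonneg: "\<And>x. 0 \<le> f x"
    and lim: "((\<lambda>n. \<integral>\<^sup>+x. ennreal (f x) \<partial>\<pi> n) \<longlongrightarrow> L) G"
  shows "(\<integral>\<^sup>+x. ennreal (f x) \<partial>\<kappa>) \<le> L"
proof -
  obtain s :: "nat \<Rightarrow> 'a \<times> 'b \<Rightarrow> real" where s: "\<And>j. ring_simple (s j)" "\<And>j x. 0 \<le> s j x" "incseq s"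
    "\<And>x. (SUP j. ennreal (s j x)) = ennreal (f x)"
    using lower_semicontinuous_ring_simple_approx[OF assms(1,2)] by blast
  have [measurable]: "s j \<in> borel_measurable borel" for j
    using s(1) by (rule ring_simple_measurable)
  have "(\<integral>\<^sup>+x. ennreal (f x) \<partial>\<kappa>) = (\<integral>\<^sup>+x. (SUP j. ennreal (s j x)) \<partial>\<kappa>)"
    by (simp add: s(4))
  also have "\<dots> = (SUP j. \<integral>\<^sup>+x. ennreal (s j x) \<partial>\<kappa>)"
    using s(3) by (intro nn_integral_monotone_convergence_SUP) (auto simp: incseq_def le_fun_def intro!: ennreal_leI)
  also have "\<dots> \<le> L"
  proof (rule SUP_least)
    fix j
    have eq: "(\<integral>\<^sup>+x. ennreal (s j x) \<partial>M) = ennreal (integral\<^sup>L M (s j))"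
      if "prob_space M" "sets M = sets borel" for M
      using integral_ring_simple(1)[OF s(1) prob_space.finite_measure[OF that(1)] that(2)] s(2)
      by (intro nn_integral_eq_integral) auto
    have "((\<lambda>n. ennreal (integral\<^sup>L (\<pi> n) (s j))) \<longlongrightarrow> ennreal (integral\<^sup>L \<kappa> (s j))) G"
      by (intro tendsto_ennrealI tendsto_integral_ring_simple s)
    moreover have "ennreal (integral\<^sup>L (\<pi> n) (s j)) \<le> (\<integral>\<^sup>+x. ennreal (f x) \<partial>\<pi> n)" for n
      unfolding eq[OF prob_seq sets_seq, symmetric]
      by (intro nn_integral_mono) (subst s(4)[symmetric], rule SUP_upper, simp)
    ultimately have "ennreal (integral\<^sup>L \<kappa> (s j)) \<le> L"
      by (intro tendsto_le[OF nontrivial lim]) auto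
    then show "(\<integral>\<^sup>+x. ennreal (s j x) \<partial>\<kappa>) \<le> L" by (simp add: eq[OF prob_lim sets_lim])
  qed
  finally show ?thesis .
qed

section \<open>Variational form of the divergence constraint\<close>

text \<open>\<open>\<xi>\<close> is the sum of the two measures. Its values are part of the
  conclusion for two later purposes: a set of small \<open>\<xi>\<close>-measure is small for both
  summands, and a marginal of \<open>\<xi>\<close> is the sum of their marginals.\<close>

lemma common_dominating_measure:
  assumes "finite_measure \<mu>" "finite_measure \<nu>" and eq: "sets \<nu> = sets \<mu>"
  obtains \<xi> and f g :: "'a \<Rightarrow> real" where "finite_measure \<xi>" "sets \<xi> = sets \<mu>"
    "f \<in> borel_measurable \<xi>" "g \<in> borel_measurable \<xi>" "\<And>x. 0 \<le> f x" "\<And>x. 0 \<le> g x"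
    "density \<xi> (\<lambda>x. ennreal (f x)) = \<mu>" "density \<xi> (\<lambda>x. ennreal (g x)) = \<nu>"
    "\<And>A. A \<in> sets \<mu> \<Longrightarrow> emeasure \<xi> A = emeasure \<mu> A + emeasure \<nu> A"
proof -
  interpret \<mu>: finite_measure \<mu> by fact
  interpret \<nu>: finite_measure \<nu> by fact
  define \<xi> where "\<xi> = measure_of (space \<mu>) (sets \<mu>) (\<lambda>A. emeasure \<mu> A + emeasure \<nu> A)"
  have sets: "sets \<xi> = sets \<mu>" by (simp add: \<xi>_def sets.space_closed sets.sigma_sets_eq)
  have em: "emeasure \<xi> A = emeasure \<mu> A + emeasure \<nu> A" if "A \<in> sets \<mu>" for A
    unfolding \<xi>_def
  proof (rule emeasure_measure_of_sigma)
    show "sigma_algebra (space \<mu>) (sets \<mu>)" by (rule sets.sigma_algebra_axioms)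
    show "countably_additive (sets \<mu>) (\<lambda>A. emeasure \<mu> A + emeasure \<nu> A)"
    proof (rule countably_additiveI)
      fix A :: "nat \<Rightarrow> 'a set" assume A: "range A \<subseteq> sets \<mu>" "disjoint_family A" "\<Union>(range A) \<in> sets \<mu>"
      then show "(\<Sum>i. emeasure \<mu> (A i) + emeasure \<nu> (A i)) = emeasure \<mu> (\<Union>(range A)) + emeasure \<nu> (\<Union>(range A))"
        using suminf_emeasure[of A \<mu>] suminf_emeasure[of A \<nu>] eq
        by (subst suminf_add[symmetric]) auto
    qed
  qed (use that in \<open>auto simp: positive_def\<close>)
  have space: "space \<xi> = space \<mu>" using sets by (rule sets_eq_imp_space_eq)
  have "finite_measure \<xi>"
  proof
    show "emeasure \<xi> (space \<xi>) \<noteq> \<infinity>"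
      unfolding space using em[of "space \<mu>"] \<mu>.emeasure_finite \<nu>.emeasure_finite by simp
  qed
  then interpret \<xi>: finite_measure \<xi> .
  have ac: "absolutely_continuous \<xi> \<mu>" "absolutely_continuous \<xi> \<nu>"
    using em eq by (auto simp: absolutely_continuous_def null_sets_def sets)
  obtain f where f: "f \<in> borel_measurable \<xi>" "AE x in \<xi>. RN_deriv \<xi> \<mu> x = ennreal (f x)" "\<And>x. 0 \<le> f x"
    using \<xi>.real_RN_deriv[OF assms(1) ac(1)] sets by metis
  obtain g where g: "g \<in> borel_measurable \<xi>" "AE x in \<xi>. RN_deriv \<xi> \<nu> x = ennreal (g x)" "\<And>x. 0 \<le> g x"
    using \<xi>.real_RN_deriv[OF assms(2) ac(2)] sets eq by metis
  have "density \<xi> (\<lambda>x. ennreal (f x)) = density \<xi> (RN_deriv \<xi> \<mu>)"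
    using f by (intro density_cong) auto
  moreover have "density \<xi> (\<lambda>x. ennreal (g x)) = density \<xi> (RN_deriv \<xi> \<nu>)"
    using g by (intro density_cong) auto
  ultimately show thesis
    using that[OF \<open>finite_measure \<xi>\<close> sets f(1) g(1) f(3) g(3)] em
    by (simp add: \<xi>.density_RN_deriv ac sets eq)
qed

text \<open>Division by the negative \<open>\<alpha> - 1\<close> reverses the order, so an upper
  bound on the divergence is a lower bound on the integral. At \<open>t = 0\<close> the left side is
  \<open>\<infinity>\<close> and both inequalities fail; at \<open>t = \<infinity>\<close> both
  hold.\<close>

lemma ext_ln_le_iff:
  assumes "\<alpha> < 1"
  shows "ereal (1 / (\<alpha> - 1)) * ext_ln t \<le> ereal \<gamma> \<longleftrightarrow> ennreal (exp ((\<alpha> - 1) * \<gamma>)) \<le> t"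
proof (cases t)
  case (real r)
  show ?thesis
  proof (cases "r = 0")
    case True
    then show ?thesis using real assms by (simp add: ext_ln_def)
  next
    case False
    then have r: "0 < r" using real by simp
    have "ereal (1 / (\<alpha> - 1)) * ext_ln t \<le> ereal \<gamma> \<longleftrightarrow> ln r / (\<alpha> - 1) \<le> \<gamma>"
      using real r by (simp add: ext_ln_def)
    also have "\<dots> \<longleftrightarrow> (\<alpha> - 1) * \<gamma> \<le> ln r"
      using assms by (simp add: neg_divide_le_eq mult.commute)
    also have "\<dots> \<longleftrightarrow> exp ((\<alpha> - 1) * \<gamma>) \<le> r" using r by (simp add: ln_ge_iff)
    finally show ?thesis using real by simp
  qed
next
  case top
  then show ?thesis using assms by (simp add: ext_ln_def)
qed

text \<open>Weighted arithmetic-geometric mean for \<open>s powr (\<alpha> - 1) * f\<close> and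
  \<open>s powr \<alpha> * g\<close>: in the geometric mean the exponents
  \<open>(\<alpha> - 1) * \<alpha>\<close> and \<open>\<alpha> * (1 - \<alpha>)\<close> of
  \<open>s\<close> cancel.\<close>

lemma young_powr:
  fixes f g s :: real
  assumes "0 < \<alpha>" "\<alpha> < 1" "0 \<le> f" "0 \<le> g" "0 < s"
  shows "f powr \<alpha> * g powr (1 - \<alpha>) \<le> \<alpha> * (s powr (\<alpha> - 1) * f) + (1 - \<alpha>) * (s powr \<alpha> * g)"
proof (cases "f = 0 \<or> g = 0")
  case False
  then have "(s powr (\<alpha> - 1) * f) powr \<alpha> * (s powr \<alpha> * g) powr (1 - \<alpha>)
      \<le> \<alpha> * (s powr (\<alpha> - 1) * f) + (1 - \<alpha>) * (s powr \<alpha> * g)"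
    using assms by (intro Youngs_inequality_0) auto
  also have "(s powr (\<alpha> - 1) * f) powr \<alpha> * (s powr \<alpha> * g) powr (1 - \<alpha>)
      = (s powr ((\<alpha> - 1) * \<alpha>) * s powr (\<alpha> * (1 - \<alpha>))) * (f powr \<alpha> * g powr (1 - \<alpha>))"
    using assms False by (simp add: powr_mult powr_powr)
  also have "s powr ((\<alpha> - 1) * \<alpha>) * s powr (\<alpha> * (1 - \<alpha>)) = 1"
    using assms by (simp flip: powr_add add: algebra_simps)
  finally show ?thesis by simp
qed (use assms in auto)

text \<open>Equality in Young's inequality holds at \<open>s = f / g\<close>, which need be neither
  bounded nor bounded away from 0; it is clamped to the interval from \<open>e\<close> to
  \<open>1 / e\<close>. Where the ratio is below \<open>e\<close> the Young expression is at most
  \<open>e powr \<alpha> * g\<close>, and where it is above \<open>1 / e\<close> at most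
  \<open>e powr (1 - \<alpha>) * f\<close>. The case \<open>g = 0\<close> belongs to the large
  ratios, although \<open>f / 0 = 0\<close> would put it among the small ones.\<close>

lemma young_powr_optimal:
  fixes f g e :: real
  assumes "0 < \<alpha>" "\<alpha> < 1" "0 \<le> f" "0 \<le> g" "0 < e" "e \<le> 1"
  defines "s \<equiv> (if g = 0 then 1 / e else max e (min (1 / e) (f / g)))"
  shows "\<alpha> * (s powr (\<alpha> - 1) * f) + (1 - \<alpha>) * (s powr \<alpha> * g)
    \<le> f powr \<alpha> * g powr (1 - \<alpha>) + (e powr \<alpha> * g + e powr (1 - \<alpha>) * f)"
proof -
  have inv: "(1 / e) powr (\<alpha> - 1) = e powr (1 - \<alpha>)"
    using assms(5) powr_minus[of e "\<alpha> - 1"] by (simp add: divide_inverse inverse_powr)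
  have hh: "0 \<le> f powr \<alpha> * g powr (1 - \<alpha>)" "0 \<le> e powr \<alpha> * g" "0 \<le> e powr (1 - \<alpha>) * f"
    using assms by auto
  consider "g = 0" | "0 < g" "f / g < e" | "0 < g" "e \<le> f / g" "f / g \<le> 1 / e" | "0 < g" "e \<le> f / g" "1 / e < f / g"
    using assms by linarith
  then show ?thesis
  proof cases
    case 1
    have "\<alpha> * (e powr (1 - \<alpha>) * f) \<le> 1 * (e powr (1 - \<alpha>) * f)"
      using assms by (intro mult_right_mono) auto
    then show ?thesis using 1 inv by (simp add: s_def)
  next
    case 2
    then have s: "s = e" using assms by (auto simp: s_def)
    have "f \<le> e * g" using 2 by (simp add: field_simps)
    then have "e powr (\<alpha> - 1) * f \<le> e powr (\<alpha> - 1) * (e * g)"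
      by (intro mult_left_mono) auto
    also have "\<dots> = e powr \<alpha> * g" using assms by (simp add: powr_diff)
    finally have "\<alpha> * (e powr (\<alpha> - 1) * f) \<le> \<alpha> * (e powr \<alpha> * g)"
      using assms by (intro mult_left_mono) auto
    moreover have "(1 - \<alpha>) * (e powr \<alpha> * g) = e powr \<alpha> * g - \<alpha> * (e powr \<alpha> * g)"
      by (simp add: algebra_simps)
    ultimately show ?thesis using hh unfolding s by linarith
  next
    case 3
    then have s: "s = f / g" by (auto simp: s_def)
    have f: "0 < f" using 3 assms by (smt (verit) divide_eq_0_iff)
    have "s powr (\<alpha> - 1) * f = f powr \<alpha> * g powr (1 - \<alpha>)"
      using f 3 by (simp add: s powr_divide powr_diff)
    moreover have "s powr \<alpha> * g = f powr \<alpha> * g powr (1 - \<alpha>)"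
      using f 3 by (simp add: s powr_divide powr_diff)
    ultimately show ?thesis using hh by (simp add: algebra_simps)
  next
    case 4
    have "e \<le> 1 / e" using assms(5,6) mult_le_one[of e e] by (simp add: field_simps)
    with 4 have s: "s = 1 / e" by (auto simp: s_def)
    have "g \<le> e * f" using 4 assms by (simp add: field_simps)
    then have "(1 / e) powr \<alpha> * g \<le> (1 / e) powr \<alpha> * (e * f)"
      by (intro mult_left_mono) auto
    also have "\<dots> = e powr (1 - \<alpha>) * f" using assms by (simp add: powr_diff powr_divide)
    finally have "(1 - \<alpha>) * ((1 / e) powr \<alpha> * g) \<le> (1 - \<alpha>) * (e powr (1 - \<alpha>) * f)"
      using assms by (intro mult_left_mono) auto
    moreover have "(1 - \<alpha>) * (e powr (1 - \<alpha>) * f) = e powr (1 - \<alpha>) * f - \<alpha> * (e powr (1 - \<alpha>) * f)"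
      by (simp add: algebra_simps)
    ultimately show ?thesis using hh unfolding s inv by linarith
  qed
qed

text \<open>For a fixed \<open>s\<close> this is affine in either measure and mentions neither
  densities nor a reference measure. So it can be followed through limits and push-forwards, where
  densities cannot.\<close>

definition young_functional :: "real \<Rightarrow> ('a \<Rightarrow> real) \<Rightarrow> 'a measure \<Rightarrow> 'a measure \<Rightarrow> real" where
  "young_functional \<alpha> s \<mu> \<nu> = \<alpha> * (\<integral>x. s x powr (\<alpha> - 1) \<partial>\<mu>) + (1 - \<alpha>) * (\<integral>x. s x powr \<alpha> \<partial>\<nu>)"

text \<open>The two bounds make both powers of \<open>s\<close> bounded, hence integrable for every
  finite measure. For \<open>e > 1\<close> the set is empty, since then
  \<open>e > 1 / e\<close>.\<close>

definition test_functions :: "real \<Rightarrow> ('a::topological_space \<Rightarrow> real) set" where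
  "test_functions e = {s \<in> borel_measurable borel. \<forall>x. e \<le> s x \<and> s x \<le> 1 / e}"

lemma test_functions_bounds:
  assumes "s \<in> test_functions e" "0 < e" "0 < \<alpha>" "\<alpha> < 1"
  shows "e \<le> 1" "0 < s x" "s x powr (\<alpha> - 1) \<le> 1 / e" "s x powr \<alpha> \<le> 1 / e"
proof -
  have s: "e \<le> s x" "s x \<le> 1 / e" for x using assms(1) by (auto simp: test_functions_def)
  have "e \<le> 1 / e" using s order_trans by blast
  then have "e * e \<le> 1 * 1" using assms(2) by (simp add: field_simps)
  then show e: "e \<le> 1" using assms(2) by (meson less_imp_le mult_strict_mono not_le zero_le_one zero_less_one order_less_le_trans)
  show sx: "0 < s x" using s(1)[of x] assms(2) by linarith
  have "s x powr (\<alpha> - 1) \<le> e powr (\<alpha> - 1)"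
    using assms s(1)[of x] by (intro powr_mono2') auto
  also have "\<dots> \<le> e powr (- 1)" using assms e by (intro powr_mono') auto
  finally show "s x powr (\<alpha> - 1) \<le> 1 / e" using assms by (simp add: powr_minus_divide)
  have "s x powr \<alpha> \<le> (1 / e) powr \<alpha>" using assms sx s(2)[of x] by (intro powr_mono2) auto
  also have "\<dots> \<le> (1 / e) powr 1" using assms e by (intro powr_mono) (auto simp: field_simps)
  finally show "s x powr \<alpha> \<le> 1 / e" using assms by simp
qed

lemma test_functions_integrable:
  assumes "s \<in> test_functions e" "0 < e" "0 < \<alpha>" "\<alpha> < 1"
    and "finite_measure M" and [measurable_cong]: "sets M = sets borel"
  shows "integrable M (\<lambda>x. s x powr (\<alpha> - 1))" "integrable M (\<lambda>x. s x powr \<alpha>)"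
proof -
  interpret finite_measure M by fact
  have [measurable]: "s \<in> borel_measurable borel" using assms(1) by (simp add: test_functions_def)
  show "integrable M (\<lambda>x. s x powr (\<alpha> - 1))" "integrable M (\<lambda>x. s x powr \<alpha>)"
    using test_functions_bounds[OF assms(1-4)]
    by (auto intro!: integrable_const_bound[where B = "1 / e"])
qed

text \<open>Variational form of the constraint: \<open>f\<^sup>\<alpha> g\<^sup>1\<^sup>-\<^sup>\<alpha>\<close> is the minimum over \<open>s > 0\<close> of
  \<open>\<alpha> s\<^sup>\<alpha>\<^sup>-\<^sup>1 f + (1 - \<alpha>) s\<^sup>\<alpha> g\<close>, attained at \<open>s = f / g\<close>.\<close>

locale renyi_densities =
  fixes \<alpha> :: real and \<mu> \<nu> \<xi> :: "'a::topological_space measure" and f g :: "'a \<Rightarrow> real"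
  assumes \<alpha>: "0 < \<alpha>" "\<alpha> < 1"
    and fin_\<mu>: "finite_measure \<mu>" and fin_\<nu>: "finite_measure \<nu>" and fin: "finite_measure \<xi>"
    and sets [measurable_cong]: "sets \<xi> = sets borel"
    and meas [measurable]: "f \<in> borel_measurable borel" "g \<in> borel_measurable borel"
    and pos: "0 \<le> f x" "0 \<le> g x"
    and dens: "density \<xi> (\<lambda>x. ennreal (f x)) = \<mu>" "density \<xi> (\<lambda>x. ennreal (g x)) = \<nu>"
begin

definition hellinger :: real where
  "hellinger = (\<integral>x. f x powr \<alpha> * g x powr (1 - \<alpha>) \<partial>\<xi>)"

lemma sets_\<mu> [measurable_cong]: "sets \<mu> = sets borel" and sets_\<nu> [measurable_cong]: "sets \<nu> = sets borel"
  using dens sets by (metis sets_density)+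

lemma integrable_densities: "integrable \<xi> f" "integrable \<xi> g"
proof -
  have "(\<integral>\<^sup>+x. ennreal (f x) \<partial>\<xi>) = emeasure \<mu> (space \<xi>)"
    unfolding dens(1)[symmetric] by (subst emeasure_density) (auto intro!: nn_integral_cong)
  then show "integrable \<xi> f"
    using pos finite_measure.emeasure_finite[OF fin_\<mu>, of "space \<xi>"]
    by (intro integrableI_nonneg) (auto simp: less_top)
  have "(\<integral>\<^sup>+x. ennreal (g x) \<partial>\<xi>) = emeasure \<nu> (space \<xi>)"
    unfolding dens(2)[symmetric] by (subst emeasure_density) (auto intro!: nn_integral_cong)
  then show "integrable \<xi> g"
    using pos finite_measure.emeasure_finite[OF fin_\<nu>, of "space \<xi>"]
    by (intro integrableI_nonneg) (auto simp: less_top)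
qed

lemma integral_densities: "integral\<^sup>L \<xi> f = measure \<mu> (space \<mu>)" "integral\<^sup>L \<xi> g = measure \<nu> (space \<nu>)"
proof -
  have "integral\<^sup>L \<mu> (\<lambda>_. 1::real) = integral\<^sup>L \<xi> f" "integral\<^sup>L \<nu> (\<lambda>_. 1::real) = integral\<^sup>L \<xi> g"
    unfolding dens[symmetric] using pos by (subst integral_density; simp)+
  then show "integral\<^sup>L \<xi> f = measure \<mu> (space \<mu>)" "integral\<^sup>L \<xi> g = measure \<nu> (space \<nu>)"
    by simp_all
qed

lemma integrable_hellinger: "integrable \<xi> (\<lambda>x. f x powr \<alpha> * g x powr (1 - \<alpha>))"
proof (rule Bochner_Integration.integrable_bound)
  show "integrable \<xi> (\<lambda>x. \<alpha> * f x + (1 - \<alpha>) * g x)" using integrable_densities by auto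
  show "AE x in \<xi>. norm (f x powr \<alpha> * g x powr (1 - \<alpha>)) \<le> norm (\<alpha> * f x + (1 - \<alpha>) * g x)"
    using young_powr[OF \<alpha> pos zero_less_one] pos \<alpha> by (auto intro!: AE_I2)
qed simp

lemma renyi_divergence_le_iff_hellinger:
  "renyi_divergence \<alpha> \<mu> \<nu> \<le> ereal \<gamma> \<longleftrightarrow> exp ((\<alpha> - 1) * \<gamma>) \<le> hellinger"
proof -
  interpret \<xi>: finite_measure \<xi> by (rule fin)
  have "renyi_divergence \<alpha> \<mu> \<nu> = renyi_formula \<alpha> (\<lambda>x. ennreal (f x)) (\<lambda>x. ennreal (g x)) \<nu>"
    using fin_\<mu> fin_\<nu> dens \<xi>.sigma_finite_measure_axioms by (intro renyi_divergence_eq) auto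
  moreover have "(\<integral>\<^sup>+x. ennreal ((enn2real (ennreal (f x)) / enn2real (ennreal (g x))) powr \<alpha>) \<partial>\<nu>) = ennreal hellinger"
  proof -
    have "(\<integral>\<^sup>+x. ennreal ((enn2real (ennreal (f x)) / enn2real (ennreal (g x))) powr \<alpha>) \<partial>\<nu>)
        = (\<integral>\<^sup>+x. ennreal (g x) * ennreal ((f x / g x) powr \<alpha>) \<partial>\<xi>)"
      unfolding dens(2)[symmetric] using pos by (subst nn_integral_density) auto
    also have "\<dots> = (\<integral>\<^sup>+x. ennreal (f x powr \<alpha> * g x powr (1 - \<alpha>)) \<partial>\<xi>)"
    proof (rule nn_integral_cong)
      fix x
      \<comment> \<open>Where \<open>g\<close> vanishes both sides are 0, the right one because
        \<open>0 powr (1 - \<alpha>) = 0\<close>.\<close>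
      have "g x * (f x / g x) powr \<alpha> = f x powr \<alpha> * g x powr (1 - \<alpha>)"
      proof (cases "g x = 0")
        case False
        then have "0 < g x" using pos(2)[of x] by simp
        then show ?thesis using pos(1)[of x] by (simp add: powr_divide powr_diff)
      qed simp
      then show "ennreal (g x) * ennreal ((f x / g x) powr \<alpha>) = ennreal (f x powr \<alpha> * g x powr (1 - \<alpha>))"
        using pos(2)[of x] by (simp flip: ennreal_mult')
    qed
    also have "\<dots> = ennreal hellinger"
      unfolding hellinger_def using integrable_hellinger pos by (intro nn_integral_eq_integral) auto
    finally show ?thesis .
  qed
  moreover have "0 \<le> hellinger" unfolding hellinger_def by (intro Bochner_Integration.integral_nonneg) auto
  ultimately show ?thesis
    by (simp add: renyi_formula_def ext_ln_le_iff \<alpha>)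
qed

lemma integrable_test:
  assumes "s \<in> test_functions e" "0 < e"
  shows "integrable \<xi> (\<lambda>x. s x powr (\<alpha> - 1) * f x)" "integrable \<xi> (\<lambda>x. s x powr \<alpha> * g x)"
proof -
  have [measurable]: "s \<in> borel_measurable borel" using assms(1) by (simp add: test_functions_def)
  show "integrable \<xi> (\<lambda>x. s x powr (\<alpha> - 1) * f x)"
    using test_functions_integrable(1)[OF assms \<alpha> fin_\<mu> sets_\<mu>] pos
    unfolding dens(1)[symmetric] by (subst (asm) integrable_density) (auto simp: mult.commute)
  show "integrable \<xi> (\<lambda>x. s x powr \<alpha> * g x)"
    using test_functions_integrable(2)[OF assms \<alpha> fin_\<nu> sets_\<nu>] pos
    unfolding dens(2)[symmetric] by (subst (asm) integrable_density) (auto simp: mult.commute)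
qed

lemma young_functional_eq:
  assumes "s \<in> test_functions e" "0 < e"
  shows "young_functional \<alpha> s \<mu> \<nu> = (\<integral>x. \<alpha> * (s x powr (\<alpha> - 1) * f x) + (1 - \<alpha>) * (s x powr \<alpha> * g x) \<partial>\<xi>)"
proof -
  have [measurable]: "s \<in> borel_measurable borel" using assms(1) by (simp add: test_functions_def)
  have "(\<integral>x. s x powr (\<alpha> - 1) \<partial>\<mu>) = (\<integral>x. s x powr (\<alpha> - 1) * f x \<partial>\<xi>)"
    "(\<integral>x. s x powr \<alpha> \<partial>\<nu>) = (\<integral>x. s x powr \<alpha> * g x \<partial>\<xi>)"
    unfolding dens[symmetric] using pos by (subst integral_density; simp add: mult.commute)+
  then show ?thesis
    using integrable_test[OF assms] by (simp add: young_functional_def)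
qed

lemma hellinger_le_young:
  assumes "s \<in> test_functions e" "0 < e"
  shows "hellinger \<le> young_functional \<alpha> s \<mu> \<nu>"
  unfolding hellinger_def young_functional_eq[OF assms]
  using integrable_test[OF assms] test_functions_bounds(2)[OF assms \<alpha>]
  by (intro integral_mono integrable_hellinger) (auto intro!: young_powr \<alpha> pos)

text \<open>The clamped ratio of \<open>young_powr_optimal\<close> is a test function that nearly
  attains the infimum: its error integrates to \<open>e powr \<alpha>\<close> times the mass of
  \<open>\<nu>\<close> plus \<open>e powr (1 - \<alpha>)\<close> times the mass of
  \<open>\<mu>\<close>, which tends to 0 with \<open>e\<close>.\<close>

lemma le_hellinger:
  assumes "\<And>e s. 0 < e \<Longrightarrow> s \<in> test_functions e \<Longrightarrow> K \<le> young_functional \<alpha> s \<mu> \<nu>"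
  shows "K \<le> hellinger"
proof -
  let ?m = "measure \<mu> (space \<mu>)" and ?n = "measure \<nu> (space \<nu>)"
  have "K \<le> hellinger + (e powr \<alpha> * ?n + e powr (1 - \<alpha>) * ?m)" if e: "0 < e" "e < 1" for e
  proof -
    define s where "s x = (if g x = 0 then 1 / e else max e (min (1 / e) (f x / g x)))" for x
    have [measurable]: "s \<in> borel_measurable borel" unfolding s_def by measurable
    have "e \<le> 1 / e" using e mult_le_one[of e e] by (simp add: field_simps)
    then have s: "s \<in> test_functions e" unfolding test_functions_def by (auto simp: s_def)
    have "K \<le> young_functional \<alpha> s \<mu> \<nu>" using assms[OF e(1) s] .
    also have "\<dots> \<le> (\<integral>x. f x powr \<alpha> * g x powr (1 - \<alpha>) + (e powr \<alpha> * g x + e powr (1 - \<alpha>) * f x) \<partial>\<xi>)"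
      unfolding young_functional_eq[OF s e(1)]
    proof (rule integral_mono)
      show "integrable \<xi> (\<lambda>x. \<alpha> * (s x powr (\<alpha> - 1) * f x) + (1 - \<alpha>) * (s x powr \<alpha> * g x))"
        using integrable_test[OF s e(1)] by auto
      show "integrable \<xi> (\<lambda>x. f x powr \<alpha> * g x powr (1 - \<alpha>) + (e powr \<alpha> * g x + e powr (1 - \<alpha>) * f x))"
        using integrable_hellinger integrable_densities by auto
      show "\<alpha> * (s x powr (\<alpha> - 1) * f x) + (1 - \<alpha>) * (s x powr \<alpha> * g x)
          \<le> f x powr \<alpha> * g x powr (1 - \<alpha>) + (e powr \<alpha> * g x + e powr (1 - \<alpha>) * f x)" for x
        unfolding s_def by (rule young_powr_optimal[OF \<alpha> pos e(1) less_imp_le[OF e(2)]])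
    qed
    also have "\<dots> = hellinger + (e powr \<alpha> * ?n + e powr (1 - \<alpha>) * ?m)"
      unfolding hellinger_def
      using integrable_hellinger integrable_densities by (simp add: integral_densities)
    finally show ?thesis .
  qed
  then have "eventually (\<lambda>e. K \<le> hellinger + (e powr \<alpha> * ?n + e powr (1 - \<alpha>) * ?m)) (at_right 0)"
    unfolding eventually_at_right_field by (intro exI[of _ 1]) auto
  moreover have "((\<lambda>e. hellinger + (e powr \<alpha> * ?n + e powr (1 - \<alpha>) * ?m)) \<longlongrightarrow> hellinger + (0 * ?n + 0 * ?m)) (at_right 0)"
    using \<alpha> by (intro tendsto_intros tendsto_zero_powrI[where b = \<alpha>] tendsto_zero_powrI[where b = "1 - \<alpha>"])
      (auto simp: eventually_at_right_field intro!: exI[of _ 1])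
  ultimately show ?thesis by (intro tendsto_lowerbound[of _ hellinger]) auto
qed

lemma renyi_divergence_le_iff_young:
  "renyi_divergence \<alpha> \<mu> \<nu> \<le> ereal \<gamma> \<longleftrightarrow>
    (\<forall>e>0. \<forall>s\<in>test_functions e. exp ((\<alpha> - 1) * \<gamma>) \<le> young_functional \<alpha> s \<mu> \<nu>)"
  unfolding renyi_divergence_le_iff_hellinger
proof (intro iffI allI impI ballI)
  fix e :: real and s :: "'a \<Rightarrow> real" assume "exp ((\<alpha> - 1) * \<gamma>) \<le> hellinger" "0 < e" "s \<in> test_functions e"
  then show "exp ((\<alpha> - 1) * \<gamma>) \<le> young_functional \<alpha> s \<mu> \<nu>"
    using hellinger_le_young order_trans by metis
qed (auto intro: le_hellinger)

end

lemma renyi_densities_exist: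
  fixes \<mu> \<nu> :: "'a::topological_space measure"
  assumes "0 < \<alpha>" "\<alpha> < 1" "finite_measure \<mu>" "finite_measure \<nu>"
    and sets: "sets \<mu> = sets borel" "sets \<nu> = sets borel"
  obtains \<xi> f g where "renyi_densities \<alpha> \<mu> \<nu> \<xi> f g"
    "\<And>A. A \<in> sets borel \<Longrightarrow> emeasure \<xi> A = emeasure \<mu> A + emeasure \<nu> A"
proof -
  obtain \<xi> f g where *: "finite_measure \<xi>" "sets \<xi> = sets \<mu>"
    "f \<in> borel_measurable \<xi>" "g \<in> borel_measurable \<xi>" "\<And>x. 0 \<le> f x" "\<And>x. 0 \<le> g x"
    "density \<xi> (\<lambda>x. ennreal (f x)) = \<mu>" "density \<xi> (\<lambda>x. ennreal (g x)) = \<nu>"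
    "\<And>A. A \<in> sets \<mu> \<Longrightarrow> emeasure \<xi> A = emeasure \<mu> A + emeasure \<nu> A"
    using common_dominating_measure[OF assms(3,4) sets(2)[folded sets(1)]] by blast
  have "borel_measurable \<xi> = borel_measurable borel"
    using *(2) sets by (intro measurable_cong_sets) auto
  then have "renyi_densities \<alpha> \<mu> \<nu> \<xi> f g"
    using * assms by (intro renyi_densities.intro) auto
  then show thesis using that *(9) sets by simp
qed

lemma renyi_divergence_le_iff:
  fixes \<mu> \<nu> :: "'a::topological_space measure"
  assumes "0 < \<alpha>" "\<alpha> < 1" "finite_measure \<mu>" "finite_measure \<nu>" "sets \<mu> = sets borel" "sets \<nu> = sets borel"
  shows "renyi_divergence \<alpha> \<mu> \<nu> \<le> ereal \<gamma> \<longleftrightarrow>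
    (\<forall>e>0. \<forall>s\<in>test_functions e. exp ((\<alpha> - 1) * \<gamma>) \<le> young_functional \<alpha> s \<mu> \<nu>)"
  by (rule renyi_densities_exist[OF assms]) (rule renyi_densities.renyi_divergence_le_iff_young)

section \<open>Existence of minimizers\<close>

text \<open>The sets that can be approximated form a \<sigma>-algebra. For a countable union,
  truncation to \<open>N\<close> sets costs less than \<open>\<delta> / 2\<close>, and approximating
  these within \<open>\<delta> / (2 * Suc N)\<close> each costs at most as much again;
  \<open>Suc N\<close> covers the case \<open>N = 0\<close>.\<close>

lemma rectangle_ring_approx:
  fixes M :: "('a::second_countable_topology \<times> 'b::second_countable_topology) measure"
  assumes "finite_measure M" and sets: "sets M = sets borel" and "E \<in> sets borel" and "0 < \<delta>"
  shows "\<exists>A\<in>rectangle_ring. measure M ((E - A) \<union> (A - E)) < \<delta>"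
proof -
  interpret finite_measure M by fact
  interpret R: ring_of_sets UNIV "rectangle_ring :: ('a \<times> 'b) set set" by (rule ring_rectangle_ring)
  note [measurable_cong] = sets
  have ring: "A \<in> rectangle_ring \<Longrightarrow> A \<in> sets M" for A
    unfolding sets by (rule rectangle_ring_borel)
  have "E \<in> sigma_sets UNIV borel_rectangles"
    using assms(3) by (simp add: sets_borel_rectangles)
  then show ?thesis using \<open>0 < \<delta>\<close>
  proof (induction arbitrary: \<delta> rule: sigma_sets.induct)
    case (Basic E)
    then have "E \<in> rectangle_ring" by (auto intro: rectangle_in_ring)
    with Basic show ?case by (intro bexI[of _ E]) auto
  next
    case Empty
    then show ?case by (intro bexI[of _ "{}"]) auto
  next
    case (Compl E)
    then obtain A where A: "A \<in> rectangle_ring" "measure M ((E - A) \<union> (A - E)) < \<delta>" by blast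
    have "(UNIV - E - (UNIV - A)) \<union> (UNIV - A - (UNIV - E)) = (E - A) \<union> (A - E)" by auto
    with A show ?case by (intro bexI[of _ "UNIV - A"]) (auto intro: UNIV_in_rectangle_ring)
  next
    case (Union E)
    have E [measurable]: "E i \<in> sets M" for i
      using Union.hyps[of i] by (simp add: sets sets_borel_rectangles)
    have "(\<lambda>N. measure M (\<Union>i<N. E i)) \<longlonglongrightarrow> measure M (\<Union>N. \<Union>i<N. E i)"
      by (rule finite_Lim_measure_incseq) (auto simp: incseq_def intro: less_le_trans)
    also have "(\<Union>N. \<Union>i<N. E i) = (\<Union>i. E i)" by auto
    finally have "eventually (\<lambda>N. measure M (\<Union>i. E i) - \<delta> / 2 < measure M (\<Union>i<N. E i)) sequentially"
      using Union.prems by (intro order_tendstoD(1)) auto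
    then obtain N where N: "measure M (\<Union>i. E i) - \<delta> / 2 < measure M (\<Union>i<N. E i)"
      by (auto simp: eventually_sequentially)
    have "\<exists>A\<in>rectangle_ring. measure M ((E i - A) \<union> (A - E i)) < \<delta> / (2 * Suc N)" for i
      using Union.prems by (intro Union.IH) auto
    then have "\<forall>i. \<exists>A. A \<in> rectangle_ring \<and> measure M ((E i - A) \<union> (A - E i)) < \<delta> / (2 * Suc N)"
      by blast
    from choice[OF this] obtain A where A: "\<And>i. A i \<in> rectangle_ring"
      "\<And>i. measure M ((E i - A i) \<union> (A i - E i)) < \<delta> / (2 * Suc N)" by blast
    have [measurable]: "A i \<in> sets M" for i using A(1) ring by auto
    let ?B = "\<Union>i<N. A i"
    have "measure M (((\<Union>i. E i) - ?B) \<union> (?B - (\<Union>i. E i)))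
        \<le> measure M (((\<Union>i. E i) - (\<Union>i<N. E i)) \<union> (\<Union>i<N. (E i - A i) \<union> (A i - E i)))"
      by (rule finite_measure_mono) auto
    also have "\<dots> \<le> measure M ((\<Union>i. E i) - (\<Union>i<N. E i)) + measure M (\<Union>i<N. (E i - A i) \<union> (A i - E i))"
      by (rule measure_Un_le) auto
    also have "measure M ((\<Union>i. E i) - (\<Union>i<N. E i)) = measure M (\<Union>i. E i) - measure M (\<Union>i<N. E i)"
      by (rule finite_measure_Diff) auto
    also have "measure M (\<Union>i<N. (E i - A i) \<union> (A i - E i)) \<le> (\<Sum>i<N. measure M ((E i - A i) \<union> (A i - E i)))"
      by (rule finite_measure_subadditive_finite) auto
    also have "\<dots> \<le> (\<Sum>i<N. \<delta> / (2 * Suc N))" using A(2) by (intro sum_mono less_imp_le)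
    also have "\<dots> \<le> \<delta> / 2" using Union.prems by (simp add: field_simps)
    finally have "measure M (((\<Union>i. E i) - ?B) \<union> (?B - (\<Union>i. E i))) < \<delta>" using N by simp
    then show ?case using A(1) by (intro bexI[of _ ?B]) auto
  qed
qed

text \<open>Induction on the set of values. The value \<open>v\<close> is first merged into the
  fallback value \<open>e\<close>, the rest is approximated by \<open>t\<close>, and
  \<open>v\<close> is then written over \<open>t\<close> on a ring set close to
  \<open>{x. s x = v}\<close>; each of the two errors is below \<open>\<delta> / 2\<close>. Control
  of the range is what keeps approximants of test functions within their bounds.\<close>

lemma ring_simple_approx:
  fixes M :: "('a::second_countable_topology \<times> 'b::second_countable_topology) measure"
    and s :: "'a \<times> 'b \<Rightarrow> real"
  assumes "finite_measure M" and sets: "sets M = sets borel" and "finite F"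
    and "s \<in> borel_measurable borel" "range s \<subseteq> insert e F" "0 < \<delta>"
  shows "\<exists>t. ring_simple t \<and> range t \<subseteq> insert e F \<and> measure M {x. s x \<noteq> t x} < \<delta>"
  using assms(3-)
proof (induction F arbitrary: s \<delta> rule: finite_induct)
  case empty
  then have "s = (\<lambda>_. e)" by auto
  with empty show ?case by (intro exI[of _ "\<lambda>_. e"]) (auto simp: ring_simple_const)
next
  case (insert v F)
  interpret finite_measure M by fact
  note [measurable_cong] = sets
  note [measurable] = insert.prems(1)
  have sp: "space M = UNIV" using sets_eq_imp_space_eq[OF sets] by simp
  let ?s = "\<lambda>x. if s x = v then e else s x"
  have "\<exists>t. ring_simple t \<and> range t \<subseteq> insert e F \<and> measure M {x. ?s x \<noteq> t x} < \<delta> / 2"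
  proof (rule insert.IH)
    show "?s \<in> borel_measurable borel" by measurable
    show "range ?s \<subseteq> insert e F" using insert.prems(2) by auto
  qed (use insert.prems(3) in auto)
  then obtain t where t: "ring_simple t" "range t \<subseteq> insert e F" "measure M {x. ?s x \<noteq> t x} < \<delta> / 2" by blast
  note [measurable] = ring_simple_measurable[OF t(1)]
  have E [measurable]: "{x. s x = v} \<in> sets borel" by measurable
  obtain A where A: "A \<in> rectangle_ring" "measure M (({x. s x = v} - A) \<union> (A - {x. s x = v})) < \<delta> / 2"
    using rectangle_ring_approx[OF assms(1,2) E, of "\<delta> / 2"] insert.prems(3) by auto
  note [measurable] = rectangle_ring_borel[OF A(1)]
  let ?t = "\<lambda>x. if x \<in> A then v else t x"
  have D: "{x. ?s x \<noteq> t x} \<in> sets borel" by measurable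
  have "measure M {x. s x \<noteq> ?t x} \<le> measure M ((({x. s x = v} - A) \<union> (A - {x. s x = v})) \<union> {x. ?s x \<noteq> t x})"
    using D by (intro finite_measure_mono) (auto simp: sets)
  also have "\<dots> \<le> measure M (({x. s x = v} - A) \<union> (A - {x. s x = v})) + measure M {x. ?s x \<noteq> t x}"
    using D by (intro measure_Un_le) (auto simp: sets)
  also have "\<dots> < \<delta>" using A(2) t(3) by simp
  finally have "measure M {x. s x \<noteq> ?t x} < \<delta>" .
  moreover have "ring_simple ?t" by (intro ring_simple_If A(1) ring_simple_const t(1))
  ultimately show ?case using t(2) by (intro exI[of _ ?t]) auto
qed

lemma integral_perturb:
  fixes u v :: "'a \<Rightarrow> real"
  assumes "finite_measure M" "integrable M u" "integrable M v" "{x\<in>space M. u x \<noteq> v x} \<subseteq> D" "D \<in> sets M"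
    and "\<And>x. \<bar>u x - v x\<bar> \<le> C"
  shows "integral\<^sup>L M u \<le> integral\<^sup>L M v + C * measure M D"
proof -
  interpret finite_measure M by fact
  have "integral\<^sup>L M u \<le> (\<integral>x. v x + C * indicator D x \<partial>M)"
    using assms by (intro integral_mono integrable_add integrable_mult_right integrable_real_indicator)
      (auto simp: emeasure_eq_measure abs_le_iff split: split_indicator intro: order_trans, smt (verit))
  also have "\<dots> = integral\<^sup>L M v + C * measure M D"
    using assms by (subst Bochner_Integration.integral_add) (auto simp: emeasure_eq_measure)
  finally show ?thesis .
qed

text \<open>\<open>s\<close> is replaced by a ring-simple \<open>t\<close> that agrees with it
  outside a set of \<open>\<xi>\<close>-measure below \<open>\<epsilon> * e\<close>. Both powers lie
  between 0 and \<open>1 / e\<close>, so each integral changes by at most \<open>\<epsilon>\<close>,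
  and so does their convex combination.\<close>

lemma le_young_functional_simple:
  fixes \<mu> \<nu> :: "('a::second_countable_topology \<times> 'b::second_countable_topology) measure"
  assumes \<alpha>: "0 < \<alpha>" "\<alpha> < 1" and fin: "finite_measure \<mu>" "finite_measure \<nu>"
    and sets: "sets \<mu> = sets borel" "sets \<nu> = sets borel" and e: "0 < e"
    and K: "\<And>t. t \<in> test_functions e \<Longrightarrow> ring_simple t \<Longrightarrow> K \<le> young_functional \<alpha> t \<mu> \<nu>"
    and s: "s \<in> test_functions e" "finite (range s)"
  shows "K \<le> young_functional \<alpha> s \<mu> \<nu>"
proof (rule field_le_epsilon)
  fix \<epsilon> :: real assume "0 < \<epsilon>"
  interpret \<mu>: finite_measure \<mu> by fact
  interpret \<nu>: finite_measure \<nu> by fact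
  obtain \<xi> f g where R: "renyi_densities \<alpha> \<mu> \<nu> \<xi> f g"
    and \<xi>: "\<And>A. A \<in> sets borel \<Longrightarrow> emeasure \<xi> A = emeasure \<mu> A + emeasure \<nu> A"
    using renyi_densities_exist[OF \<alpha> fin sets] by metis
  interpret \<xi>: finite_measure \<xi> by (rule renyi_densities.fin[OF R])
  have sm: "s \<in> borel_measurable borel" and sb: "e \<le> s x" "s x \<le> 1 / e" for x
    using s(1) unfolding test_functions_def by blast+
  \<comment> \<open>A value of \<open>s\<close> serves as the fallback value, so \<open>t\<close>
    takes only values of \<open>s\<close> and is again a test function.\<close>
  obtain x0 where "x0 \<in> range s" by auto
  then have "range s \<subseteq> insert x0 (range s)" "insert x0 (range s) = range s" by auto
  moreover have "0 < \<epsilon> * e" using \<open>0 < \<epsilon>\<close> e by simp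
  ultimately obtain t where t: "ring_simple t" "range t \<subseteq> range s" "measure \<xi> {x. s x \<noteq> t x} < \<epsilon> * e"
    using ring_simple_approx[OF \<xi>.finite_measure_axioms renyi_densities.sets[OF R] s(2) sm] by metis
  have tm: "t \<in> borel_measurable borel" by (rule ring_simple_measurable[OF t(1)])
  have "e \<le> t x \<and> t x \<le> 1 / e" for x
  proof -
    have "t x \<in> range s" using t(2) by auto
    then show ?thesis using sb by auto
  qed
  then have te: "t \<in> test_functions e" using tm by (auto simp: test_functions_def)
  let ?D = "{x. s x \<noteq> t x}"
  have D: "?D \<in> sets borel" using sm tm by measurable
  have D\<xi>: "measure \<mu> ?D \<le> measure \<xi> ?D" "measure \<nu> ?D \<le> measure \<xi> ?D"
    using \<xi>[OF D] by (simp_all add: \<mu>.emeasure_eq_measure \<nu>.emeasure_eq_measure \<xi>.emeasure_eq_measure flip: ennreal_plus)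
  note b = test_functions_bounds[OF te e \<alpha>] test_functions_bounds[OF s(1) e \<alpha>]
  have "(\<integral>x. t x powr (\<alpha> - 1) \<partial>\<mu>) \<le> (\<integral>x. s x powr (\<alpha> - 1) \<partial>\<mu>) + 1 / e * measure \<mu> ?D"
  proof (rule integral_perturb[OF fin(1)])
    show "\<bar>t x powr (\<alpha> - 1) - s x powr (\<alpha> - 1)\<bar> \<le> 1 / e" for x
      using b(3)[of x] b(7)[of x] powr_ge_zero[of "t x" "\<alpha> - 1"] powr_ge_zero[of "s x" "\<alpha> - 1"] by linarith
  qed (use D sets test_functions_integrable[OF te e \<alpha> fin(1) sets(1)] test_functions_integrable[OF s(1) e \<alpha> fin(1) sets(1)] in auto)
  also have "\<dots> \<le> (\<integral>x. s x powr (\<alpha> - 1) \<partial>\<mu>) + 1 / e * (\<epsilon> * e)"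
    using D\<xi>(1) t(3) e by (intro add_left_mono mult_left_mono) auto
  finally have 1: "(\<integral>x. t x powr (\<alpha> - 1) \<partial>\<mu>) \<le> (\<integral>x. s x powr (\<alpha> - 1) \<partial>\<mu>) + \<epsilon>" using e by simp
  have "(\<integral>x. t x powr \<alpha> \<partial>\<nu>) \<le> (\<integral>x. s x powr \<alpha> \<partial>\<nu>) + 1 / e * measure \<nu> ?D"
  proof (rule integral_perturb[OF fin(2)])
    show "\<bar>t x powr \<alpha> - s x powr \<alpha>\<bar> \<le> 1 / e" for x
      using b(4)[of x] b(8)[of x] powr_ge_zero[of "t x" "\<alpha>"] powr_ge_zero[of "s x" "\<alpha>"] by linarith
  qed (use D sets test_functions_integrable[OF te e \<alpha> fin(2) sets(2)] test_functions_integrable[OF s(1) e \<alpha> fin(2) sets(2)] in auto)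
  also have "\<dots> \<le> (\<integral>x. s x powr \<alpha> \<partial>\<nu>) + 1 / e * (\<epsilon> * e)"
    using D\<xi>(2) t(3) e by (intro add_left_mono mult_left_mono) auto
  finally have 2: "(\<integral>x. t x powr \<alpha> \<partial>\<nu>) \<le> (\<integral>x. s x powr \<alpha> \<partial>\<nu>) + \<epsilon>" using e by simp
  have "K \<le> young_functional \<alpha> t \<mu> \<nu>" using K[OF te t(1)] .
  also have "\<dots> \<le> \<alpha> * ((\<integral>x. s x powr (\<alpha> - 1) \<partial>\<mu>) + \<epsilon>) + (1 - \<alpha>) * ((\<integral>x. s x powr \<alpha> \<partial>\<nu>) + \<epsilon>)"
    unfolding young_functional_def using 1 2 \<alpha> by (intro add_mono mult_left_mono) auto
  also have "\<dots> = young_functional \<alpha> s \<mu> \<nu> + \<epsilon>" by (simp add: young_functional_def algebra_simps)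
  finally show "K \<le> young_functional \<alpha> s \<mu> \<nu> + \<epsilon>" .
qed

lemma test_functions_simple_approx:
  assumes s: "s \<in> test_functions e" and e: "0 < e"
  obtains t where "\<And>n::nat. t n \<in> test_functions e" "\<And>n. finite (range (t n))" "\<And>x. (\<lambda>n. t n x) \<longlonglongrightarrow> s x"
proof -
  have [measurable]: "s \<in> borel_measurable borel" and sb: "e \<le> s x" "s x \<le> 1 / e" for x
    using s by (auto simp: test_functions_def)
  \<comment> \<open>\<open>s\<close> is rounded down to a multiple of \<open>1 / Suc n\<close>,
    which respects the bound \<open>1 / e\<close>; the maximum with \<open>e\<close> restores the
    lower bound. Only finitely many multiples lie in the range.\<close>
  define t where "t n x = max e (of_int \<lfloor>real (Suc n) * s x\<rfloor> / real (Suc n))" for n x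
  have up: "of_int \<lfloor>real (Suc n) * s x\<rfloor> / real (Suc n) \<le> s x"
    and lo: "s x - 1 / real (Suc n) \<le> of_int \<lfloor>real (Suc n) * s x\<rfloor> / real (Suc n)" for n x
  proof -
    have "of_int \<lfloor>real (Suc n) * s x\<rfloor> \<le> real (Suc n) * s x" "real (Suc n) * s x - 1 \<le> of_int \<lfloor>real (Suc n) * s x\<rfloor>"
      by linarith+
    then have "of_int \<lfloor>real (Suc n) * s x\<rfloor> / real (Suc n) \<le> real (Suc n) * s x / real (Suc n)"
      "(real (Suc n) * s x - 1) / real (Suc n) \<le> of_int \<lfloor>real (Suc n) * s x\<rfloor> / real (Suc n)"
      by (intro divide_right_mono; simp)+
    then show "of_int \<lfloor>real (Suc n) * s x\<rfloor> / real (Suc n) \<le> s x"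
      "s x - 1 / real (Suc n) \<le> of_int \<lfloor>real (Suc n) * s x\<rfloor> / real (Suc n)"
      by (simp_all add: diff_divide_distrib)
  qed
  have tle: "t n x \<le> s x" for n x using up sb by (simp add: t_def)
  have tge: "s x - 1 / real (Suc n) \<le> t n x" for n x using lo[of x n] unfolding t_def by linarith
  show thesis
  proof
    show "t n \<in> test_functions e" for n
    proof -
      have "t n \<in> borel_measurable borel" unfolding t_def by measurable
      moreover have "t n x \<le> 1 / e" for x using tle[of n x] sb(2)[of x] by linarith
      ultimately show ?thesis by (auto simp: test_functions_def) (simp add: t_def)
    qed
    show "finite (range (t n))" for n
    proof (rule finite_subset)
      let ?f = "\<lambda>j. max e (of_int j / real (Suc n))"
      show "range (t n) \<subseteq> ?f ` {0..\<lfloor>real (Suc n) * (1 / e)\<rfloor>}"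
      proof safe
        fix x
        have "0 \<le> s x" using sb(1)[of x] e by linarith
        then have "0 \<le> real (Suc n) * s x" by simp
        moreover have "real (Suc n) * s x \<le> real (Suc n) * (1 / e)"
          using sb(2) by (intro mult_left_mono) auto
        ultimately have "\<lfloor>real (Suc n) * s x\<rfloor> \<in> {0..\<lfloor>real (Suc n) * (1 / e)\<rfloor>}"
          by (simp only: atLeastAtMost_iff zero_le_floor floor_mono simp_thms)
        then show "t n x \<in> ?f ` {0..\<lfloor>real (Suc n) * (1 / e)\<rfloor>}" unfolding t_def by (rule imageI)
      qed
    qed simp
    show "(\<lambda>n. t n x) \<longlonglongrightarrow> s x" for x
    proof (rule tendsto_sandwich[where f = "\<lambda>n. s x - 1 / real (Suc n)" and h = "\<lambda>_. s x"])
      have "(\<lambda>n. s x - 1 / real (Suc n)) \<longlonglongrightarrow> s x - 0"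
        by (intro tendsto_intros) (rule LIMSEQ_Suc[OF lim_1_over_n])
      then show "(\<lambda>n. s x - 1 / real (Suc n)) \<longlonglongrightarrow> s x" by simp
    qed (use tle tge in auto)
  qed
qed

text \<open>Finitely valued test functions converge pointwise to \<open>s\<close>, and both powers
  are dominated by the constant \<open>1 / e\<close>. The constraint thus needs checking only
  against functions whose integrals converge along rectangles.\<close>

lemma le_young_functional_ring_simple:
  fixes \<mu> \<nu> :: "('a::second_countable_topology \<times> 'b::second_countable_topology) measure"
  assumes \<alpha>: "0 < \<alpha>" "\<alpha> < 1" and fin: "finite_measure \<mu>" "finite_measure \<nu>"
    and sets: "sets \<mu> = sets borel" "sets \<nu> = sets borel" and e: "0 < e"
    and K: "\<And>t. t \<in> test_functions e \<Longrightarrow> ring_simple t \<Longrightarrow> K \<le> young_functional \<alpha> t \<mu> \<nu>"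
    and s: "s \<in> test_functions e"
  shows "K \<le> young_functional \<alpha> s \<mu> \<nu>"
proof -
  interpret \<mu>: finite_measure \<mu> by fact
  interpret \<nu>: finite_measure \<nu> by fact
  note [measurable_cong] = sets
  obtain t where t: "\<And>n::nat. t n \<in> test_functions e" "\<And>n. finite (range (t n))" "\<And>x. (\<lambda>n. t n x) \<longlonglongrightarrow> s x"
    using test_functions_simple_approx[OF s e] by blast
  have [measurable]: "s \<in> borel_measurable borel" "\<And>n. t n \<in> borel_measurable borel"
    using s t(1) by (auto simp: test_functions_def)
  note bt = test_functions_bounds[OF t(1) e \<alpha>] and bs = test_functions_bounds[OF s e \<alpha>]
  have lim: "(\<lambda>n. t n x powr r) \<longlonglongrightarrow> s x powr r" for x r
    using bs(2)[of x] by (intro tendsto_powr t tendsto_const) auto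
  have "(\<lambda>n. \<integral>x. t n x powr (\<alpha> - 1) \<partial>\<mu>) \<longlonglongrightarrow> (\<integral>x. s x powr (\<alpha> - 1) \<partial>\<mu>)"
    using bt(3) by (intro integral_dominated_convergence[where w = "\<lambda>_. 1 / e"]) (auto simp: lim)
  moreover have "(\<lambda>n. \<integral>x. t n x powr \<alpha> \<partial>\<nu>) \<longlonglongrightarrow> (\<integral>x. s x powr \<alpha> \<partial>\<nu>)"
    using bt(4) by (intro integral_dominated_convergence[where w = "\<lambda>_. 1 / e"]) (auto simp: lim)
  ultimately have "(\<lambda>n. young_functional \<alpha> (t n) \<mu> \<nu>) \<longlonglongrightarrow> young_functional \<alpha> s \<mu> \<nu>"
    unfolding young_functional_def by (intro tendsto_intros)
  moreover have "K \<le> young_functional \<alpha> (t n) \<mu> \<nu>" for n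
    by (rule le_young_functional_simple[OF \<alpha> fin sets e K t(1,2)])
  ultimately show ?thesis by (intro LIMSEQ_le_const) auto
qed

text \<open>With \<open>\<nu>\<close> fixed, every ring-simple test function turns the constraint
  into an affine inequality in the coupling, and both of its sides converge along
  \<open>G\<close>.\<close>

lemma (in rectangle_limit) renyi_divergence_closed:
  assumes \<alpha>: "0 < \<alpha>" "\<alpha> < 1" and "finite_measure \<nu>" "sets \<nu> = sets borel"
    and "\<And>n. renyi_divergence \<alpha> (\<pi> n) \<nu> \<le> ereal \<gamma>"
  shows "renyi_divergence \<alpha> \<kappa> \<nu> \<le> ereal \<gamma>"
proof -
  note fin = prob_space.finite_measure[OF prob_seq] prob_space.finite_measure[OF prob_lim]
  show ?thesis
    unfolding renyi_divergence_le_iff[OF \<alpha> fin(2) assms(3) sets_lim assms(4)]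
  proof (intro allI impI ballI)
    fix e :: real and s :: "'a \<times> 'b \<Rightarrow> real" assume e: "0 < e" and s: "s \<in> test_functions e"
    show "exp ((\<alpha> - 1) * \<gamma>) \<le> young_functional \<alpha> s \<kappa> \<nu>"
    proof (rule le_young_functional_ring_simple[OF \<alpha> fin(2) assms(3) sets_lim assms(4) e _ s])
      fix t :: "'a \<times> 'b \<Rightarrow> real" assume t: "t \<in> test_functions e" "ring_simple t"
      have "((\<lambda>n. young_functional \<alpha> t (\<pi> n) \<nu>) \<longlongrightarrow> young_functional \<alpha> t \<kappa> \<nu>) G"
        unfolding young_functional_def
        by (intro tendsto_add tendsto_mult tendsto_const
            tendsto_integral_ring_simple[OF ring_simple_comp[OF t(2)]])
      moreover have "exp ((\<alpha> - 1) * \<gamma>) \<le> young_functional \<alpha> t (\<pi> n) \<nu>" for n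
        using assms(5)[of n] e t unfolding renyi_divergence_le_iff[OF \<alpha> fin(1) assms(3) sets_seq assms(4)] by blast
      ultimately show "exp ((\<alpha> - 1) * \<gamma>) \<le> young_functional \<alpha> t \<kappa> \<nu>"
        using nontrivial by (intro tendsto_lowerbound) auto
    qed
  qed
qed

section \<open>The direct method for the constrained transport problem\<close>

lemma sets_pair_borel_probs:
  fixes \<mu> \<nu> :: "'a::polish_space measure"
  assumes "\<mu> \<in> borel_probs" "\<nu> \<in> borel_probs"
  shows "sets (\<mu> \<Otimes>\<^sub>M \<nu>) = sets borel"
  unfolding borel_prod[symmetric] using assms by (intro sets_pair_measure_cong borel_probsD)

lemma prob_space_pair_borel_probs:
  assumes "\<mu> \<in> borel_probs" "\<nu> \<in> borel_probs"
  shows "prob_space (\<mu> \<Otimes>\<^sub>M \<nu>)"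
  using assms by (intro prob_space_pair borel_probsD)

text \<open>The product has constant density 1 with respect to itself, hence divergence 0, which is
  admissible as \<open>0 \<le> \<gamma>\<close>. This makes the feasible set nonempty.\<close>

lemma pair_in_renyi_couplings:
  fixes \<mu> \<nu> :: "'a::polish_space measure"
  assumes \<mu>: "\<mu> \<in> borel_probs" and \<nu>: "\<nu> \<in> borel_probs" and "0 < \<alpha>" "\<alpha> < 1" "0 \<le> \<gamma>"
  shows "\<mu> \<Otimes>\<^sub>M \<nu> \<in> renyi_couplings \<gamma> \<alpha> \<mu> \<nu>"
proof -
  interpret \<mu>: prob_space \<mu> using \<mu> by (rule borel_probsD)
  interpret \<nu>: prob_space \<nu> using \<nu> by (rule borel_probsD)
  interpret P: prob_space "\<mu> \<Otimes>\<^sub>M \<nu>" by (rule prob_space_pair_borel_probs[OF \<mu> \<nu>])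
  have "\<mu> \<Otimes>\<^sub>M \<nu> \<in> couplings \<mu> \<nu>"
    unfolding couplings_def borel_probs_def
  proof (intro CollectI conjI ballI)
    fix A B :: "'a set" assume "A \<in> sets borel" "B \<in> sets borel"
    then show "emeasure (\<mu> \<Otimes>\<^sub>M \<nu>) (A \<times> UNIV) = emeasure \<mu> A" "emeasure (\<mu> \<Otimes>\<^sub>M \<nu>) (UNIV \<times> B) = emeasure \<nu> B"
      using \<nu>.emeasure_space_1 \<mu>.emeasure_space_1 borel_probsD[OF \<mu>] borel_probsD[OF \<nu>]
      by (simp_all add: \<nu>.emeasure_pair_measure_Times)
  qed (fact P.prob_space_axioms sets_pair_borel_probs[OF \<mu> \<nu>])+
  moreover have "renyi_divergence \<alpha> (\<mu> \<Otimes>\<^sub>M \<nu>) (\<mu> \<Otimes>\<^sub>M \<nu>) = renyi_formula \<alpha> (\<lambda>_. 1) (\<lambda>_. 1) (\<mu> \<Otimes>\<^sub>M \<nu>)"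
    by (rule renyi_divergence_eq[where \<xi> = "\<mu> \<Otimes>\<^sub>M \<nu>"])
      (auto intro: P.finite_measure_axioms prob_space_imp_sigma_finite P.prob_space_axioms density_1)
  ultimately show ?thesis
    using assms by (simp add: renyi_couplings_def renyi_formula_def ext_ln_def P.emeasure_space_1 one_ennreal_def[symmetric])
qed

lemma renyi_couplings_minimizer:
  fixes c :: "'a::polish_space \<times> 'a \<Rightarrow> real"
  assumes \<mu>: "\<mu> \<in> borel_probs" and \<nu>: "\<nu> \<in> borel_probs" and \<alpha>: "0 < \<alpha>" "\<alpha> < 1" and "0 \<le> \<gamma>"
    and c: "lower_semicontinuous c" "\<And>x. 0 \<le> c x"
  obtains \<pi> where "\<pi> \<in> renyi_couplings \<gamma> \<alpha> \<mu> \<nu>"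
    "\<And>\<pi>'. \<pi>' \<in> renyi_couplings \<gamma> \<alpha> \<mu> \<nu> \<Longrightarrow> (\<integral>\<^sup>+x. ennreal (c x) \<partial>\<pi>) \<le> (\<integral>\<^sup>+x. ennreal (c x) \<partial>\<pi>')"
proof -
  let ?I = "\<lambda>\<pi>. \<integral>\<^sup>+x. ennreal (c x) \<partial>\<pi>" and ?R = "renyi_couplings \<gamma> \<alpha> \<mu> \<nu>"
  have "?R \<noteq> {}" using pair_in_renyi_couplings[OF \<mu> \<nu> \<alpha> \<open>0 \<le> \<gamma>\<close>] by auto
  then obtain v where v: "range v \<subseteq> ?I ` ?R" "v \<longlonglongrightarrow> Inf (?I ` ?R)"
    using Inf_as_limit[of "?I ` ?R"] by auto
  then have "\<forall>n. \<exists>\<pi>\<in>?R. v n = ?I \<pi>" by auto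
  then obtain \<pi> where \<pi>: "\<And>n. \<pi> n \<in> ?R" "\<And>n. v n = ?I (\<pi> n)" by metis
  have \<pi>c: "\<pi> n \<in> couplings \<mu> \<nu>" for n using \<pi>(1) by (auto simp: renyi_couplings_def)
  obtain G \<kappa> where G: "G \<le> sequentially" "rectangle_limit G \<pi> \<kappa>" "\<kappa> \<in> couplings \<mu> \<nu>"
    using couplings_compact[OF \<mu> \<nu> \<pi>c] .
  have "renyi_divergence \<alpha> \<kappa> (\<mu> \<Otimes>\<^sub>M \<nu>) \<le> ereal \<gamma>"
    using \<pi>(1) prob_space.finite_measure[OF prob_space_pair_borel_probs[OF \<mu> \<nu>]]
    by (intro rectangle_limit.renyi_divergence_closed[OF G(2) \<alpha>])
      (auto simp: renyi_couplings_def sets_pair_borel_probs[OF \<mu> \<nu>])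
  with G(3) have "\<kappa> \<in> ?R" by (simp add: renyi_couplings_def)
  \<comment> \<open>The costs converge along \<open>sequentially\<close>, hence along the finer
    filter \<open>G\<close>.\<close>
  moreover have "((\<lambda>n. ?I (\<pi> n)) \<longlongrightarrow> Inf (?I ` ?R)) G"
    using tendsto_mono[OF G(1) v(2)] by (simp add: \<pi>(2)[symmetric])
  then have "?I \<kappa> \<le> Inf (?I ` ?R)"
    by (rule rectangle_limit.nn_integral_lower_semicontinuous[OF G(2) c])
  ultimately show thesis using that by (meson INF_lower order_trans)
qed

section \<open>Gluing\<close>

lemma measurable_fst_borel [measurable]:
    "fst \<in> borel_measurable (borel :: ('a::second_countable_topology \<times> 'b::second_countable_topology) measure)"
  and measurable_snd_borel [measurable]:
    "snd \<in> borel_measurable (borel :: ('a::second_countable_topology \<times> 'b::second_countable_topology) measure)"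
  by (simp_all flip: borel_prod)

lemma borel_rectangle [measurable (raw)]:
  fixes A :: "'a::second_countable_topology set" and B :: "'b::second_countable_topology set"
  shows "A \<in> sets borel \<Longrightarrow> B \<in> sets borel \<Longrightarrow> A \<times> B \<in> sets borel"
  by (intro rectangle_ring_borel rectangle_in_ring)

lemma measure_eqI_rectangles:
  fixes M N :: "('a::second_countable_topology \<times> 'b::second_countable_topology) measure"
  assumes "finite_measure M" "sets M = sets borel" "sets N = sets borel"
    and "\<And>A B. A \<in> sets borel \<Longrightarrow> B \<in> sets borel \<Longrightarrow> emeasure M (A \<times> B) = emeasure N (A \<times> B)"
  shows "M = N"
proof (rule measure_eqI_generator_eq[where \<Omega> = UNIV and E = borel_rectangles and A = "\<lambda>_. UNIV"])
  show "Int_stable (borel_rectangles :: ('a \<times> 'b) set set)"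
    by (rule Int_stable_pair_measure_generator)
  show "range (\<lambda>_::nat. UNIV) \<subseteq> (borel_rectangles :: ('a \<times> 'b) set set)"
    by (auto intro!: exI[of _ UNIV])
qed (use assms finite_measure.emeasure_finite[OF assms(1)] in \<open>auto simp: sets_borel_rectangles\<close>)

text \<open>
  \<open>g C\<close> plays the role of \<open>x \<mapsto> k(x, C)\<close> for a kernel \<open>k\<close> disintegrating \<open>\<tau>\<close> over its first marginal
  \<open>\<mu>\<close>; it is only additive up to null sets depending on \<open>C\<close>, which suffices to define \<open>\<Theta>\<close> on
  rectangles.
\<close>

locale glued =
  fixes \<xi> :: "('a::second_countable_topology \<times> 'b::second_countable_topology) measure"
    and \<tau> :: "('b \<times> 'c::second_countable_topology) measure" and \<mu> :: "'b measure"
    and \<Theta> :: "(('a \<times> 'b) \<times> 'c) measure" and g :: "'c set \<Rightarrow> 'b \<Rightarrow> ennreal"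
  assumes sets_\<xi> [measurable_cong]: "sets \<xi> = sets borel"
    and sets_\<mu> [measurable_cong]: "sets \<mu> = sets borel"
    and sets_\<Theta> [measurable_cong]: "sets \<Theta> = sets borel"
    and g [measurable]: "C \<in> sets borel \<Longrightarrow> g C \<in> borel_measurable borel"
    and kernel: "B \<in> sets borel \<Longrightarrow> C \<in> sets borel \<Longrightarrow>
      (\<integral>\<^sup>+x. g C x * indicator B x \<partial>\<mu>) = emeasure \<tau> (B \<times> C)"
    and rectangle: "D \<in> sets borel \<Longrightarrow> C \<in> sets borel \<Longrightarrow>
      emeasure \<Theta> (D \<times> C) = (\<integral>\<^sup>+y. g C (snd y) * indicator D y \<partial>\<xi>)"
    and g_UNIV: "AE y in \<xi>. g UNIV (snd y) = 1"
begin

lemma distr_fst: "distr \<Theta> borel fst = \<xi>"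
proof (rule measure_eqI)
  fix D assume "D \<in> sets (distr \<Theta> borel fst)"
  then have [measurable]: "D \<in> sets borel" by simp
  have "emeasure (distr \<Theta> borel fst) D = emeasure \<Theta> (D \<times> UNIV)"
    using sets_eq_imp_space_eq[OF sets_\<Theta>] by (subst emeasure_distr) (auto simp: fst_vimage_eq_Times)
  also have "\<dots> = (\<integral>\<^sup>+y. g UNIV (snd y) * indicator D y \<partial>\<xi>)"
    by (rule rectangle) auto
  also have "\<dots> = (\<integral>\<^sup>+y. indicator D y \<partial>\<xi>)"
    using g_UNIV by (intro nn_integral_cong_AE) auto
  finally show "emeasure (distr \<Theta> borel fst) D = emeasure \<xi> D" by simp
qed (simp add: sets_\<xi>)

text \<open>A weight that depends on the first coordinate only commutes with gluing, so one
  \<open>\<Theta>\<close> serves for every measure with a density with respect to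
  \<open>\<xi>\<close>. The reason is that \<open>\<Theta>\<close>, restricted to
  \<open>UNIV \<times> C\<close> and projected, is \<open>\<xi>\<close> with density
  \<open>g C (snd y)\<close>.\<close>

lemma density_rectangle:
  assumes [measurable]: "h \<in> borel_measurable borel" "D \<in> sets borel" "C \<in> sets borel"
  shows "emeasure (density \<Theta> (\<lambda>z. h (fst z))) (D \<times> C)
    = (\<integral>\<^sup>+y. g C (snd y) * indicator D y \<partial>density \<xi> h)"
proof -
  have [measurable]: "UNIV \<times> C \<in> sets \<Theta>" unfolding sets_\<Theta> by measurable
  have *: "distr (density \<Theta> (indicator (UNIV \<times> C))) borel fst = density \<xi> (\<lambda>y. g C (snd y))"
  proof (rule measure_eqI)
    fix E assume "E \<in> sets (distr (density \<Theta> (indicator (UNIV \<times> C))) borel fst)"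
    then have [measurable]: "E \<in> sets borel" by simp
    have "emeasure (distr (density \<Theta> (indicator (UNIV \<times> C))) borel fst) E
        = emeasure (density \<Theta> (indicator (UNIV \<times> C))) (E \<times> UNIV)"
      using sets_eq_imp_space_eq[OF sets_\<Theta>]
      by (subst emeasure_distr) (auto simp: fst_vimage_eq_Times)
    also have "\<dots> = emeasure \<Theta> (E \<times> C)"
      by (subst emeasure_restricted) (auto simp: Times_Int_Times)
    finally show "emeasure (distr (density \<Theta> (indicator (UNIV \<times> C))) borel fst) E
        = emeasure (density \<xi> (\<lambda>y. g C (snd y))) E"
      by (simp add: rectangle emeasure_density)
  qed (simp add: sets_\<xi>)
  have "emeasure (density \<Theta> (\<lambda>z. h (fst z))) (D \<times> C)
      = (\<integral>\<^sup>+z. indicator (UNIV \<times> C) z * (h (fst z) * indicator D (fst z)) \<partial>\<Theta>)"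
    by (subst emeasure_density) (auto intro!: nn_integral_cong split: split_indicator)
  also have "\<dots> = (\<integral>\<^sup>+y. h y * indicator D y \<partial>distr (density \<Theta> (indicator (UNIV \<times> C))) borel fst)"
    by (subst nn_integral_distr, measurable, subst nn_integral_density) auto
  also have "\<dots> = (\<integral>\<^sup>+y. g C (snd y) * indicator D y \<partial>density \<xi> h)"
    unfolding * by (simp add: nn_integral_density mult_ac)
  finally show ?thesis .
qed

end

text \<open>\<open>I D C\<close> is the mass that the glued measure must give to
  \<open>D \<times> C\<close>. It is dominated by \<open>\<xi>\<close> in \<open>D\<close> and by
  \<open>w\<close> times the second marginal of \<open>\<tau>\<close> in \<open>C\<close>, so the
  extension of tight bimeasures takes the place of a regular conditional probability. The factor
  \<open>w\<close> admits a \<open>\<xi>\<close> whose second marginal is a multiple of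
  \<open>\<mu>\<close>.\<close>

lemma gluing:
  fixes \<xi> :: "('a::{second_countable_topology, complete_space} \<times> 'b::{second_countable_topology, complete_space}) measure"
    and \<tau> :: "('b \<times> 'c::{second_countable_topology, complete_space}) measure" and \<mu> :: "'b measure"
  assumes fin: "finite_measure \<xi>" "finite_measure \<tau>" "finite_measure \<mu>"
    and sets [measurable_cong]: "sets \<xi> = sets borel" "sets \<tau> = sets borel" "sets \<mu> = sets borel"
    and \<tau>\<mu>: "\<And>B. B \<in> sets borel \<Longrightarrow> emeasure \<tau> (B \<times> UNIV) = emeasure \<mu> B"
    and \<xi>\<mu>: "\<And>B. B \<in> sets borel \<Longrightarrow> emeasure \<xi> (UNIV \<times> B) = w * emeasure \<mu> B" and w: "w < \<infinity>"
  obtains \<Theta> g where "glued \<xi> \<tau> \<mu> \<Theta> g"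
proof -
  interpret \<xi>: finite_measure \<xi> by fact
  interpret \<tau>: finite_measure \<tau> by fact
  interpret \<mu>: finite_measure \<mu> by fact
  have space: "space \<xi> = UNIV" "space \<tau> = UNIV" "space \<mu> = UNIV"
    using sets[THEN sets_eq_imp_space_eq] by simp_all
  define \<kappa> where "\<kappa> C = distr (density \<tau> (indicator (UNIV \<times> C))) borel fst" for C
  define g where "g C = RN_deriv \<mu> (\<kappa> C)" for C
  have \<kappa>: "emeasure (\<kappa> C) B = emeasure \<tau> (B \<times> C)" if [measurable]: "B \<in> sets borel" "C \<in> sets borel" for B C
  proof -
    have "emeasure (\<kappa> C) B = emeasure (density \<tau> (indicator (UNIV \<times> C))) (B \<times> UNIV)"
      unfolding \<kappa>_def using space by (subst emeasure_distr) (auto simp: fst_vimage_eq_Times)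
    also have "\<dots> = emeasure \<tau> (B \<times> C)"
      by (subst emeasure_restricted) (auto simp: Times_Int_Times)
    finally show ?thesis .
  qed
  have ac: "absolutely_continuous \<mu> (\<kappa> C)" if [measurable]: "C \<in> sets borel" for C
    unfolding absolutely_continuous_def
  proof
    fix N assume "N \<in> null_sets \<mu>"
    then have N [measurable]: "N \<in> sets borel" and 0: "emeasure \<mu> N = 0" by (auto simp: null_sets_def sets)
    have "emeasure \<tau> (N \<times> C) \<le> emeasure \<tau> (N \<times> UNIV)" by (intro emeasure_mono) auto
    then show "N \<in> null_sets (\<kappa> C)" using 0 by (auto simp: null_sets_def \<kappa> \<tau>\<mu>) (simp add: \<kappa>_def)
  qed
  have gm [measurable]: "g C \<in> borel_measurable borel" for C
    using borel_measurable_RN_deriv[of \<mu> "\<kappa> C"] measurable_cong_sets[OF sets(3) refl]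
    unfolding g_def by auto
  have dens: "density \<mu> (g C) = \<kappa> C" if "C \<in> sets borel" for C
    unfolding g_def by (rule \<mu>.density_RN_deriv[OF ac[OF that]]) (simp add: \<kappa>_def sets)
  have kernel: "(\<integral>\<^sup>+x. g C x * indicator B x \<partial>\<mu>) = emeasure \<tau> (B \<times> C)"
    if [measurable]: "B \<in> sets borel" "C \<in> sets borel" for B C
  proof -
    have "emeasure (density \<mu> (g C)) B = emeasure \<tau> (B \<times> C)" by (simp add: dens \<kappa>)
    then show ?thesis by (simp add: emeasure_density)
  qed
  have marg: "distr \<xi> borel snd = scale_measure w \<mu>"
    by (rule measure_eqI) (auto simp: sets emeasure_distr snd_vimage_eq_Times space \<xi>\<mu>)
  \<comment> \<open>The second marginal of \<open>\<xi>\<close> is a multiple of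
    \<open>\<mu>\<close>, so the relations between the derivatives \<open>g C\<close>, known almost
    everywhere for \<open>\<mu>\<close>, may be used under \<open>\<xi>\<close>.\<close>
  have AE_\<xi>: "AE y in \<xi>. P (snd y)" if "AE x in \<mu>. P x" for P
  proof -
    have "absolutely_continuous \<mu> (distr \<xi> borel snd)"
      unfolding marg absolutely_continuous_def by (auto simp: null_sets_def)
    then have "AE x in distr \<xi> borel snd. P x"
      using that by (rule absolutely_continuous_AE[rotated]) (simp add: sets)
    then show ?thesis by (rule AE_distrD[rotated]) measurable
  qed
  define I where "I D C = (\<integral>\<^sup>+y. g C (snd y) * indicator D y \<partial>\<xi>)" for D C
  have g_Un: "AE x in \<mu>. g (C \<union> C') x = g C x + g C' x"
    if [measurable]: "C \<in> sets borel" "C' \<in> sets borel" and "C \<inter> C' = {}" for C C'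
  proof (rule \<mu>.density_unique_finite_measure)
    fix A assume "A \<in> sets \<mu>"
    then have [measurable]: "A \<in> sets borel" by (simp add: sets)
    have "emeasure \<tau> (A \<times> (C \<union> C')) = emeasure \<tau> (A \<times> C) + emeasure \<tau> (A \<times> C')"
      unfolding Sigma_Un_distrib2 using that(3) by (intro plus_emeasure[symmetric]) auto
    then show "(\<integral>\<^sup>+x. g (C \<union> C') x * indicator A x \<partial>\<mu>) = (\<integral>\<^sup>+x. (g C x + g C' x) * indicator A x \<partial>\<mu>)"
      by (simp add: kernel distrib_right nn_integral_add)
  qed auto
  have g_UNIV: "AE x in \<mu>. g UNIV x = 1"
  proof (rule \<mu>.density_unique_finite_measure)
    fix A assume "A \<in> sets \<mu>"
    then have [measurable]: "A \<in> sets borel" by (simp add: sets)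
    show "(\<integral>\<^sup>+x. g UNIV x * indicator A x \<partial>\<mu>) = (\<integral>\<^sup>+x. 1 * indicator A x \<partial>\<mu>)"
      by (simp add: kernel \<tau>\<mu>)
  qed auto
  have I_UNIV: "I D UNIV = emeasure \<xi> D" if [measurable]: "D \<in> sets borel" for D
  proof -
    have "I D UNIV = (\<integral>\<^sup>+y. indicator D y \<partial>\<xi>)"
      unfolding I_def using AE_\<xi>[OF g_UNIV] by (intro nn_integral_cong_AE) auto
    then show ?thesis by simp
  qed
  have I_Un2: "I D (C \<union> C') = I D C + I D C'"
    if [measurable]: "D \<in> sets borel" "C \<in> sets borel" "C' \<in> sets borel" and "C \<inter> C' = {}" for D C C'
  proof -
    have "I D (C \<union> C') = (\<integral>\<^sup>+y. g C (snd y) * indicator D y + g C' (snd y) * indicator D y \<partial>\<xi>)"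
      unfolding I_def using AE_\<xi>[OF g_Un[OF that(2-4)]]
      by (intro nn_integral_cong_AE) (auto simp: distrib_right)
    then show ?thesis by (simp add: I_def nn_integral_add)
  qed
  have I_Un1: "I (D \<union> D') C = I D C + I D' C"
    if [measurable]: "D \<in> sets borel" "D' \<in> sets borel" "C \<in> sets borel" and "D \<inter> D' = {}" for D D' C
  proof -
    have "g C (snd y) * indicator (D \<union> D') y = g C (snd y) * indicator D y + g C (snd y) * indicator D' y" for y
      using that(4) by (auto split: split_indicator)
    then show ?thesis by (simp add: I_def nn_integral_add)
  qed
  have I_le1: "I D C \<le> emeasure \<xi> D" if [measurable]: "D \<in> sets borel" "C \<in> sets borel" for D C
  proof -
    have "I D UNIV = I D C + I D (- C)"
      using I_Un2[of D C "- C"] by simp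
    then show ?thesis using I_UNIV[of D] by simp
  qed
  have I_le2: "I D C \<le> w * emeasure \<tau> (UNIV \<times> C)" if [measurable]: "D \<in> sets borel" "C \<in> sets borel" for D C
  proof -
    have "I D C \<le> I UNIV C" unfolding I_def by (intro nn_integral_mono) (auto split: split_indicator)
    also have "\<dots> = (\<integral>\<^sup>+x. g C x \<partial>distr \<xi> borel snd)" by (simp add: I_def nn_integral_distr)
    also have "\<dots> = w * emeasure \<tau> (UNIV \<times> C)"
      using kernel[of UNIV C] unfolding marg by (simp add: nn_integral_scale_measure)
    finally show ?thesis .
  qed
  have I_fin: "I D C < \<infinity>" if "D \<in> sets borel" "C \<in> sets borel" for D C
    using I_le1[OF that] \<xi>.emeasure_finite[of D] by (auto simp: less_top[symmetric] top_unique)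
  \<comment> \<open>The measure that dominates the bimeasure in its second variable.\<close>
  define \<sigma> where "\<sigma> = scale_measure w (distr \<tau> borel snd)"
  have \<sigma>: "emeasure \<sigma> C = w * emeasure \<tau> (UNIV \<times> C)" if "C \<in> sets borel" for C
    using that by (simp add: \<sigma>_def emeasure_distr snd_vimage_eq_Times space)
  interpret \<sigma>: finite_measure \<sigma>
  proof
    show "emeasure \<sigma> (space \<sigma>) \<noteq> \<infinity>"
      using w \<sigma>[of UNIV] by (simp add: \<sigma>_def space_scale_measure ennreal_mult_eq_top_iff)
  qed
  interpret tight_bimeasure "\<lambda>D C. enn2real (I D C)" \<xi> \<sigma>
  proof (rule tight_bimeasure.intro)
    show "sets \<sigma> = sets borel" by (simp add: \<sigma>_def)
    fix A A' :: "('a \<times> 'b) set" and B :: "'c set" assume "A \<in> sets borel" "A' \<in> sets borel" "B \<in> sets borel" "A \<inter> A' = {}"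
    then show "enn2real (I (A \<union> A') B) = enn2real (I A B) + enn2real (I A' B)"
      using I_fin by (simp add: I_Un1 enn2real_plus)
  next
    fix A :: "('a \<times> 'b) set" and B B' :: "'c set" assume "A \<in> sets borel" "B \<in> sets borel" "B' \<in> sets borel" "B \<inter> B' = {}"
    then show "enn2real (I A (B \<union> B')) = enn2real (I A B) + enn2real (I A B')"
      using I_fin by (simp add: I_Un2 enn2real_plus)
  next
    fix A :: "('a \<times> 'b) set" and B :: "'c set" assume AB: "A \<in> sets borel" "B \<in> sets borel"
    show "enn2real (I A B) \<le> measure \<xi> A"
      unfolding measure_def using I_le1[OF AB] \<xi>.emeasure_finite[of A] by (intro enn2real_mono) (auto simp: less_top[symmetric])
    show "enn2real (I A B) \<le> measure \<sigma> B"
      unfolding measure_def using I_le2[OF AB] \<sigma>[OF AB(2)] \<sigma>.emeasure_finite[of B]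
      by (intro enn2real_mono) (auto simp: less_top[symmetric])
  qed (auto simp: sets intro: fin \<sigma>.finite_measure_axioms)
  obtain \<Theta> where \<Theta>: "sets \<Theta> = sets borel"
    "\<And>D C. D \<in> sets borel \<Longrightarrow> C \<in> sets borel \<Longrightarrow> emeasure \<Theta> (D \<times> C) = ennreal (enn2real (I D C))"
    using bimeasure_extension by blast
  have "glued \<xi> \<tau> \<mu> \<Theta> g"
  proof (rule glued.intro)
    fix D :: "('a \<times> 'b) set" and C :: "'c set" assume DC: "D \<in> sets borel" "C \<in> sets borel"
    show "emeasure \<Theta> (D \<times> C) = (\<integral>\<^sup>+y. g C (snd y) * indicator D y \<partial>\<xi>)"
      using \<Theta>(2)[OF DC] I_fin[OF DC] by (simp add: I_def)
  qed (simp_all add: sets \<Theta> gm kernel AE_\<xi>[OF g_UNIV])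
  then show thesis by (rule that)
qed

text \<open>Lifting loses nothing: both densities depend only on the first coordinate of
  \<open>\<Theta>\<close>, whose law is \<open>\<xi>\<close>.\<close>

lemma (in glued) renyi_densities_glued:
  assumes R: "renyi_densities \<alpha> \<pi> \<nu> \<xi> f h"
  shows "renyi_densities \<alpha> (density \<Theta> (\<lambda>z. ennreal (f (fst z)))) (density \<Theta> (\<lambda>z. ennreal (h (fst z))))
      \<Theta> (\<lambda>z. f (fst z)) (\<lambda>z. h (fst z))"
    and "renyi_densities.hellinger \<alpha> \<Theta> (\<lambda>z. f (fst z)) (\<lambda>z. h (fst z)) = renyi_densities.hellinger \<alpha> \<xi> f h"
proof -
  interpret R: renyi_densities \<alpha> \<pi> \<nu> \<xi> f h by fact
  note [measurable] = R.meas
  note \<Theta>1 = distr_fst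
  have "finite_measure \<Theta>"
  proof
    have "emeasure \<Theta> (space \<Theta>) = emeasure (distr \<Theta> borel fst) (space \<xi>)"
      using sets_eq_imp_space_eq[OF sets_\<Theta>] sets_eq_imp_space_eq[OF sets_\<xi>] by (simp add: emeasure_distr)
    then show "emeasure \<Theta> (space \<Theta>) \<noteq> \<infinity>"
      unfolding \<Theta>1 using finite_measure.emeasure_finite[OF R.fin, of "space \<xi>"] by simp
  qed
  have fin: "finite_measure (density \<Theta> (\<lambda>z. ennreal (u (fst z))))"
    if [measurable]: "u \<in> borel_measurable borel" and "finite_measure (density \<xi> (\<lambda>y. ennreal (u y)))" for u
  proof
    interpret u: finite_measure "density \<xi> (\<lambda>y. ennreal (u y))" by fact
    have "emeasure (density \<Theta> (\<lambda>z. ennreal (u (fst z)))) (space \<Theta>) = (\<integral>\<^sup>+y. ennreal (u y) \<partial>distr \<Theta> borel fst)"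
      by (subst nn_integral_distr) (auto simp: emeasure_density intro!: nn_integral_cong)
    also have "\<dots> = emeasure (density \<xi> (\<lambda>y. ennreal (u y))) (space \<xi>)"
      unfolding \<Theta>1 by (auto simp: emeasure_density intro!: nn_integral_cong)
    finally show "emeasure (density \<Theta> (\<lambda>z. ennreal (u (fst z)))) (space (density \<Theta> (\<lambda>z. ennreal (u (fst z))))) \<noteq> \<infinity>"
      using u.emeasure_finite[of "space \<xi>"] by simp
  qed
  show D: "renyi_densities \<alpha> (density \<Theta> (\<lambda>z. ennreal (f (fst z)))) (density \<Theta> (\<lambda>z. ennreal (h (fst z))))
      \<Theta> (\<lambda>z. f (fst z)) (\<lambda>z. h (fst z))"
  proof (rule renyi_densities.intro)
    show "finite_measure (density \<Theta> (\<lambda>z. ennreal (f (fst z))))" "finite_measure (density \<Theta> (\<lambda>z. ennreal (h (fst z))))"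
      using fin[of f] fin[of h] R.dens R.fin_\<mu> R.fin_\<nu> by simp_all
  qed (use R.\<alpha> R.pos \<open>finite_measure \<Theta>\<close> sets_\<Theta> in auto)
  show "renyi_densities.hellinger \<alpha> \<Theta> (\<lambda>z. f (fst z)) (\<lambda>z. h (fst z)) = R.hellinger"
    unfolding renyi_densities.hellinger_def[OF D] R.hellinger_def
    by (subst \<Theta>1[symmetric], subst integral_distr) auto
qed

text \<open>\<open>\<Psi>\<close> and \<open>M\<close> continue \<open>\<pi>\<close> and the product
  of \<open>\<mu>1\<close> and \<open>\<mu>2\<close> by the same kernel and have the same Hellinger
  integral as these. On the outer coordinates \<open>M\<close> becomes the product of
  \<open>\<mu>1\<close> and \<open>\<mu>3\<close>, and the projection of \<open>\<Psi>\<close> is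
  the required coupling.\<close>

lemma renyi_couplings_glue:
  fixes \<mu>1 \<mu>2 \<mu>3 :: "'a::polish_space measure"
  assumes \<mu>: "\<mu>1 \<in> borel_probs" "\<mu>2 \<in> borel_probs" "\<mu>3 \<in> borel_probs" and \<alpha>: "0 < \<alpha>" "\<alpha> < 1"
    and \<pi>: "\<pi> \<in> renyi_couplings \<gamma> \<alpha> \<mu>1 \<mu>2" and \<tau>: "\<tau> \<in> couplings \<mu>2 \<mu>3"
  obtains \<Psi> :: "(('a \<times> 'a) \<times> 'a) measure" where "sets \<Psi> = sets borel"
    "distr \<Psi> borel fst = \<pi>" "distr \<Psi> borel (\<lambda>z. (snd (fst z), snd z)) = \<tau>"
    "distr \<Psi> borel (\<lambda>z. (fst (fst z), snd z)) \<in> renyi_couplings \<gamma> \<alpha> \<mu>1 \<mu>3"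
proof -
  interpret \<mu>1: prob_space \<mu>1 using \<mu>(1) by (rule borel_probsD)
  interpret \<mu>2: prob_space \<mu>2 using \<mu>(2) by (rule borel_probsD)
  interpret \<mu>3: prob_space \<mu>3 using \<mu>(3) by (rule borel_probsD)
  note sets [measurable_cong] = borel_probsD(2)[OF \<mu>(1)] borel_probsD(2)[OF \<mu>(2)] borel_probsD(2)[OF \<mu>(3)]
  have \<pi>c: "\<pi> \<in> couplings \<mu>1 \<mu>2" and \<pi>R: "renyi_divergence \<alpha> \<pi> (\<mu>1 \<Otimes>\<^sub>M \<mu>2) \<le> ereal \<gamma>"
    using \<pi> by (simp_all add: renyi_couplings_def)
  interpret \<pi>: prob_space \<pi> using \<pi>c by (rule couplingsD)
  interpret \<tau>: prob_space \<tau> using \<tau> by (rule couplingsD)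
  interpret m: prob_space "\<mu>1 \<Otimes>\<^sub>M \<mu>2" using \<mu>(1,2) by (rule prob_space_pair_borel_probs)
  note sm = sets_pair_borel_probs[OF \<mu>(1,2)]
  note [measurable_cong] = couplingsD(2)[OF \<pi>c] couplingsD(2)[OF \<tau>]
  obtain \<xi> f h where R: "renyi_densities \<alpha> \<pi> (\<mu>1 \<Otimes>\<^sub>M \<mu>2) \<xi> f h"
    and \<xi>: "\<And>A. A \<in> sets borel \<Longrightarrow> emeasure \<xi> A = emeasure \<pi> A + emeasure (\<mu>1 \<Otimes>\<^sub>M \<mu>2) A"
    using renyi_densities_exist[OF \<alpha> \<pi>.finite_measure_axioms m.finite_measure_axioms couplingsD(2)[OF \<pi>c] sm]
    by blast
  interpret R: renyi_densities \<alpha> \<pi> "\<mu>1 \<Otimes>\<^sub>M \<mu>2" \<xi> f h by fact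
  note [measurable] = R.meas
  have m12: "emeasure (\<mu>1 \<Otimes>\<^sub>M \<mu>2) (A \<times> B) = emeasure \<mu>1 A * emeasure \<mu>2 B"
    if "A \<in> sets borel" "B \<in> sets borel" for A B
    using that sets by (intro \<mu>2.emeasure_pair_measure_Times) auto
  have one: "emeasure \<mu>1 UNIV = 1" "emeasure \<mu>2 UNIV = 1" "emeasure \<mu>3 UNIV = 1"
    using \<mu>1.emeasure_space_1 \<mu>2.emeasure_space_1 \<mu>3.emeasure_space_1 \<mu>[THEN borel_probsD(3)] by simp_all
  \<comment> \<open>\<open>\<pi>\<close> and the product both have second marginal
    \<open>\<mu>2\<close>, and \<open>\<xi>\<close> is their sum; hence the weight 2.\<close>
  have \<xi>2: "emeasure \<xi> (UNIV \<times> B) = 2 * emeasure \<mu>2 B" if "B \<in> sets borel" for B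
    using \<xi>[OF borel_rectangle, of UNIV B] that couplingsD(5)[OF \<pi>c that] m12[of UNIV B] by (simp add: one mult_2)
  have two: "(2::ennreal) < \<infinity>" by simp
  obtain \<Theta> g where "glued \<xi> \<tau> \<mu>2 \<Theta> g"
    by (rule gluing[OF R.fin \<tau>.finite_measure_axioms \<mu>2.finite_measure_axioms R.sets couplingsD(2)[OF \<tau>]
      sets(2) couplingsD(4)[OF \<tau>] \<xi>2 two])
  then interpret G: glued \<xi> \<tau> \<mu>2 \<Theta> g .
  note sets\<Theta> = G.sets_\<Theta>
  note [measurable_cong] = sets\<Theta> R.sets
  have int_snd: "(\<integral>\<^sup>+y. k (snd y) \<partial>M) = (\<integral>\<^sup>+x. k x \<partial>\<mu>2)"
    if [measurable]: "k \<in> borel_measurable borel" and M: "M \<in> couplings \<mu>1 \<mu>2" for k M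
  proof -
    note [measurable_cong] = couplingsD(2)[OF M]
    have "distr M borel snd = \<mu>2"
      using couplingsD(3,5)[OF M] by (intro measure_eqI) (auto simp: sets emeasure_distr snd_vimage_eq_Times)
    then have "(\<integral>\<^sup>+x. k x \<partial>\<mu>2) = (\<integral>\<^sup>+x. k x \<partial>distr M borel snd)" by simp
    also have "\<dots> = (\<integral>\<^sup>+y. k (snd y) \<partial>M)" by (rule nn_integral_distr) measurable
    finally show ?thesis ..
  qed
  have \<mu>3: "(\<integral>\<^sup>+x. g C x \<partial>\<mu>2) = emeasure \<mu>3 C" if [measurable]: "C \<in> sets borel" for C
    using G.kernel[of UNIV C] couplingsD(5)[OF \<tau>, of C] by simp
  define \<Psi> where "\<Psi> = density \<Theta> (\<lambda>z. ennreal (f (fst z)))"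
  define M where "M = density \<Theta> (\<lambda>z. ennreal (h (fst z)))"
  let ?q = "\<lambda>z::('a \<times> 'a) \<times> 'a. (fst (fst z), snd z)" and ?r = "\<lambda>z::('a \<times> 'a) \<times> 'a. (snd (fst z), snd z)"
  have s\<Psi> [measurable_cong]: "sets \<Psi> = sets borel" "sets M = sets borel"
    by (simp_all add: \<Psi>_def M_def sets\<Theta>)
  note sp\<Psi> = s\<Psi>[THEN sets_eq_imp_space_eq, simplified]
  have R\<Theta>: "renyi_densities \<alpha> \<Psi> M \<Theta> (\<lambda>z. f (fst z)) (\<lambda>z. h (fst z))"
    and hell: "renyi_densities.hellinger \<alpha> \<Theta> (\<lambda>z. f (fst z)) (\<lambda>z. h (fst z)) = R.hellinger"
    unfolding \<Psi>_def M_def by (fact G.renyi_densities_glued[OF R])+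
  have rect: "emeasure \<Psi> (D \<times> C) = (\<integral>\<^sup>+y. g C (snd y) * indicator D y \<partial>\<pi>)"
    "emeasure M (D \<times> C) = (\<integral>\<^sup>+y. g C (snd y) * indicator D y \<partial>(\<mu>1 \<Otimes>\<^sub>M \<mu>2))"
    if "D \<in> sets borel" "C \<in> sets borel" for D C
    using G.density_rectangle[of "\<lambda>y. ennreal (f y)", OF _ that] G.density_rectangle[of "\<lambda>y. ennreal (h y)", OF _ that]
    by (simp_all add: \<Psi>_def M_def R.dens)
  have \<Psi>1: "distr \<Psi> borel fst = \<pi>"
    using density_distr[of "\<lambda>y. ennreal (f y)" borel fst \<Theta>] by (simp add: \<Psi>_def G.distr_fst R.dens)
  have \<Psi>fst: "emeasure \<Psi> (D \<times> UNIV) = emeasure \<pi> D" if "D \<in> sets borel" for D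
    unfolding \<Psi>1[symmetric] using that by (subst emeasure_distr) (auto simp: fst_vimage_eq_Times sp\<Psi>)
  have "emeasure \<Psi> (space \<Psi>) = 1"
    using \<Psi>fst[of UNIV] \<pi>.emeasure_space_1 couplingsD(3)[OF \<pi>c] by (simp add: sp\<Psi>)
  then interpret \<Psi>: prob_space \<Psi> by (rule prob_spaceI)
  have q: "emeasure (distr N borel ?q) (A \<times> C) = emeasure N ((A \<times> UNIV) \<times> C)"
    "emeasure (distr N borel ?r) (A \<times> C) = emeasure N ((UNIV \<times> A) \<times> C)"
    if [measurable]: "A \<in> sets borel" "C \<in> sets borel" and N [measurable_cong]: "sets N = sets borel" for A C N
  proof -
    have "?q -` (A \<times> C) = (A \<times> UNIV) \<times> C" "?r -` (A \<times> C) = (UNIV \<times> A) \<times> C" by auto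
    then show "emeasure (distr N borel ?q) (A \<times> C) = emeasure N ((A \<times> UNIV) \<times> C)"
      "emeasure (distr N borel ?r) (A \<times> C) = emeasure N ((UNIV \<times> A) \<times> C)"
      using sets_eq_imp_space_eq[OF N] by (simp_all add: emeasure_distr)
  qed
  have \<Psi>2: "emeasure \<Psi> ((UNIV \<times> B) \<times> C) = emeasure \<tau> (B \<times> C)"
    if [measurable]: "B \<in> sets borel" "C \<in> sets borel" for B C
  proof -
    have "emeasure \<Psi> ((UNIV \<times> B) \<times> C) = (\<integral>\<^sup>+y. g C (snd y) * indicator B (snd y) \<partial>\<pi>)"
      by (subst rect) (auto intro!: nn_integral_cong split: split_indicator)
    also have "\<dots> = (\<integral>\<^sup>+x. g C x * indicator B x \<partial>\<mu>2)"
      by (rule int_snd[OF _ \<pi>c]) measurable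
    also have "\<dots> = emeasure \<tau> (B \<times> C)" by (rule G.kernel) measurable
    finally show ?thesis .
  qed
  have \<Psi>23: "distr \<Psi> borel ?r = \<tau>"
  proof (rule measure_eqI_rectangles)
    show "finite_measure (distr \<Psi> borel ?r)" by (rule \<Psi>.finite_measure_distr) measurable
  qed (simp_all add: couplingsD(2)[OF \<tau>] q s\<Psi> \<Psi>2)
  \<comment> \<open>Under \<open>M\<close> the first and the middle coordinate are independent, so
    integrating out the middle one averages \<open>g C\<close> over \<open>\<mu>2\<close>, which
    gives the \<open>\<mu>3\<close>-mass of \<open>C\<close>.\<close>
  have M13: "\<mu>1 \<Otimes>\<^sub>M \<mu>3 = distr M borel ?q"
  proof (rule pair_measure_eqI)
    show "sigma_finite_measure \<mu>1" "sigma_finite_measure \<mu>3" by unfold_locales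
    show "sets (\<mu>1 \<Otimes>\<^sub>M \<mu>3) = sets (distr M borel ?q)" by (simp add: sets_pair_borel_probs[OF \<mu>(1,3)])
    fix A C assume "A \<in> sets \<mu>1" "C \<in> sets \<mu>3"
    then have [measurable]: "A \<in> sets borel" "C \<in> sets borel" by (simp_all add: sets)
    have "emeasure (distr M borel ?q) (A \<times> C) = (\<integral>\<^sup>+y. g C (snd y) * indicator (A \<times> UNIV) y \<partial>(\<mu>1 \<Otimes>\<^sub>M \<mu>2))"
      by (simp add: q s\<Psi> rect)
    also have "\<dots> = (\<integral>\<^sup>+x. \<integral>\<^sup>+x'. g C (snd (x, x')) * indicator (A \<times> UNIV) (x, x') \<partial>\<mu>2 \<partial>\<mu>1)"
      by (rule \<mu>2.nn_integral_fst[symmetric]) (unfold measurable_cong_sets[OF sm refl],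
          intro borel_measurable_times_ennreal measurable_compose[OF measurable_snd_borel] G.g
          borel_measurable_indicator borel_rectangle; simp)
    also have "\<dots> = (\<integral>\<^sup>+x. emeasure \<mu>3 C * indicator A x \<partial>\<mu>1)"
    proof (rule nn_integral_cong)
      fix x
      have "(\<integral>\<^sup>+x'. g C (snd (x, x')) * indicator (A \<times> UNIV) (x, x') \<partial>\<mu>2) = (\<integral>\<^sup>+x'. g C x' * indicator A x \<partial>\<mu>2)"
        by (intro nn_integral_cong) (auto split: split_indicator)
      also have "\<dots> = emeasure \<mu>3 C * indicator A x" by (simp add: nn_integral_multc \<mu>3)
      finally show "(\<integral>\<^sup>+x'. g C (snd (x, x')) * indicator (A \<times> UNIV) (x, x') \<partial>\<mu>2) = emeasure \<mu>3 C * indicator A x" .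
    qed
    also have "\<dots> = emeasure \<mu>1 A * emeasure \<mu>3 C" by (subst nn_integral_cmult_indicator) (simp_all add: sets mult.commute)
    finally show "emeasure \<mu>1 A * emeasure \<mu>3 C = emeasure (distr M borel ?q) (A \<times> C)" ..
  qed
  have "distr \<Psi> borel ?q \<in> couplings \<mu>1 \<mu>3"
    unfolding couplings_def borel_probs_def
  proof (intro CollectI conjI ballI)
    show "prob_space (distr \<Psi> borel ?q)" by (rule \<Psi>.prob_space_distr) measurable
    fix A C :: "'a set" assume AC: "A \<in> sets borel" "C \<in> sets borel"
    show "emeasure (distr \<Psi> borel ?q) (A \<times> UNIV) = emeasure \<mu>1 A"
      using AC couplingsD(4)[OF \<pi>c AC(1)] by (simp add: q s\<Psi> \<Psi>fst borel_rectangle)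
    show "emeasure (distr \<Psi> borel ?q) (UNIV \<times> C) = emeasure \<mu>3 C"
      using AC couplingsD(5)[OF \<tau> AC(2)] \<Psi>2[of UNIV C] by (simp add: q s\<Psi>)
  qed simp
  moreover have "renyi_divergence \<alpha> (distr \<Psi> borel ?q) (\<mu>1 \<Otimes>\<^sub>M \<mu>3) \<le> ereal \<gamma>"
  proof (subst renyi_divergence_le_iff[OF \<alpha>])
    show "finite_measure (distr \<Psi> borel ?q)" by (rule \<Psi>.finite_measure_distr) measurable
    show "finite_measure (\<mu>1 \<Otimes>\<^sub>M \<mu>3)"
      using prob_space_pair_borel_probs[OF \<mu>(1,3)] by (rule prob_space.finite_measure)
    show "sets (\<mu>1 \<Otimes>\<^sub>M \<mu>3) = sets borel" by (rule sets_pair_borel_probs[OF \<mu>(1,3)])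
    show "\<forall>e>0. \<forall>s\<in>test_functions e. exp ((\<alpha> - 1) * \<gamma>) \<le> young_functional \<alpha> s (distr \<Psi> borel ?q) (\<mu>1 \<Otimes>\<^sub>M \<mu>3)"
    proof (intro allI impI ballI)
      fix e :: real and s :: "'a \<times> 'a \<Rightarrow> real" assume e: "0 < e" and s: "s \<in> test_functions e"
      have [measurable]: "s \<in> borel_measurable borel" using s by (simp add: test_functions_def)
      \<comment> \<open>Data processing: a test function of the outer pair is a particular test
        function of the triple, so the bound for the triple includes the one for its
        projection.\<close>
      have sq: "(\<lambda>z. s (?q z)) \<in> test_functions e" using s by (auto simp: test_functions_def)
      have "exp ((\<alpha> - 1) * \<gamma>) \<le> R.hellinger" using \<pi>R by (simp add: R.renyi_divergence_le_iff_hellinger)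
      also have "\<dots> \<le> young_functional \<alpha> (\<lambda>z. s (?q z)) \<Psi> M"
        unfolding hell[symmetric] by (rule renyi_densities.hellinger_le_young[OF R\<Theta> sq e])
      also have "\<dots> = young_functional \<alpha> s (distr \<Psi> borel ?q) (\<mu>1 \<Otimes>\<^sub>M \<mu>3)"
        unfolding young_functional_def M13 by (simp add: integral_distr)
      finally show "exp ((\<alpha> - 1) * \<gamma>) \<le> young_functional \<alpha> s (distr \<Psi> borel ?q) (\<mu>1 \<Otimes>\<^sub>M \<mu>3)" .
    qed
  qed simp
  ultimately have "distr \<Psi> borel ?q \<in> renyi_couplings \<gamma> \<alpha> \<mu>1 \<mu>3" by (simp add: renyi_couplings_def)
  with s\<Psi>(1) \<Psi>1 \<Psi>23 show thesis by (rule that)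
qed

section \<open>The metric\<close>

text \<open>\<open>powr_convex\<close> covers the open half-line only. If \<open>x\<close> or
  \<open>y\<close> is 0, the claim reduces to \<open>r powr p \<le> r\<close> for a weight
  \<open>r\<close> in the unit interval.\<close>

lemma powr_convex_sum:
  fixes a b x y p :: real
  assumes p: "1 \<le> p" and ab: "0 < a" "0 < b" "a + b = 1" and xy: "0 \<le> x" "0 \<le> y"
  shows "(a * x + b * y) powr p \<le> a * x powr p + b * y powr p"
proof -
  have *: "(r * z) powr p \<le> r * z powr p" if "0 < r" "r \<le> 1" "0 \<le> z" for r z :: real
  proof -
    have "r powr p \<le> r powr 1" using that p by (intro powr_mono') auto
    then show ?thesis using that by (simp add: powr_mult mult_right_mono)
  qed
  consider "x = 0" | "y = 0" | "0 < x" "0 < y" using xy by linarith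
  then show ?thesis
  proof cases
    case 3
    have "convex_on {0<..} (\<lambda>x. x powr p)" using p by (rule powr_convex)
    moreover have "a = 1 - b" using ab by simp
    ultimately show ?thesis using convex_onD[of "{0<..}" "\<lambda>x. x powr p" b x y] 3 ab(1,2) by simp
  qed (use * ab xy in auto)
qed

text \<open>Minkowski's inequality, stated with bounds \<open>A\<close>, \<open>B > 0\<close> instead of norms to avoid vanishing denominators.\<close>

lemma nn_integral_powr_add_le:
  fixes u v :: "'a \<Rightarrow> real"
  assumes p: "1 \<le> p" and [measurable]: "u \<in> borel_measurable M" "v \<in> borel_measurable M"
    and nonneg: "\<And>x. 0 \<le> u x" "\<And>x. 0 \<le> v x" and AB: "0 < A" "0 < B"
    and u: "(\<integral>\<^sup>+x. ennreal (u x powr p) \<partial>M) \<le> ennreal (A powr p)"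
    and v: "(\<integral>\<^sup>+x. ennreal (v x powr p) \<partial>M) \<le> ennreal (B powr p)"
  shows "(\<integral>\<^sup>+x. ennreal ((u x + v x) powr p) \<partial>M) \<le> ennreal ((A + B) powr p)"
proof -
  \<comment> \<open>Convexity with weights \<open>A / (A + B)\<close> and \<open>B / (A + B)\<close>
    is applied to \<open>u / A\<close> and \<open>v / B\<close> and multiplied by
    \<open>(A + B) powr p\<close>; \<open>a\<close> and \<open>b\<close> are the resulting
    coefficients of \<open>u powr p\<close> and \<open>v powr p\<close>.\<close>
  define a b where "a = (A + B) powr p * (A / (A + B)) / A powr p" and "b = (A + B) powr p * (B / (A + B)) / B powr p"
  have ab: "0 \<le> a" "0 \<le> b" using AB by (auto simp: a_def b_def)
  have "(u x + v x) powr p \<le> a * u x powr p + b * v x powr p" for x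
  proof -
    have "A / (A + B) * (u x / A) + B / (A + B) * (v x / B) = (u x + v x) / (A + B)"
      using AB by (simp add: add_divide_distrib)
    moreover have "A / (A + B) + B / (A + B) = 1" using AB by (simp flip: add_divide_distrib)
    ultimately have "((u x + v x) / (A + B)) powr p \<le> A / (A + B) * (u x / A) powr p + B / (A + B) * (v x / B) powr p"
      using powr_convex_sum[OF p, of "A / (A + B)" "B / (A + B)" "u x / A" "v x / B"] AB nonneg by simp
    then have "(A + B) powr p * ((u x + v x) / (A + B)) powr p
        \<le> (A + B) powr p * (A / (A + B) * (u x / A) powr p + B / (A + B) * (v x / B) powr p)"
      by (intro mult_left_mono) auto
    then show ?thesis using AB nonneg[of x] by (simp add: powr_divide a_def b_def distrib_left)
  qed
  then have "(\<integral>\<^sup>+x. ennreal ((u x + v x) powr p) \<partial>M) \<le> (\<integral>\<^sup>+x. ennreal (a * u x powr p + b * v x powr p) \<partial>M)"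
    by (intro nn_integral_mono ennreal_leI)
  also have "\<dots> = (\<integral>\<^sup>+x. ennreal a * ennreal (u x powr p) + ennreal b * ennreal (v x powr p) \<partial>M)"
    using ab by (intro nn_integral_cong) (simp add: ennreal_plus ennreal_mult)
  also have "\<dots> = ennreal a * (\<integral>\<^sup>+x. ennreal (u x powr p) \<partial>M) + ennreal b * (\<integral>\<^sup>+x. ennreal (v x powr p) \<partial>M)"
    by (simp add: nn_integral_add nn_integral_cmult)
  also have "\<dots> \<le> ennreal a * ennreal (A powr p) + ennreal b * ennreal (B powr p)"
    by (intro add_mono mult_left_mono u v) auto
  also have "\<dots> = ennreal (a * A powr p + b * B powr p)"
    using ab by (simp add: ennreal_plus ennreal_mult)
  also have "a * A powr p + b * B powr p = (A + B) powr p"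
  proof -
    have "a * A powr p = (A + B) powr p * (A / (A + B))" "b * B powr p = (A + B) powr p * (B / (A + B))"
      using AB by (simp_all add: a_def b_def)
    moreover have "A / (A + B) + B / (A + B) = 1" using AB by (simp flip: add_divide_distrib)
    ultimately show ?thesis by (simp only: distrib_left[symmetric] mult_1_right)
  qed
  finally show ?thesis .
qed

lemma lower_semicontinuous_measurable:
  fixes f :: "'a::topological_space \<Rightarrow> real"
  shows "lower_semicontinuous f \<Longrightarrow> f \<in> borel_measurable borel"
  unfolding borel_measurable_iff_greater lower_semicontinuous_def by auto

lemma couplings_distr:
  fixes \<mu> \<nu> :: "'a::polish_space measure"
  assumes "\<mu> \<in> borel_probs" "\<nu> \<in> borel_probs" "\<pi> \<in> couplings \<mu> \<nu>"
  shows "distr \<pi> borel fst = \<mu>" "distr \<pi> borel snd = \<nu>"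
proof -
  note c = couplingsD[OF assms(3)] and m = borel_probsD[OF assms(1)] borel_probsD[OF assms(2)]
  note [measurable_cong] = c(2)
  show "distr \<pi> borel fst = \<mu>"
    by (rule measure_eqI) (auto simp: m emeasure_distr fst_vimage_eq_Times c)
  show "distr \<pi> borel snd = \<nu>"
    by (rule measure_eqI) (auto simp: m emeasure_distr snd_vimage_eq_Times c)
qed

lemma measurable_swap_borel [measurable]:
  "prod.swap \<in> borel_measurable (borel :: ('a::second_countable_topology \<times> 'a) measure)"
  unfolding prod.swap_def by measurable

text \<open>In variational form the constraint is visibly invariant: composing with the swap maps
  test functions to test functions, and the swap carries one product measure to the other.\<close>

lemma renyi_couplings_swap:
  fixes \<mu> \<nu> :: "'a::polish_space measure"
  assumes \<mu>: "\<mu> \<in> borel_probs" and \<nu>: "\<nu> \<in> borel_probs" and \<alpha>: "0 < \<alpha>" "\<alpha> < 1"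
    and \<pi>: "\<pi> \<in> renyi_couplings \<gamma> \<alpha> \<mu> \<nu>"
  shows "distr \<pi> borel prod.swap \<in> renyi_couplings \<gamma> \<alpha> \<nu> \<mu>"
proof -
  interpret \<mu>: prob_space \<mu> using \<mu> by (rule borel_probsD)
  interpret \<nu>: prob_space \<nu> using \<nu> by (rule borel_probsD)
  have \<pi>c: "\<pi> \<in> couplings \<mu> \<nu>" and \<pi>R: "renyi_divergence \<alpha> \<pi> (\<mu> \<Otimes>\<^sub>M \<nu>) \<le> ereal \<gamma>"
    using \<pi> by (simp_all add: renyi_couplings_def)
  interpret \<pi>: prob_space \<pi> using \<pi>c by (rule couplingsD)
  interpret pair_sigma_finite \<nu> \<mu> ..
  note [measurable_cong] = couplingsD(2)[OF \<pi>c]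
  have sm: "sets (\<mu> \<Otimes>\<^sub>M \<nu>) = sets borel" "sets (\<nu> \<Otimes>\<^sub>M \<mu>) = sets borel"
    using \<mu> \<nu> by (simp_all add: sets_pair_borel_probs)
  have swap_m: "prod.swap \<in> borel_measurable (\<mu> \<Otimes>\<^sub>M \<nu>)"
    unfolding measurable_cong_sets[OF sm(1) refl] by measurable
  have m: "\<nu> \<Otimes>\<^sub>M \<mu> = distr (\<mu> \<Otimes>\<^sub>M \<nu>) borel prod.swap"
    using distr_pair_swap distr_cong[OF refl sm(2), of "\<mu> \<Otimes>\<^sub>M \<nu>" "\<lambda>(x, y). (y, x)" prod.swap] by auto
  have "distr \<pi> borel prod.swap \<in> couplings \<nu> \<mu>"
    unfolding couplings_def borel_probs_def
  proof (intro CollectI conjI ballI)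
    show "prob_space (distr \<pi> borel prod.swap)" by (rule \<pi>.prob_space_distr) measurable
    fix A B :: "'a set" assume AB [measurable]: "A \<in> sets borel" "B \<in> sets borel"
    have "prod.swap -` (A \<times> (UNIV :: 'a set)) = UNIV \<times> A" "prod.swap -` ((UNIV :: 'a set) \<times> B) = B \<times> UNIV"
      by auto
    then show "emeasure (distr \<pi> borel prod.swap) (A \<times> UNIV) = emeasure \<nu> A"
      "emeasure (distr \<pi> borel prod.swap) (UNIV \<times> B) = emeasure \<mu> B"
      using couplingsD(3-5)[OF \<pi>c] AB by (simp_all add: emeasure_distr)
  qed simp
  moreover have "renyi_divergence \<alpha> (distr \<pi> borel prod.swap) (\<nu> \<Otimes>\<^sub>M \<mu>) \<le> ereal \<gamma>"
  proof (subst renyi_divergence_le_iff[OF \<alpha>])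
    show "finite_measure (distr \<pi> borel prod.swap)" by (rule \<pi>.finite_measure_distr) measurable
    show "finite_measure (\<nu> \<Otimes>\<^sub>M \<mu>)"
      using prob_space_pair_borel_probs[OF \<nu> \<mu>] by (rule prob_space.finite_measure)
    show "\<forall>e>0. \<forall>s\<in>test_functions e. exp ((\<alpha> - 1) * \<gamma>) \<le> young_functional \<alpha> s (distr \<pi> borel prod.swap) (\<nu> \<Otimes>\<^sub>M \<mu>)"
    proof (intro allI impI ballI)
      fix e :: real and s :: "'a \<times> 'a \<Rightarrow> real" assume e: "0 < e" and s: "s \<in> test_functions e"
      have [measurable]: "s \<in> borel_measurable borel" using s by (simp add: test_functions_def)
      have "(\<lambda>z. s (prod.swap z)) \<in> test_functions e" using s by (auto simp: test_functions_def)
      then have "exp ((\<alpha> - 1) * \<gamma>) \<le> young_functional \<alpha> (\<lambda>z. s (prod.swap z)) \<pi> (\<mu> \<Otimes>\<^sub>M \<nu>)"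
        using \<pi>R e prob_space.finite_measure[OF prob_space_pair_borel_probs[OF \<mu> \<nu>]]
        by (subst (asm) renyi_divergence_le_iff[OF \<alpha> \<pi>.finite_measure_axioms _ couplingsD(2)[OF \<pi>c] sm(1)]) auto
      also have "\<dots> = young_functional \<alpha> s (distr \<pi> borel prod.swap) (\<nu> \<Otimes>\<^sub>M \<mu>)"
        unfolding young_functional_def m using swap_m by (simp add: integral_distr)
      finally show "exp ((\<alpha> - 1) * \<gamma>) \<le> young_functional \<alpha> s (distr \<pi> borel prod.swap) (\<nu> \<Otimes>\<^sub>M \<mu>)" .
    qed
  qed (simp_all add: sm)
  ultimately show ?thesis by (simp add: renyi_couplings_def)
qed

section \<open>Metric axioms for the constrained transport distance\<close>

locale renyi_transport =
  fixes d :: "'a::polish_space \<Rightarrow> 'a \<Rightarrow> real" and c :: "'a \<times> 'a \<Rightarrow> real" and p \<alpha> \<gamma> :: real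
  assumes p: "1 \<le> p" and \<alpha>: "0 < \<alpha>" "\<alpha> < 1" and \<gamma>: "0 \<le> \<gamma>"
    and metric: "Metric_space UNIV d" and lsc: "lower_semicontinuous (\<lambda>(x, y). d x y)"
    and c_eq: "c = (\<lambda>(x, y). d x y powr p)"
begin

sublocale d: Metric_space UNIV d by (rule metric)

abbreviation cost :: "('a \<times> 'a) measure \<Rightarrow> ennreal" where
  "cost \<pi> \<equiv> \<integral>\<^sup>+z. ennreal (c z) \<partial>\<pi>"

lemma c_nonneg: "0 \<le> c z"
  by (simp add: c_eq split: prod.split)

lemma c_lsc: "lower_semicontinuous c"
  unfolding lower_semicontinuous_def
proof
  fix r
  show "open {z. r < c z}"
  \<comment> \<open>\<open>r powr (1 / p)\<close> inverts the power only for nonnegative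
    \<open>r\<close>; at negative levels the superlevel set is the whole space.\<close>
  proof (cases "r < 0")
    case True
    then have "{z. r < c z} = UNIV" using c_nonneg order_less_le_trans by blast
    then show ?thesis by simp
  next
    case False
    have "r < x powr p \<longleftrightarrow> r powr (1 / p) < x" if "0 \<le> x" for x
    proof -
      have r: "r = (r powr (1 / p)) powr p" using p False by (simp add: powr_powr)
      show ?thesis
      proof
        assume "r powr (1 / p) < x"
        then show "r < x powr p" using p by (subst r, intro powr_less_mono2) auto
      next
        assume "r < x powr p"
        then have "\<not> x powr p \<le> (r powr (1 / p)) powr p" using r by simp
        then show "r powr (1 / p) < x" using p that powr_mono2[of p x "r powr (1 / p)"] by linarith
      qed
    qed
    then have "{z. r < c z} = {z. r powr (1 / p) < (\<lambda>(x, y). d x y) z}"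
      by (auto simp: c_eq)
    then show ?thesis using lsc by (simp add: lower_semicontinuous_def)
  qed
qed

lemma c_measurable [measurable]: "c \<in> borel_measurable borel"
  by (rule lower_semicontinuous_measurable[OF c_lsc])

lemma d_measurable [measurable]: "(\<lambda>z. d (fst z) (snd z)) \<in> borel_measurable borel"
  using lower_semicontinuous_measurable[OF lsc] by (simp add: case_prod_beta')

text \<open>Only finiteness is at stake, so three distances are bounded crudely by three times their
  maximum. Two base points occur because the moments of the two measures may be given at different
  points.\<close>

lemma c_triangle: "c (x, y) \<le> 3 powr p * (c (x, x0) + c (y, y0) + c (x0, y0))"
proof -
  define m where "m = max (d x x0) (max (d y y0) (d x0 y0))"
  have "d x y \<le> d x x0 + d x0 y0 + d y0 y"
    using d.triangle[of x x0 y] d.triangle[of x0 y0 y] by simp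
  then have "d x y \<le> 3 * m" using d.commute[of y0 y] by (auto simp: m_def)
  then have "d x y powr p \<le> (3 * m) powr p" using p by (intro powr_mono2) auto
  also have "\<dots> = 3 powr p * m powr p" by (intro powr_mult)
  also have "m powr p \<le> c (x, x0) + c (y, y0) + c (x0, y0)"
    by (auto simp: m_def c_eq max_def)
  finally show ?thesis by (simp add: c_eq)
qed

lemma cost_finite:
  assumes \<mu>: "\<mu> \<in> prob_moment c" and \<nu>: "\<nu> \<in> prob_moment c" and \<pi>: "\<pi> \<in> couplings \<mu> \<nu>"
  shows "cost \<pi> < \<infinity>"
proof -
  obtain x0 y0 where x0: "(\<integral>\<^sup>+x. ennreal (c (x, x0)) \<partial>\<mu>) < \<infinity>" and y0: "(\<integral>\<^sup>+x. ennreal (c (x, y0)) \<partial>\<nu>) < \<infinity>"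
    using \<mu> \<nu> by (auto simp: prob_moment_def)
  have P: "\<mu> \<in> borel_probs" "\<nu> \<in> borel_probs" using \<mu> \<nu> by (auto simp: prob_moment_def)
  interpret \<pi>: prob_space \<pi> using \<pi> by (rule couplingsD)
  note [measurable_cong] = couplingsD(2)[OF \<pi>]
  have "cost \<pi> \<le> (\<integral>\<^sup>+z. ennreal (3 powr p) * (ennreal (c (fst z, x0)) + ennreal (c (snd z, y0)) + ennreal (c (x0, y0))) \<partial>\<pi>)"
  proof (rule nn_integral_mono)
    fix z
    have "ennreal (c z) \<le> ennreal (3 powr p * (c (fst z, x0) + c (snd z, y0) + c (x0, y0)))"
      using c_triangle[of "fst z" "snd z"] by (intro ennreal_leI) simp
    then show "ennreal (c z) \<le> ennreal (3 powr p) * (ennreal (c (fst z, x0)) + ennreal (c (snd z, y0)) + ennreal (c (x0, y0)))"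
      by (simp add: ennreal_mult ennreal_plus c_nonneg)
  qed
  also have "\<dots> = ennreal (3 powr p) * ((\<integral>\<^sup>+z. ennreal (c (fst z, x0)) \<partial>\<pi>) + (\<integral>\<^sup>+z. ennreal (c (snd z, y0)) \<partial>\<pi>) + ennreal (c (x0, y0)))"
    by (simp add: nn_integral_cmult nn_integral_add \<pi>.emeasure_space_1)
  also have "(\<integral>\<^sup>+z. ennreal (c (fst z, x0)) \<partial>\<pi>) = (\<integral>\<^sup>+x. ennreal (c (x, x0)) \<partial>\<mu>)"
    by (subst couplings_distr(1)[OF P \<pi>, symmetric], subst nn_integral_distr) auto
  also have "(\<integral>\<^sup>+z. ennreal (c (snd z, y0)) \<partial>\<pi>) = (\<integral>\<^sup>+x. ennreal (c (x, y0)) \<partial>\<nu>)"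
    by (subst couplings_distr(2)[OF P \<pi>, symmetric], subst nn_integral_distr) auto
  also have "ennreal (3 powr p) * ((\<integral>\<^sup>+x. ennreal (c (x, x0)) \<partial>\<mu>) + (\<integral>\<^sup>+x. ennreal (c (x, y0)) \<partial>\<nu>) + ennreal (c (x0, y0))) < \<infinity>"
    using x0 y0 by (simp add: ennreal_mult_less_top)
  finally show ?thesis .
qed

text \<open>Attainment gives \<open>LEAST\<close> its meaning, and the moment conditions make the
  minimum a real number \<open>v\<close>; from here on the distance is handled through
  \<open>v\<close> and a minimizer.\<close>

lemma renyi_dist_minimizer:
  assumes \<mu>: "\<mu> \<in> prob_moment c" and \<nu>: "\<nu> \<in> prob_moment c"
  obtains \<pi> v where "\<pi> \<in> renyi_couplings \<gamma> \<alpha> \<mu> \<nu>" "cost \<pi> = ennreal v" "0 \<le> v"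
    "\<And>\<pi>'. \<pi>' \<in> renyi_couplings \<gamma> \<alpha> \<mu> \<nu> \<Longrightarrow> ennreal v \<le> cost \<pi>'"
    "renyi_dist c p \<gamma> \<alpha> \<mu> \<nu> = ennreal (v powr (1 / p))"
proof -
  have P: "\<mu> \<in> borel_probs" "\<nu> \<in> borel_probs" using \<mu> \<nu> by (auto simp: prob_moment_def)
  obtain \<pi> where \<pi>: "\<pi> \<in> renyi_couplings \<gamma> \<alpha> \<mu> \<nu>"
    and min: "\<And>\<pi>'. \<pi>' \<in> renyi_couplings \<gamma> \<alpha> \<mu> \<nu> \<Longrightarrow> cost \<pi> \<le> cost \<pi>'"
    using renyi_couplings_minimizer[OF P \<alpha> \<gamma> c_lsc c_nonneg] by blast
  have "cost \<pi> < \<infinity>" using \<pi> by (intro cost_finite[OF \<mu> \<nu>]) (simp add: renyi_couplings_def)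
  then obtain v where v: "cost \<pi> = ennreal v" "0 \<le> v" by (cases "cost \<pi>") auto
  have "(LEAST v. v \<in> cost ` renyi_couplings \<gamma> \<alpha> \<mu> \<nu>) = cost \<pi>"
    using \<pi> min by (intro Least_equality) auto
  then have "renyi_dist c p \<gamma> \<alpha> \<mu> \<nu> = ennreal (v powr (1 / p))"
    using v by (simp add: renyi_dist_def ennreal_powr_def)
  with \<pi> v min show thesis by (intro that[of \<pi> v]) auto
qed

lemma renyi_dist_commute:
  assumes \<mu>: "\<mu> \<in> prob_moment c" and \<nu>: "\<nu> \<in> prob_moment c"
  shows "renyi_dist c p \<gamma> \<alpha> \<mu> \<nu> = renyi_dist c p \<gamma> \<alpha> \<nu> \<mu>"
proof -
  \<comment> \<open>The swap of a minimizer competes in the reversed problem. The statement is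
    general in the measures so that it yields both inequalities.\<close>
  have *: "v' \<le> v" if M: "\<mu> \<in> prob_moment c" "\<nu> \<in> prob_moment c"
    and \<pi>: "\<pi> \<in> renyi_couplings \<gamma> \<alpha> \<mu> \<nu>" "cost \<pi> = ennreal v" "0 \<le> v"
    and min: "\<And>\<pi>'. \<pi>' \<in> renyi_couplings \<gamma> \<alpha> \<nu> \<mu> \<Longrightarrow> ennreal v' \<le> cost \<pi>'" for \<mu> \<nu> \<pi> v v'
  proof -
    have P: "\<mu> \<in> borel_probs" "\<nu> \<in> borel_probs" using M by (auto simp: prob_moment_def)
    have "\<pi> \<in> couplings \<mu> \<nu>" using \<pi>(1) by (simp add: renyi_couplings_def)
    note [measurable_cong] = couplingsD(2)[OF this]
    have "ennreal v' \<le> cost (distr \<pi> borel prod.swap)"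
      by (intro min renyi_couplings_swap[OF P \<alpha> \<pi>(1)])
    also have "\<dots> = (\<integral>\<^sup>+z. ennreal (c (prod.swap z)) \<partial>\<pi>)" by (rule nn_integral_distr) measurable
    also have "\<dots> = cost \<pi>" by (intro nn_integral_cong) (auto simp: c_eq d.commute split: prod.split)
    finally show "v' \<le> v" using \<pi> by simp
  qed
  show ?thesis
    by (rule renyi_dist_minimizer[OF \<mu> \<nu>], rule renyi_dist_minimizer[OF \<nu> \<mu>])
      (metis * \<mu> \<nu> order_antisym)
qed

text \<open>Since the minimum is attained, some coupling has cost 0. It is concentrated on the
  diagonal, so its two coordinates, and hence its marginals, agree.\<close>

lemma renyi_dist_eq_0D:
  assumes \<mu>: "\<mu> \<in> prob_moment c" and \<nu>: "\<nu> \<in> prob_moment c" and 0: "renyi_dist c p \<gamma> \<alpha> \<mu> \<nu> = 0"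
  shows "\<mu> = \<nu>"
proof -
  have P: "\<mu> \<in> borel_probs" "\<nu> \<in> borel_probs" using \<mu> \<nu> by (auto simp: prob_moment_def)
  obtain \<pi> v where \<pi>: "\<pi> \<in> renyi_couplings \<gamma> \<alpha> \<mu> \<nu>" "cost \<pi> = ennreal v" "0 \<le> v"
    "renyi_dist c p \<gamma> \<alpha> \<mu> \<nu> = ennreal (v powr (1 / p))"
    by (rule renyi_dist_minimizer[OF \<mu> \<nu>]) blast
  then have \<pi>c: "\<pi> \<in> couplings \<mu> \<nu>" by (simp add: renyi_couplings_def)
  note [measurable_cong] = couplingsD(2)[OF \<pi>c]
  have "cost \<pi> = 0" using \<pi> 0 by simp
  then have "AE z in \<pi>. ennreal (c z) = 0"
    by (subst (asm) nn_integral_0_iff_AE) measurable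
  then have AE: "AE z in \<pi>. fst z = snd z"
    by eventually_elim (auto simp: c_eq split: prod.splits)
  have "distr \<pi> borel fst = distr \<pi> borel snd"
    by (rule distr_cong_AE[OF refl refl AE]) measurable
  then show ?thesis by (simp add: couplings_distr[OF P \<pi>c])
qed

lemma renyi_dist_triangle:
  assumes M: "\<mu>1 \<in> prob_moment c" "\<mu>2 \<in> prob_moment c" "\<mu>3 \<in> prob_moment c"
  shows "renyi_dist c p \<gamma> \<alpha> \<mu>1 \<mu>3 \<le> renyi_dist c p \<gamma> \<alpha> \<mu>1 \<mu>2 + renyi_dist c p \<gamma> \<alpha> \<mu>2 \<mu>3"
proof -
  have P: "\<mu>1 \<in> borel_probs" "\<mu>2 \<in> borel_probs" "\<mu>3 \<in> borel_probs" using M by (auto simp: prob_moment_def)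
  obtain \<pi> a where \<pi>: "\<pi> \<in> renyi_couplings \<gamma> \<alpha> \<mu>1 \<mu>2" "cost \<pi> = ennreal a" "0 \<le> a"
    "renyi_dist c p \<gamma> \<alpha> \<mu>1 \<mu>2 = ennreal (a powr (1 / p))"
    by (rule renyi_dist_minimizer[OF M(1,2)]) blast
  obtain \<tau> b where \<tau>: "\<tau> \<in> renyi_couplings \<gamma> \<alpha> \<mu>2 \<mu>3" "cost \<tau> = ennreal b" "0 \<le> b"
    "renyi_dist c p \<gamma> \<alpha> \<mu>2 \<mu>3 = ennreal (b powr (1 / p))"
    by (rule renyi_dist_minimizer[OF M(2,3)]) blast
  obtain v where v: "0 \<le> v" "\<And>\<pi>'. \<pi>' \<in> renyi_couplings \<gamma> \<alpha> \<mu>1 \<mu>3 \<Longrightarrow> ennreal v \<le> cost \<pi>'"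
    "renyi_dist c p \<gamma> \<alpha> \<mu>1 \<mu>3 = ennreal (v powr (1 / p))"
    by (rule renyi_dist_minimizer[OF M(1,3)]) blast
  have "\<tau> \<in> couplings \<mu>2 \<mu>3" using \<tau>(1) by (simp add: renyi_couplings_def)
  then obtain \<Psi> :: "(('a \<times> 'a) \<times> 'a) measure" where s [measurable_cong]: "sets \<Psi> = sets borel"
    and \<Psi>: "distr \<Psi> borel fst = \<pi>" "distr \<Psi> borel (\<lambda>z. (snd (fst z), snd z)) = \<tau>"
      "distr \<Psi> borel (\<lambda>z. (fst (fst z), snd z)) \<in> renyi_couplings \<gamma> \<alpha> \<mu>1 \<mu>3"
    by (rule renyi_couplings_glue[OF P \<alpha> \<pi>(1)])
  let ?u = "\<lambda>z::('a \<times> 'a) \<times> 'a. d (fst (fst z)) (snd (fst z))" and ?v = "\<lambda>z::('a \<times> 'a) \<times> 'a. d (snd (fst z)) (snd z)"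
  have [measurable]: "?u \<in> borel_measurable \<Psi>"
    using measurable_compose[OF measurable_fst_borel d_measurable] measurable_cong_sets[OF s refl] by simp
  have [measurable]: "?v \<in> borel_measurable \<Psi>"
  proof -
    have "(\<lambda>z. (snd (fst z), snd z)) \<in> borel_measurable \<Psi>" by measurable
    from measurable_compose[OF this d_measurable] show ?thesis by simp
  qed
  have u: "(\<integral>\<^sup>+z. ennreal (?u z powr p) \<partial>\<Psi>) = ennreal a"
  proof -
    have "cost \<pi> = (\<integral>\<^sup>+z. ennreal (c (fst z)) \<partial>\<Psi>)"
      unfolding \<Psi>(1)[symmetric] by (rule nn_integral_distr) measurable
    then show ?thesis using \<pi>(2) by (simp add: c_eq case_prod_beta)
  qed
  have v': "(\<integral>\<^sup>+z. ennreal (?v z powr p) \<partial>\<Psi>) = ennreal b"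
  proof -
    have "cost \<tau> = (\<integral>\<^sup>+z. ennreal (c (snd (fst z), snd z)) \<partial>\<Psi>)"
      unfolding \<Psi>(2)[symmetric] by (rule nn_integral_distr) measurable
    then show ?thesis using \<tau>(2) by (simp add: c_eq)
  qed
  \<comment> \<open>\<open>A\<close> and \<open>B\<close> strictly exceed the two distances, so they
    are positive even if a distance is 0, as Minkowski's inequality demands; the excess is removed
    by letting it tend to 0.\<close>
  have le: "v powr (1 / p) \<le> A + B" if A: "a powr (1 / p) < A" and B: "b powr (1 / p) < B" for A B
  proof -
    have pos: "0 < A" "0 < B" using A B powr_ge_zero[of a "1 / p"] powr_ge_zero[of b "1 / p"] by linarith+
    have "a = (a powr (1 / p)) powr p" "b = (b powr (1 / p)) powr p"
      using p \<pi>(3) \<tau>(3) by (simp_all add: powr_powr)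
    then have ab: "a \<le> A powr p" "b \<le> B powr p"
      using A B p powr_mono2[of p "a powr (1 / p)" A] powr_mono2[of p "b powr (1 / p)" B] by simp_all
    have "ennreal v \<le> cost (distr \<Psi> borel (\<lambda>z. (fst (fst z), snd z)))" by (rule v(2)[OF \<Psi>(3)])
    also have "\<dots> = (\<integral>\<^sup>+z. ennreal (c (fst (fst z), snd z)) \<partial>\<Psi>)" by (rule nn_integral_distr) measurable
    also have "\<dots> \<le> (\<integral>\<^sup>+z. ennreal ((?u z + ?v z) powr p) \<partial>\<Psi>)"
      using p by (intro nn_integral_mono ennreal_leI) (auto simp: c_eq intro!: powr_mono2 d.triangle)
    also have "\<dots> \<le> ennreal ((A + B) powr p)"
      using ab by (intro nn_integral_powr_add_le p pos) (simp_all add: u v' ennreal_leI)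
    finally have "v \<le> (A + B) powr p" by simp
    then have "v powr (1 / p) \<le> ((A + B) powr p) powr (1 / p)" using v(1) p by (intro powr_mono2) auto
    then show ?thesis using p pos by (simp add: powr_powr)
  qed
  have "v powr (1 / p) \<le> a powr (1 / p) + b powr (1 / p)"
  proof (rule field_le_epsilon)
    fix e :: real assume "0 < e"
    then show "v powr (1 / p) \<le> a powr (1 / p) + b powr (1 / p) + e"
      using le[of "a powr (1 / p) + e / 2" "b powr (1 / p) + e / 2"] by simp
  qed
  then show ?thesis unfolding \<pi>(4) \<tau>(4) v(3) by (simp flip: ennreal_plus add: ennreal_leI)
qed

lemma renyi_dist_finite:
  assumes "\<mu> \<in> prob_moment c" "\<nu> \<in> prob_moment c"
  shows "renyi_dist c p \<gamma> \<alpha> \<mu> \<nu> < \<infinity>"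
  by (rule renyi_dist_minimizer[OF assms]) simp

end

theorem theorem2p1:
  fixes c :: "'a::polish_space \<times> 'a \<Rightarrow> real" and p \<alpha> \<gamma> :: real
  assumes "1 \<le> p" and "0 < \<alpha>" and "\<alpha> < 1" and "0 \<le> \<gamma>"
    and "c \<in> metric_costs p"
  shows "(\<forall>\<mu>\<in>prob_moment c. \<forall>\<nu>\<in>prob_moment c. renyi_dist_tilde c p \<gamma> \<alpha> \<mu> \<nu> < \<infinity>) \<and>
         Metric_space (prob_moment c) (\<lambda>\<mu> \<nu>. enn2real (renyi_dist_tilde c p \<gamma> \<alpha> \<mu> \<nu>))"
proof -
  obtain d where "Metric_space UNIV d" "lower_semicontinuous (\<lambda>(x, y). d x y)" "c = (\<lambda>(x, y). d x y powr p)"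
    using assms(5) by (auto simp: metric_costs_def)
  then interpret renyi_transport d c p \<alpha> \<gamma>
    using assms by (intro renyi_transport.intro)
  have fin: "renyi_dist_tilde c p \<gamma> \<alpha> \<mu> \<nu> < \<infinity>" for \<mu> \<nu>
    using renyi_dist_finite by (simp add: renyi_dist_tilde_def)
  have "Metric_space (prob_moment c) (\<lambda>\<mu> \<nu>. enn2real (renyi_dist_tilde c p \<gamma> \<alpha> \<mu> \<nu>))"
  proof
    fix \<mu> \<nu>
    show "enn2real (renyi_dist_tilde c p \<gamma> \<alpha> \<mu> \<nu>) = enn2real (renyi_dist_tilde c p \<gamma> \<alpha> \<nu> \<mu>)"
      by (auto simp: renyi_dist_tilde_def renyi_dist_commute)
  next
    fix \<mu> \<nu> assume M: "\<mu> \<in> prob_moment c" "\<nu> \<in> prob_moment c"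
    show "enn2real (renyi_dist_tilde c p \<gamma> \<alpha> \<mu> \<nu>) = 0 \<longleftrightarrow> \<mu> = \<nu>"
    proof
      assume "enn2real (renyi_dist_tilde c p \<gamma> \<alpha> \<mu> \<nu>) = 0"
      \<comment> \<open>\<open>enn2real\<close> sends \<open>\<infinity>\<close> to 0 as well, so
        finiteness is needed here.\<close>
      then have "renyi_dist_tilde c p \<gamma> \<alpha> \<mu> \<nu> = 0" using fin[of \<mu> \<nu>] by (auto simp: enn2real_eq_0_iff)
      then show "\<mu> = \<nu>" using renyi_dist_eq_0D[OF M] M by (auto simp: renyi_dist_tilde_def split: if_splits)
    qed (simp add: renyi_dist_tilde_def)
  next
    fix \<mu>1 \<mu>2 \<mu>3 assume M: "\<mu>1 \<in> prob_moment c" "\<mu>2 \<in> prob_moment c" "\<mu>3 \<in> prob_moment c"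
    \<comment> \<open>If two of the measures coincide, the value 0 on the diagonal makes the
      inequality trivial; \<open>renyi_dist_triangle\<close> settles three distinct
      measures.\<close>
    have "renyi_dist_tilde c p \<gamma> \<alpha> \<mu>1 \<mu>3 \<le> renyi_dist_tilde c p \<gamma> \<alpha> \<mu>1 \<mu>2 + renyi_dist_tilde c p \<gamma> \<alpha> \<mu>2 \<mu>3"
      using M renyi_dist_triangle[OF M] by (auto simp: renyi_dist_tilde_def)
    then have "enn2real (renyi_dist_tilde c p \<gamma> \<alpha> \<mu>1 \<mu>3)
        \<le> enn2real (renyi_dist_tilde c p \<gamma> \<alpha> \<mu>1 \<mu>2 + renyi_dist_tilde c p \<gamma> \<alpha> \<mu>2 \<mu>3)"
      using fin by (intro enn2real_mono) auto
    then show "enn2real (renyi_dist_tilde c p \<gamma> \<alpha> \<mu>1 \<mu>3)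
        \<le> enn2real (renyi_dist_tilde c p \<gamma> \<alpha> \<mu>1 \<mu>2) + enn2real (renyi_dist_tilde c p \<gamma> \<alpha> \<mu>2 \<mu>3)"
      using fin by (simp add: enn2real_plus)
  qed simp
  with fin show ?thesis by blast
qed

end
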